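(* Let $m>0$, $|a|<m$, $S<0$, $R,\widetilde R\in\mathbb R$. Let $\psi$ be an acceptable solution of $\square_{\mathbf g}\psi=N$ on the Kerr exterior, let $\widetilde\psi=\mathfrak W[\psi]$ be its (outgoing) generalized Whiting transform, and assume the radiation field $\widetilde\psi_\infty$ of $\widetilde\psi$ at $\widetilde{\mathcal I}^+=\{X=-\infty\}$ has enough regularity. Then for every $M>0$ $$\int_{\mathcal H^+}\big|\Pi_{\mathcal A_M}T_+^{1/2}\psi\big|^2+\big|\Pi_{\mathcal A_M}\psi\big|^2\;dv\,d\omega\;\lesssim_M\;\int_{\widetilde{\mathcal I}^+}\big|\Pi_{\mathcal A_M}T\widetilde\psi_\infty\big|^2\,d\widetilde u\,d\omega .$$ The conclusion remains true after applying (to both $\psi$ and $\widetilde\psi$) $T$, $Z$, or the corresponding half-derivatives $T^{1/2},T_+^{1/2}$.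
   Context: **Kerr.** $\Delta=r^2-2mr+a^2=(r-r_+)(r-r_-)$, $r_\pm=m\pm\sqrt{m^2-a^2}$; Boyer–Lindquist coordinates $(t,r,\theta,\phi)$; $r_*'=\frac{r^2+a^2}\Delta$, $\phi_*'=\frac a\Delta$; $u=t-r_*$, $\phi_-=\phi-\phi_*$, $v=t+r_*$, $\phi_+=\phi+\phi_*$. $T=\partial_t$, $Z=\partial_\phi$. $\mathcal H^+=\{r=r_+\}$ with coordinates $(v,\theta,\phi_+)$. Time function $\widehat\tau$: equal to $t+f(r)$ for $r\le4m$, where $f'=\frac{r^2+a^2}\Delta-\frac{m^2}{r^2}$ there, equal to $u+m\ln r$ for $r\ge5m$, smoothly interpolated in between with spacelike level sets. **Acceptable**: $\psi\in C_c^\infty(\mathbb R_{\widehat\tau}\times[r_+,\infty)_r\times\mathbb S^2)$ (in coordinates regular up to the future horizon). **Transform.** With $X=S(\widetilde r-\widetilde R)$ and $\psi$ in coordinates $(u,r,\theta,\phi_-)$, $\mathfrak W[\psi](\widetilde v,\widetilde r,\widetilde\theta,\widetilde\varphi)=\int_{r_+}^\infty\psi(\widetilde v+X(r-R),r,\widetilde\theta,\widetilde\varphi)\,dr$; $T=\partial_{\widetilde v}$, $Z=\partial_{\widetilde\varphi}$ on the transformed side. **Outgoing coordinates and radiation field ($X<-2$).** $\widetilde t=\widetilde v-\widetilde r^*$, $\frac{d\widetilde r^*}{d\widetilde r}=\frac{(R-m)X+2R}{\widetilde r-\widetilde R+2/S}$, $\widetilde u=\widetilde t-\int\frac{\sqrt{(m^2-a^2)X^2-4a^2X-4a^2}}{\widetilde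 r-\widetilde R+2/S}d\widetilde r$, $\widetilde\varphi_-=\widetilde\varphi-\int\frac{a}{\sqrt{m^2-a^2}}\frac{d\widetilde r}{\widetilde r-\widetilde R}$; $\widetilde\psi_\infty=\lim_{X\to-\infty}|X+1|\widetilde\psi$ at fixed $(\widetilde u,\widetilde\theta,\widetilde\varphi_-)$; $\widetilde{\mathcal I}^+$ has coordinates $(\widetilde u,\widetilde\theta,\widetilde\varphi_-)$. $d\omega$ is the standard measure of $\mathbb S^2$. **Frequencies.** Functions are decomposed in azimuthal modes $e^{in\phi_+}$ (on Kerr, with time variable $v$), respectively $e^{in\widetilde\varphi_-}$ (on the transformed side, with time variable $\widetilde u$), and Fourier transformed in time, $\mathcal F[f_n](\xi)=\int e^{-i\xi x}f_n(x)\,dx$. Set $\omega_+=\frac a{2mr_+}$, $\lambda_+=\frac{4mr_+}{r_+-r_-}$, $\beta_+=\lambda_+(\xi+\omega_+n)$. $T^{1/2}$ and $T_+^{1/2}$ are the multipliers $|\xi|^{1/2}$ and $|\xi+\omega_+n|^{1/2}$ (here $T_+=T+\omega_+Z$). $\mathcal A_M=\{(\xi,n):\beta_+\xi\ge0\}\cup\{(\xi,n):|\beta_+|\le M\}$, and $\Pi_{\mathcal A_M}$ is the corresponding frequency projection (multiplication by the indicator function of $\mathcal A_M$ on the Fourier side). The implicit constant depends on $M$ (and $a,m,S$) only. *)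

theory Defs
  imports "HOL-Analysis.Analysis"
begin

section \<open>Smoothness\<close>

text \<open>\<open>Ck k U f\<close> is meant for open \<open>U\<close> in a finite-dimensional space.\<close>

primrec Ck :: "nat \<Rightarrow> 'a::real_normed_vector set \<Rightarrow> ('a \<Rightarrow> 'b::real_normed_vector) \<Rightarrow> bool" where
  "Ck 0 U f = continuous_on U f"
| "Ck (Suc k) U f =
     (f differentiable_on U \<and> (\<forall>e. Ck k U (\<lambda>x. frechet_derivative f (at x) e)))"

text \<open>Regularity on a set that need not be open, such as a manifold with boundary embedded in a
  Euclidean space: existence of an extension of that regularity to a neighbourhood.\<close>

definition Ck_upto :: "nat \<Rightarrow> 'a::real_normed_vector set \<Rightarrow> ('a \<Rightarrow> 'b::real_normed_vector) \<Rightarrow> bool" where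
  "Ck_upto k A f \<longleftrightarrow>
     (\<exists>U F. open U \<and> A \<subseteq> U \<and> Ck k U F \<and> (\<forall>x\<in>A. F x = f x))"

definition smooth_upto :: "'a::real_normed_vector set \<Rightarrow> ('a \<Rightarrow> 'b::real_normed_vector) \<Rightarrow> bool" where
  "smooth_upto A f \<longleftrightarrow>
     (\<exists>U F. open U \<and> A \<subseteq> U \<and> (\<forall>k. Ck k U F) \<and> (\<forall>x\<in>A. F x = f x))"


section \<open>The Kerr exterior\<close>

definition rplus :: "real \<Rightarrow> real \<Rightarrow> real" where
  "rplus m a = m + sqrt (m\<^sup>2 - a\<^sup>2)"

definition rminus :: "real \<Rightarrow> real \<Rightarrow> real" where
  "rminus m a = m - sqrt (m\<^sup>2 - a\<^sup>2)"

definition Delta :: "real \<Rightarrow> real \<Rightarrow> real \<Rightarrow> real" where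
  "Delta m a r = r\<^sup>2 - 2 * m * r + a\<^sup>2"

text \<open>Boyer--Lindquist coordinates \<open>x = (t, r, \<theta>, \<phi>)\<close>, signature \<open>(-,+,+,+)\<close>.\<close>

definition kerr_metric :: "real \<Rightarrow> real \<Rightarrow> real ^ 4 \<Rightarrow> real ^ 4 ^ 4" where
  "kerr_metric m a x =
     (let r = x $ 2; s = (sin (x $ 3))\<^sup>2; \<Sigma> = r\<^sup>2 + a\<^sup>2 * (cos (x $ 3))\<^sup>2 in
      vector
        [vector [- (1 - 2 * m * r / \<Sigma>), 0, 0, - (2 * m * a * r * s / \<Sigma>)],
         vector [0, \<Sigma> / Delta m a r, 0, 0],
         vector [0, 0, \<Sigma>, 0],
         vector [- (2 * m * a * r * s / \<Sigma>), 0, 0,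
                 s * (r\<^sup>2 + a\<^sup>2 + 2 * m * a\<^sup>2 * r * s / \<Sigma>)]])"

definition partial_deriv :: "4 \<Rightarrow> (real ^ 4 \<Rightarrow> complex) \<Rightarrow> real ^ 4 \<Rightarrow> complex" where
  "partial_deriv i F x = frechet_derivative F (at x) (axis i 1)"

definition dalembertian :: "(real ^ 4 \<Rightarrow> real ^ 4 ^ 4) \<Rightarrow> (real ^ 4 \<Rightarrow> complex) \<Rightarrow> real ^ 4 \<Rightarrow> complex" where
  "dalembertian g F x =
     (\<Sum>i\<in>UNIV. \<Sum>j\<in>UNIV.
        partial_deriv i
          (\<lambda>y. (sqrt \<bar>det (g y)\<bar> * matrix_inv (g y) $ i $ j) *\<^sub>R partial_deriv j F y) x)
     /\<^sub>R sqrt \<bar>det (g x)\<bar>"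

definition sph :: "real \<Rightarrow> real \<Rightarrow> real ^ 3" where
  "sph \<theta> \<phi> = vector [sin \<theta> * cos \<phi>, sin \<theta> * sin \<phi>, cos \<theta>]"

text \<open>The exterior together with its future horizon is modelled as
  \<open>\<real>\<^sub>v \<times> [r\<^sub>+,\<infinity>)\<^sub>r \<times> S\<^sup>2\<close> in the horizon-regular coordinates
  \<open>(v, r, \<theta>, \<phi>\<^sub>+)\<close>, with \<open>S\<^sup>2\<close> the unit sphere of \<open>\<real>\<^sup>3\<close> and \<open>(\<theta>, \<phi>\<^sub>+)\<close> the
  point \<open>sph \<theta> \<phi>\<^sub>+\<close>. Values of a spacetime function off this set are irrelevant.\<close>

type_synonym spacetime_fun = "real \<times> real \<times> (real ^ 3) \<Rightarrow> complex"

definition exterior :: "real \<Rightarrow> real \<Rightarrow> (real \<times> real \<times> (real ^ 3)) set" where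
  "exterior m a = UNIV \<times> {rplus m a..} \<times> sphere 0 1"

text \<open>\<open>r\<^sub>*\<close> and \<open>\<phi>\<^sub>*\<close> are only determined up to additive constants.\<close>

definition kerr_star :: "real \<Rightarrow> real \<Rightarrow> (real \<Rightarrow> real) \<Rightarrow> (real \<Rightarrow> real) \<Rightarrow> bool" where
  "kerr_star m a rstar phistar \<longleftrightarrow>
     (\<forall>r > rplus m a.
        (rstar has_real_derivative (r\<^sup>2 + a\<^sup>2) / Delta m a r) (at r) \<and>
        (phistar has_real_derivative a / Delta m a r) (at r))"

definition boyer_lindquist ::
    "(real \<Rightarrow> real) \<Rightarrow> (real \<Rightarrow> real) \<Rightarrow> spacetime_fun \<Rightarrow> real ^ 4 \<Rightarrow> complex" where
  "boyer_lindquist rstar phistar psi x =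
     psi (x $ 1 + rstar (x $ 2), x $ 2, sph (x $ 3) (x $ 4 + phistar (x $ 2)))"

text \<open>Coordinates \<open>(u, r, \<theta>, \<phi>\<^sub>-)\<close>: here \<open>v = u + 2 r\<^sub>*\<close> and
  \<open>\<phi>\<^sub>+ = \<phi>\<^sub>- + 2 \<phi>\<^sub>*\<close>.\<close>

definition outgoing ::
    "(real \<Rightarrow> real) \<Rightarrow> (real \<Rightarrow> real) \<Rightarrow> spacetime_fun \<Rightarrow> real \<Rightarrow> real \<Rightarrow> real \<Rightarrow> real \<Rightarrow> complex" where
  "outgoing rstar phistar psi u r \<theta> \<phi> =
     psi (u + 2 * rstar r, r, sph \<theta> (\<phi> + 2 * phistar r))"

definition solves_wave ::
    "real \<Rightarrow> real \<Rightarrow> (real \<Rightarrow> real) \<Rightarrow> (real \<Rightarrow> real) \<Rightarrow> spacetime_fun \<Rightarrow> spacetime_fun \<Rightarrow> bool" where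
  "solves_wave m a rstar phistar psi N \<longleftrightarrow>
     (\<forall>x. x $ 2 > rplus m a \<and> 0 < x $ 3 \<and> x $ 3 < pi \<longrightarrow>
        dalembertian (kerr_metric m a) (boyer_lindquist rstar phistar psi) x
        = boyer_lindquist rstar phistar N x)"

text \<open>The time function is written \<open>v + h(r)\<close>, that is \<open>t + (r\<^sub>* + h)(r)\<close>, so that it makes
  sense on the horizon. Its level sets are spacelike iff its differential, with components
  \<open>(1, (r\<^sub>* + h)', 0, 0)\<close> in Boyer--Lindquist coordinates, is timelike.\<close>

definition kerr_time :: "real \<Rightarrow> real \<Rightarrow> (real \<Rightarrow> real) \<Rightarrow> (real \<Rightarrow> real) \<Rightarrow> bool" where
  "kerr_time m a rstar h \<longleftrightarrow>
     smooth_upto {rplus m a..} h \<and>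
     (\<forall>r. rplus m a < r \<and> r \<le> 4 * m \<longrightarrow>
        ((\<lambda>s. rstar s + h s) has_real_derivative (r\<^sup>2 + a\<^sup>2) / Delta m a r - m\<^sup>2 / r\<^sup>2) (at r)) \<and>
     (\<forall>r \<ge> 5 * m. rstar r + h r = - rstar r + m * ln r) \<and>
     (\<forall>r \<theta>. rplus m a < r \<and> 0 < \<theta> \<and> \<theta> < pi \<longrightarrow>
        (let w = vector [1, deriv (\<lambda>s. rstar s + h s) r, 0, 0] :: real ^ 4 in
         w \<bullet> (matrix_inv (kerr_metric m a (vector [0, r, \<theta>, 0])) *v w) < 0))"

definition acceptable :: "real \<Rightarrow> real \<Rightarrow> (real \<Rightarrow> real) \<Rightarrow> spacetime_fun \<Rightarrow> bool" where
  "acceptable m a h psi \<longleftrightarrow>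
     smooth_upto (exterior m a) psi \<and>
     (\<exists>K. compact K \<and> K \<subseteq> UNIV \<times> {rplus m a..} \<and>
        (\<forall>v r \<omega>. (v, r, \<omega>) \<in> exterior m a \<and> psi (v, r, \<omega>) \<noteq> 0 \<longrightarrow> (v + h r, r) \<in> K))"


section \<open>The transform and its radiation field\<close>

definition whiting ::
    "real \<Rightarrow> real \<Rightarrow> real \<Rightarrow> real \<Rightarrow> real \<Rightarrow> (real \<Rightarrow> real) \<Rightarrow> (real \<Rightarrow> real) \<Rightarrow> spacetime_fun
     \<Rightarrow> real \<Rightarrow> real \<Rightarrow> real \<Rightarrow> real \<Rightarrow> complex" where
  "whiting m a S R Rt rstar phistar psi vt rt \<theta> \<phi> =
     (LINT r:{rplus m a<..}|lborel.
        outgoing rstar phistar psi (vt + S * (rt - Rt) * (r - R)) r \<theta> \<phi>)"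

text \<open>In the region \<open>X < -2\<close>: \<open>rst\<close> is the transformed tortoise coordinate, and \<open>q\<close>, \<open>p\<close> are the
  antiderivatives entering \<open>u' = v' - rst - q\<close> and \<open>\<phi>'\<^sub>- = \<phi>' - p\<close> (primes standing for
  the tildes of the transformed side). Each is determined up to an additive constant.\<close>

definition transformed_coords ::
    "real \<Rightarrow> real \<Rightarrow> real \<Rightarrow> real \<Rightarrow> real \<Rightarrow> (real \<Rightarrow> real) \<Rightarrow> (real \<Rightarrow> real) \<Rightarrow> (real \<Rightarrow> real) \<Rightarrow> bool" where
  "transformed_coords m a S R Rt rst q p \<longleftrightarrow>
     (\<forall>rt. let X = S * (rt - Rt) in X < -2 \<longrightarrow>
        (rst has_real_derivative ((R - m) * X + 2 * R) / (rt - Rt + 2 / S)) (at rt) \<and>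
        (q has_real_derivative
           sqrt ((m\<^sup>2 - a\<^sup>2) * X\<^sup>2 - 4 * a\<^sup>2 * X - 4 * a\<^sup>2) / (rt - Rt + 2 / S)) (at rt) \<and>
        (p has_real_derivative a / sqrt (m\<^sup>2 - a\<^sup>2) * (1 / (rt - Rt))) (at rt))"

text \<open>\<open>psit\<close> is a function of the transformed coordinates (time, radius, polar and azimuthal
  angle); \<open>psinf\<close> is a function on null infinity, regarded as \<open>\<real> \<times> S\<^sup>2\<close>. The radius is
  expressed through \<open>X\<close>.\<close>

definition radiation_field ::
    "real \<Rightarrow> real \<Rightarrow> (real \<Rightarrow> real) \<Rightarrow> (real \<Rightarrow> real) \<Rightarrow> (real \<Rightarrow> real)
     \<Rightarrow> (real \<Rightarrow> real \<Rightarrow> real \<Rightarrow> real \<Rightarrow> complex) \<Rightarrow> (real \<times> (real ^ 3) \<Rightarrow> complex) \<Rightarrow> bool" where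
  "radiation_field S Rt rst q p psit psinf \<longleftrightarrow>
     (\<forall>ut \<theta> \<phi>. 0 \<le> \<theta> \<and> \<theta> \<le> pi \<longrightarrow>
        ((\<lambda>X. let rt = Rt + X / S in
              of_real \<bar>X + 1\<bar> * psit (ut + rst rt + q rt) rt \<theta> (\<phi> + p rt))
         \<longlongrightarrow> psinf (ut, sph \<theta> \<phi>)) at_bot)"


section \<open>Boundary fields and Fourier multipliers\<close>

text \<open>A field on the horizon or on null infinity, as a function of (time, polar angle, azimuthal
  angle), where (time, azimuth) is \<open>(v, \<phi>\<^sub>+)\<close>, respectively the retarded time and
  \<open>\<phi>\<^sub>-\<close> of the transformed side. \<open>cyl\<close> is the measure \<open>dx d\<omega> = sin \<theta> dx d\<theta> d\<phi>\<close>.\<close>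

type_synonym field = "real \<times> real \<times> real \<Rightarrow> complex"

definition horizon_field :: "real \<Rightarrow> real \<Rightarrow> spacetime_fun \<Rightarrow> field" where
  "horizon_field m a psi = (\<lambda>(v, \<theta>, \<phi>). psi (v, rplus m a, sph \<theta> \<phi>))"

definition scri_field :: "(real \<times> (real ^ 3) \<Rightarrow> complex) \<Rightarrow> field" where
  "scri_field psinf = (\<lambda>(x, \<theta>, \<phi>). psinf (x, sph \<theta> \<phi>))"

definition cyl :: "(real \<times> real \<times> real) measure" where
  "cyl = density lborel
     (\<lambda>(x, \<theta>, \<phi>). indicator ({0..pi} \<times> {0..2 * pi}) (\<theta>, \<phi>) * ennreal (sin \<theta>))"

definition L2_field :: "field \<Rightarrow> bool" where
  "L2_field f \<longleftrightarrow>
     f \<in> borel_measurable cyl \<and> (\<integral>\<^sup>+ z. ennreal ((cmod (f z))\<^sup>2) \<partial>cyl) < \<infinity>"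

definition dT :: "field \<Rightarrow> field" where
  "dT f = (\<lambda>(x, \<theta>, \<phi>). vector_derivative (\<lambda>s. f (s, \<theta>, \<phi>)) (at x))"

definition dZ :: "field \<Rightarrow> field" where
  "dZ f = (\<lambda>(x, \<theta>, \<phi>). vector_derivative (\<lambda>s. f (x, \<theta>, s)) (at \<phi>))"

text \<open>Sufficient regularity of the radiation field. The field itself is in general not square
  integrable (it need not decay at late retarded times), so only fields with at least one
  \<open>T\<close>-derivative are required to be.\<close>

definition regular_radiation_field :: "(real \<times> (real ^ 3) \<Rightarrow> complex) \<Rightarrow> bool" where
  "regular_radiation_field psinf \<longleftrightarrow>
     Ck_upto 2 (UNIV \<times> sphere 0 1) psinf \<and>
     L2_field (dT (scri_field psinf)) \<and>
     L2_field (dT (dT (scri_field psinf))) \<and>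
     L2_field (dT (dZ (scri_field psinf)))"

definition az_mode :: "int \<Rightarrow> field \<Rightarrow> real \<Rightarrow> real \<Rightarrow> complex" where
  "az_mode n f \<theta> x =
     (LINT \<phi>:{0..2 * pi}|lborel. cis (- (of_int n * \<phi>)) * f (x, \<theta>, \<phi>)) / (2 * of_real pi)"

text \<open>\<open>g\<close> is the (Plancherel) Fourier transform of \<open>f \<in> L\<^sup>2(\<real>)\<close>: the \<open>L\<^sup>2\<close>-limit of the
  truncated integrals \<open>\<integral>\<^sub>-\<^sub>L\<^sup>L e\<^sup>-\<^sup>i\<^sup>\<xi>\<^sup>x f(x) dx\<close>. The \<open>L\<^sup>1\<close> definition would not do, since
  the \<open>T\<close>-derivative of the radiation field is in general not integrable in time.\<close>

definition L2_fourier :: "(real \<Rightarrow> complex) \<Rightarrow> (real \<Rightarrow> complex) \<Rightarrow> bool" where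
  "L2_fourier f g \<longleftrightarrow>
     f \<in> borel_measurable lborel \<and> (\<integral>\<^sup>+ x. ennreal ((cmod (f x))\<^sup>2) \<partial>lborel) < \<infinity> \<and>
     g \<in> borel_measurable lborel \<and> (\<integral>\<^sup>+ \<xi>. ennreal ((cmod (g \<xi>))\<^sup>2) \<partial>lborel) < \<infinity> \<and>
     ((\<lambda>L. \<integral>\<^sup>+ \<xi>. ennreal ((cmod (g \<xi> - (LINT x:{-L..L}|lborel. cis (- (\<xi> * x)) * f x)))\<^sup>2) \<partial>lborel)
        \<longlongrightarrow> 0) at_top"

text \<open>\<open>h = \<mu>(D) f\<close> as an \<open>L\<^sup>2\<close> field: mode by mode, for almost every polar angle, the Fourier
  transform of \<open>h\<close> is \<open>\<mu>\<close> times that of \<open>f\<close>. This determines \<open>h\<close> up to null sets.\<close>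

definition fourier_mult :: "(real \<Rightarrow> int \<Rightarrow> real) \<Rightarrow> field \<Rightarrow> field \<Rightarrow> bool" where
  "fourier_mult \<mu> f h \<longleftrightarrow>
     L2_field h \<and>
     (AE \<theta> in lborel. 0 \<le> \<theta> \<and> \<theta> \<le> pi \<longrightarrow>
        (\<forall>n. \<exists>g. L2_fourier (az_mode n f \<theta>) g \<and>
                 L2_fourier (az_mode n h \<theta>) (\<lambda>\<xi>. of_real (\<mu> \<xi> n) * g \<xi>)))"

definition omega_plus :: "real \<Rightarrow> real \<Rightarrow> real" where
  "omega_plus m a = a / (2 * m * rplus m a)"

definition lambda_plus :: "real \<Rightarrow> real \<Rightarrow> real" where
  "lambda_plus m a = 4 * m * rplus m a / (rplus m a - rminus m a)"

definition beta_plus :: "real \<Rightarrow> real \<Rightarrow> real \<Rightarrow> int \<Rightarrow> real" where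
  "beta_plus m a \<xi> n = lambda_plus m a * (\<xi> + omega_plus m a * of_int n)"

definition A_set :: "real \<Rightarrow> real \<Rightarrow> real \<Rightarrow> (real \<times> int) set" where
  "A_set m a M =
     {(\<xi>, n). beta_plus m a \<xi> n * \<xi> \<ge> 0} \<union> {(\<xi>, n). \<bar>beta_plus m a \<xi> n\<bar> \<le> M}"

definition Pi_A :: "real \<Rightarrow> real \<Rightarrow> real \<Rightarrow> real \<Rightarrow> int \<Rightarrow> real" where
  "Pi_A m a M \<xi> n = indicator (A_set m a M) (\<xi>, n)"

definition T_half :: "real \<Rightarrow> int \<Rightarrow> real" where
  "T_half \<xi> n = \<bar>\<xi>\<bar> powr (1/2)"

definition Tplus_half :: "real \<Rightarrow> real \<Rightarrow> real \<Rightarrow> int \<Rightarrow> real" where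
  "Tplus_half m a \<xi> n = \<bar>\<xi> + omega_plus m a * of_int n\<bar> powr (1/2)"

text \<open>The operators that may be applied to both sides: identity, \<open>T\<close>, \<open>Z\<close>, \<open>T\<^sup>1\<^sup>/\<^sup>2\<close> and
  \<open>T\<^sub>+\<^sup>1\<^sup>/\<^sup>2\<close>, each as a pair of a classical differential operator and a Fourier symbol.\<close>

definition commutators :: "real \<Rightarrow> real \<Rightarrow> ((field \<Rightarrow> field) \<times> (real \<Rightarrow> int \<Rightarrow> real)) set" where
  "commutators m a =
     {(\<lambda>f. f, \<lambda>\<xi> n. 1), (dT, \<lambda>\<xi> n. 1), (dZ, \<lambda>\<xi> n. 1),
      (\<lambda>f. f, T_half), (\<lambda>f. f, Tplus_half m a)}"

end

theory Submission
  imports Defs "HOL-Probability.Probability" "HOL-Real_Asymp.Real_Asymp"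
begin

text \<open>Substituting \<open>s = \<bar>X\<bar> (r - r\<^sub>+)\<close> in the transform and letting \<open>X \<rightarrow> -\<infinity>\<close>, the radiation field
  becomes an explicit average of the field on the horizon,
  \<open>\<integral>\<^sub>0\<^sup>\<infinity> \<psi>(u - s + \<lambda>\<^sub>+ ln s + c\<^sub>0, \<theta>, \<phi> + \<lambda>\<^sub>+ \<omega>\<^sub>+ ln s + c\<^sub>1) ds\<close>.
  Mode by mode, its \<open>T\<close>-derivative is therefore the horizon field multiplied on the Fourier side, up to
  a phase, by \<open>\<i>\<xi> \<integral>\<^sub>0\<^sup>\<infinity> e\<^sup>-\<^sup>i\<^sup>\<xi>\<^sup>s s\<^sup>i\<^sup>\<beta> ds = \<Gamma>(1 + \<i>\<beta>) (\<i>\<xi>)\<^sup>-\<^sup>i\<^sup>\<beta>\<close> with \<open>\<beta> = \<beta>\<^sub>+\<close>. Its squared modulus is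
  \<open>2\<pi>x / (1 - e\<^sup>-\<^sup>2\<^sup>\<pi>\<^sup>x)\<close> with \<open>x = \<beta> sgn \<xi>\<close>, which on \<open>\<A>\<^sub>M\<close> is bounded below by a multiple of
  \<open>1 + \<bar>\<beta>\<bar>\<close>. Since the horizon field is smooth with compact support in \<open>v\<close>, all the fields in question
  are given by absolutely convergent Fourier integrals.\<close>

section \<open>Fourier transform on the line\<close>

text \<open>The right side of the estimate carries a \<open>T\<close>-derivative because the factor
  \<xi> which it supplies cancels the singularity 1/\<xi> of the Mellin integral at zero frequency.
  Two obstacles shape the proof. The integral of e^(-i\<xi>s) s^(i\<beta>) does not converge
  absolutely, so it is damped by e^(-\<epsilon>s) and evaluated for \<epsilon> > 0; the damping is
  removed only under the \<xi>-integral, with a bound uniform in \<epsilon>. And \<open>Pi_A\<close>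
  jumps, so the multiplied data are merely continuous for almost every \<xi> and their transforms
  need not be integrable; Plancherel and the property \<open>L2_fourier\<close> are therefore
  derived for bounded integrable functions with this weak continuity. The restriction to the
  frequency set is forced by the weight, which decays exponentially as x -> -infinity: cutting at
  |\<beta>| \<le> M leaves a loss of size e^(2 pi M). The three fields claimed to exist are written
  down by Fourier synthesis, one polar angle at a time, which turns the estimate into a pointwise
  inequality in (\<xi>, n).\<close>

lemma integrable_pair_mult:
  fixes f g :: "_ \<Rightarrow> complex"
  assumes "sigma_finite_measure M" "sigma_finite_measure N"
    and f: "integrable M f" and g: "integrable N g"
  shows "integrable (M \<Otimes>\<^sub>M N) (\<lambda>(x, y). f x * g y)"
proof -
  interpret pair_sigma_finite M N by (intro pair_sigma_finite.intro assms)
  note [measurable] = borel_measurable_integrable[OF f] borel_measurable_integrable[OF g]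
  show ?thesis
  proof (rule Fubini_integrable)
    show "integrable M (\<lambda>x. LINT y|N. norm (case (x, y) of (x, y) \<Rightarrow> f x * g y))"
      using f by (simp add: norm_mult)
  qed (use g in auto)
qed

text \<open>The sign of the exponent is opposite to that of the transform in the statement:
  \<open>ft\<close> is the inverse transform without its factor 1/(2 pi), and the forward transform
  is \<open>ft G (- \<xi>)\<close>.\<close>

definition ft :: "(real \<Rightarrow> complex) \<Rightarrow> real \<Rightarrow> complex" where
  "ft G x = (LINT t|lborel. cis (x * t) * G t)"

section \<open>Gaussian regularisation, Fourier inversion and Plancherel\<close>

lemma cis_measurable [measurable]: "cis \<in> borel_measurable borel"
  by (intro borel_measurable_continuous_onI continuous_intros)

lemma cnj_measurable [measurable]: "cnj \<in> borel_measurable borel"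
  by (intro borel_measurable_continuous_onI continuous_intros)

text \<open>The substitution x -> \<epsilon> x reduces this to the characteristic function of the
  standard normal distribution.\<close>

lemma gaussian_fourier:
  assumes "\<epsilon> > 0"
  shows "integrable lborel (\<lambda>x. exp (- (\<epsilon> * x)\<^sup>2 / 2))"
    and "(LINT x|lborel. cis (x * y) * of_real (exp (- (\<epsilon> * x)\<^sup>2 / 2)))
           = of_real (sqrt (2 * pi) / \<epsilon> * exp (- (y / \<epsilon>)\<^sup>2 / 2))"
proof -
  have n: "std_normal_density x = exp (- x\<^sup>2 / 2) / sqrt (2 * pi)" for x
    by (simp add: normal_density_def)
  have "integrable lborel (\<lambda>x. sqrt (2*pi) * std_normal_density (0 + \<epsilon> * x))"
    using lborel_integrable_real_affine[OF integrable_normal_density[of 1 0], of \<epsilon> 0] assms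
    by (intro integrable_mult_right) auto
  then show "integrable lborel (\<lambda>x. exp (- (\<epsilon> * x)\<^sup>2 / 2))"
    by (simp add: n)
  have "complex_of_real (exp (- (y/\<epsilon>)\<^sup>2 / 2)) = char std_normal_distribution (y/\<epsilon>)"
    by (simp add: char_std_normal_distribution)
  also have "\<dots> = (LINT x|lborel. std_normal_density x *\<^sub>R cis ((y/\<epsilon>) * x))"
    by (simp add: char_def cis_conv_exp integral_density)
  also have "\<dots> = \<bar>\<epsilon>\<bar> *\<^sub>R (LINT x|lborel. std_normal_density (0 + \<epsilon> * x) *\<^sub>R cis ((y/\<epsilon>) * (0 + \<epsilon> * x)))"
    using assms by (intro lborel_integral_real_affine) auto
  also have "(LINT x|lborel. std_normal_density (0 + \<epsilon> * x) *\<^sub>R cis ((y/\<epsilon>) * (0 + \<epsilon> * x)))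
     = (LINT x|lborel. (1/sqrt (2*pi)) *\<^sub>R (cis (x * y) * of_real (exp (- (\<epsilon> * x)\<^sup>2 / 2))))"
    using assms by (intro Bochner_Integration.integral_cong) (auto simp: n scaleR_conv_of_real mult_ac)
  also have "\<dots> = (1/sqrt (2*pi)) *\<^sub>R (LINT x|lborel. (cis (x * y) * of_real (exp (- (\<epsilon> * x)\<^sup>2 / 2))))"
    by (rule integral_scaleR_right)
  finally show "(LINT x|lborel. cis (x * y) * of_real (exp (- (\<epsilon> * x)\<^sup>2 / 2)))
           = of_real (sqrt (2 * pi) / \<epsilon> * exp (- (y / \<epsilon>)\<^sup>2 / 2))"
    using assms by (simp add: scaleR_conv_of_real field_simps)
qed

lemma ft_measurable [measurable]:
  assumes [measurable]: "G \<in> borel_measurable borel"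
  shows "ft G \<in> borel_measurable borel"
  unfolding ft_def by measurable

lemma ft_bound:
  "cmod (ft G x) \<le> (LINT t|lborel. cmod (G t))"
proof (cases "integrable lborel (\<lambda>t. cis (x * t) * G t)")
  case True
  then show ?thesis unfolding ft_def
    using integral_norm_bound[of lborel "\<lambda>t. cis (x * t) * G t"] by (simp add: norm_mult)
next
  \<comment> \<open>The Bochner integral of a non-integrable function is 0, so the bound
    persists.\<close>
  case False
  then show ?thesis unfolding ft_def
    by (simp add: not_integrable_integral_eq integral_nonneg_AE)
qed

text \<open>Convolution of \<open>G\<close> with the centred normal density of standard deviation
  \<epsilon>. The weight is kept fixed and \<epsilon> moved into the argument, so that a bound on
  \<open>G\<close> yields a majorant independent of \<epsilon>.\<close>

definition gauss_mean :: "real \<Rightarrow> (real \<Rightarrow> complex) \<Rightarrow> real \<Rightarrow> complex" where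
  "gauss_mean \<epsilon> G y = (LINT t|lborel. std_normal_density t *\<^sub>R G (y + \<epsilon> * t))"

text \<open>The Gaussian factor makes the double integral in frequency and time absolutely
  convergent. After Fubini the frequency integral is again a Gaussian, of width \<epsilon> around
  \<open>y\<close>, and rescaling the time about \<open>y\<close> gives the mean.\<close>

lemma gauss_regularised_inversion:
  assumes G: "integrable lborel G" and e: "\<epsilon> > 0"
  shows "(LINT x|lborel. cis (- (x * y)) * of_real (exp (- (\<epsilon> * x)\<^sup>2 / 2)) * ft G x)
     = 2 * of_real pi * gauss_mean \<epsilon> G y"
proof -
  have [measurable, simp]: "G \<in> borel_measurable borel" using borel_measurable_integrable[OF G] by simp
  let ?E = "\<lambda>x. of_real (exp (- (\<epsilon> * x)\<^sup>2 / 2)) :: complex"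
  have E: "integrable lborel ?E"
    using gaussian_fourier(1)[OF e] by (rule integrable_of_real)
  have I: "integrable (lborel \<Otimes>\<^sub>M lborel) (\<lambda>(x, t). ?E x * G t)"
    using integrable_pair_mult[OF _ _ E G] by (simp add: sigma_finite_lborel)
  have I2: "integrable (lborel \<Otimes>\<^sub>M lborel) (\<lambda>(x, t). cis (- (x * y)) * ?E x * (cis (x * t) * G t))"
    by (rule Bochner_Integration.integrable_bound[OF I]) (auto simp: norm_mult case_prod_beta)
  have "(LINT x|lborel. cis (- (x * y)) * ?E x * ft G x)
     = (LINT x|lborel. LINT t|lborel. cis (- (x * y)) * ?E x * (cis (x * t) * G t))"
    unfolding ft_def by simp
  also have "\<dots> = (LINT t|lborel. LINT x|lborel. cis (- (x * y)) * ?E x * (cis (x * t) * G t))"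
    using lborel_pair.Fubini_integral[OF I2] by simp
  also have "\<dots> = (LINT t|lborel. G t * (LINT x|lborel. cis (x * (t - y)) * ?E x))"
  proof (intro Bochner_Integration.integral_cong refl)
    fix t
    have "(LINT x|lborel. cis (- (x * y)) * ?E x * (cis (x * t) * G t))
      = (LINT x|lborel. G t * (cis (x * (t - y)) * ?E x))"
    proof (intro Bochner_Integration.integral_cong refl)
      fix x
      have "cis (x * (t-y)) = cis (- (x * y)) * cis (x*t)" by (simp add: cis_mult algebra_simps)
      then show "cis (- (x * y)) * ?E x * (cis (x * t) * G t) = G t * (cis (x * (t - y)) * ?E x)"
        by simp
    qed
    then show "(LINT x|lborel. cis (- (x * y)) * ?E x * (cis (x * t) * G t))
      = G t * (LINT x|lborel. (cis (x * (t - y)) * ?E x))" by simp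
  qed
  also have "\<dots> = (LINT t|lborel. (sqrt (2 * pi) / \<epsilon> * exp (- ((t - y) / \<epsilon>)\<^sup>2 / 2)) *\<^sub>R G t)"
    by (intro Bochner_Integration.integral_cong refl, subst gaussian_fourier(2)[OF e])
       (simp only: scaleR_conv_of_real mult.commute)
  also have "\<dots> = \<bar>\<epsilon>\<bar> *\<^sub>R (LINT t|lborel. (sqrt (2 * pi) / \<epsilon> * exp (- ((y + \<epsilon> * t - y) / \<epsilon>)\<^sup>2 / 2)) *\<^sub>R G (y + \<epsilon> * t))"
    using e by (intro lborel_integral_real_affine) auto
  also have "\<dots> = (LINT t|lborel. \<bar>\<epsilon>\<bar> *\<^sub>R ((sqrt (2 * pi) / \<epsilon> * exp (- ((y + \<epsilon> * t - y) / \<epsilon>)\<^sup>2 / 2)) *\<^sub>R G (y + \<epsilon> * t)))"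
    by (rule integral_scaleR_right[symmetric])
  also have "\<dots> = (LINT t|lborel. (2 * pi) *\<^sub>R (std_normal_density t *\<^sub>R G (y + \<epsilon> * t)))"
    using e by (intro Bochner_Integration.integral_cong) (auto simp: normal_density_def field_simps)
  also have "\<dots> = 2 * of_real pi * gauss_mean \<epsilon> G y"
    unfolding gauss_mean_def by (subst integral_scaleR_right) (simp add: scaleR_conv_of_real)
  finally show ?thesis .
qed

lemma gauss_mean_bound:
  assumes [measurable]: "G \<in> borel_measurable borel" and B: "\<And>t. cmod (G t) \<le> B"
  shows "cmod (gauss_mean \<epsilon> G y) \<le> B"
proof -
  have i: "integrable lborel (\<lambda>t. B * std_normal_density t)" by (intro integrable_mult_right) simp
  have "cmod (gauss_mean \<epsilon> G y) \<le> (LINT t|lborel. B * std_normal_density t)"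
    unfolding gauss_mean_def
  proof (rule Bochner_Integration.integral_norm_bound_integral[OF _ i])
    show "integrable lborel (\<lambda>t. std_normal_density t *\<^sub>R G (y + \<epsilon> * t))"
      by (rule Bochner_Integration.integrable_bound[OF i])
         (use B order_trans[OF norm_ge_zero B] in \<open>auto simp: abs_mult mult.commute[of B] intro!: mult_left_mono AE_I2\<close>)
  qed (use B in \<open>auto simp: mult.commute[of B] intro!: mult_left_mono AE_I2\<close>)
  then show ?thesis by simp
qed

text \<open>Continuity is used at the single point \<open>y\<close>; this is what admits functions
  with jumps later on.\<close>

lemma gauss_mean_tendsto:
  assumes [measurable]: "G \<in> borel_measurable borel" and B: "\<And>t. cmod (G t) \<le> B" and c: "isCont G y"
    and e: "\<epsilon> \<longlonglongrightarrow> 0"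
  shows "(\<lambda>j. gauss_mean (\<epsilon> j) G y) \<longlonglongrightarrow> G y"
proof -
  have i: "integrable lborel (\<lambda>t. B * std_normal_density t)" by (intro integrable_mult_right) simp
  have "(\<lambda>j. gauss_mean (\<epsilon> j) G y) \<longlonglongrightarrow> (LINT t|lborel. std_normal_density t *\<^sub>R G y)"
    unfolding gauss_mean_def
  proof (rule integral_dominated_convergence[OF _ _ i])
    show "AE t in lborel. (\<lambda>j. std_normal_density t *\<^sub>R G (y + \<epsilon> j * t)) \<longlonglongrightarrow> std_normal_density t *\<^sub>R G y"
    proof (rule AE_I2)
      fix t
      have "(\<lambda>j. y + \<epsilon> j * t) \<longlonglongrightarrow> y + 0 * t" by (intro tendsto_intros e)
      then have "(\<lambda>j. G (y + \<epsilon> j * t)) \<longlonglongrightarrow> G y"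
        using isCont_tendsto_compose[OF c] by simp
      then show "(\<lambda>j. std_normal_density t *\<^sub>R G (y + \<epsilon> j * t)) \<longlonglongrightarrow> std_normal_density t *\<^sub>R G y"
        by (intro tendsto_intros)
    qed
  qed (use B in \<open>auto simp: mult.commute[of B] intro!: mult_left_mono AE_I2\<close>)
  also have "(LINT t|lborel. std_normal_density t *\<^sub>R G y) = G y"
    by (subst integral_scaleR_left) auto
  finally show ?thesis .
qed

text \<open>Limit \<epsilon> -> 0 in the regularised identity: the left side is dominated by the
  modulus of \<open>ft G\<close>, and the right side is an approximate identity acting on a bounded
  function.\<close>

lemma fourier_inversion:
  assumes G: "integrable lborel G" and B: "\<And>t. cmod (G t) \<le> B" and c: "isCont G y"
    and F: "integrable lborel (ft G)"
  shows "ft (ft G) (- y) = 2 * of_real pi * G y"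
proof -
  have [measurable, simp]: "G \<in> borel_measurable borel" using borel_measurable_integrable[OF G] by simp
  let ?e = "\<lambda>j. inverse (real (Suc j))"
  let ?f = "\<lambda>j x. cis (- (x * y)) * of_real (exp (- (?e j * x)\<^sup>2 / 2)) * ft G x"
  have e: "?e \<longlonglongrightarrow> 0" by (rule LIMSEQ_inverse_real_of_nat)
  have "(\<lambda>j. LINT x|lborel. ?f j x) \<longlonglongrightarrow> (LINT x|lborel. cis (- (x * y)) * ft G x)"
  proof (rule integral_dominated_convergence[OF _ _ integrable_norm[OF F]])
    show "AE x in lborel. (\<lambda>j. ?f j x) \<longlonglongrightarrow> cis (- (x * y)) * ft G x"
    proof (rule AE_I2)
      fix x
      have "(\<lambda>j. ?f j x) \<longlonglongrightarrow> cis (- (x * y)) * of_real (exp (- (0 * x)\<^sup>2 / 2)) * ft G x"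
        by (intro tendsto_intros e) auto
      then show "(\<lambda>j. ?f j x) \<longlonglongrightarrow> cis (- (x * y)) * ft G x" by simp
    qed
  qed (auto simp: norm_mult intro!: mult_left_le_one_le)
  moreover have "(LINT x|lborel. ?f j x) = 2 * of_real pi * gauss_mean (?e j) G y" for j
    by (rule gauss_regularised_inversion[OF G]) simp
  then have "(\<lambda>j. LINT x|lborel. ?f j x) \<longlonglongrightarrow> 2 * of_real pi * G y"
    using tendsto_mult_left[OF gauss_mean_tendsto[OF _ B c e], of "2 * of_real pi"]
    by simp
  ultimately have "(LINT x|lborel. cis (- (x * y)) * ft G x) = 2 * of_real pi * G y"
    by (rule LIMSEQ_unique)
  then show ?thesis unfolding ft_def[of "ft G"] by (simp add: mult.commute)
qed

lemma square_integrable_bounded: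
  fixes G :: "real \<Rightarrow> complex"
  assumes G: "integrable lborel G" and B: "\<And>t. cmod (G t) \<le> B"
  shows "integrable lborel (\<lambda>t. (cmod (G t))\<^sup>2)"
proof (rule Bochner_Integration.integrable_bound)
  show "integrable lborel (\<lambda>t. B * cmod (G t))"
    using G by (intro integrable_mult_right integrable_norm)
  have [measurable, simp]: "G \<in> borel_measurable borel" using borel_measurable_integrable[OF G] by simp
  show "(\<lambda>t. (cmod (G t))\<^sup>2) \<in> borel_measurable lborel" by measurable
  have "0 \<le> B" using order_trans[OF norm_ge_zero B] .
  then show "AE t in lborel. norm ((cmod (G t))\<^sup>2) \<le> norm (B * cmod (G t))"
    using B by (auto simp: power2_eq_square abs_mult intro!: mult_right_mono)
qed

text \<open>When \<open>G\<close> has jumps, \<open>ft G\<close> may fail to be integrable, so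
  inversion cannot be invoked. The Gaussian weight is put under the integral of the squared
  transform instead; as it is removed, the time side converges by domination and the frequency side
  by monotonicity.\<close>

lemma plancherel:
  assumes G: "integrable lborel G" and B: "\<And>t. cmod (G t) \<le> B" and c: "AE y in lborel. isCont G y"
  shows "integrable lborel (\<lambda>x. (cmod (ft G x))\<^sup>2)"
    and "(LINT x|lborel. (cmod (ft G x))\<^sup>2) = 2 * pi * (LINT y|lborel. (cmod (G y))\<^sup>2)"
proof -
  have [measurable, simp]: "G \<in> borel_measurable borel" using borel_measurable_integrable[OF G] by simp
  let ?e = "\<lambda>j. inverse (real (Suc j))"
  let ?E = "\<lambda>j x. exp (- (?e j * x)\<^sup>2 / 2)"
  let ?f = "\<lambda>j x. ?E j x * (cmod (ft G x))\<^sup>2"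
  have e: "?e \<longlonglongrightarrow> 0" by (rule LIMSEQ_inverse_real_of_nat)
  have e0: "?e j > 0" for j by simp
  have B0: "0 \<le> B" using order_trans[OF norm_ge_zero B] .
  \<comment> \<open>The square is \<open>ft G\<close> times its conjugate. Expanding only the
    conjugate leaves, after Fubini, the regularised inversion integral at each point.\<close>
  have key: "complex_of_real (LINT x|lborel. ?f j x) = (LINT y|lborel. cnj (G y) * (2 * of_real pi * gauss_mean (?e j) G y))" for j
  proof -
    let ?K = "\<lambda>x. complex_of_real (?E j x) * ft G x"
    have K: "integrable lborel ?K"
    proof (rule Bochner_Integration.integrable_bound)
      show "integrable lborel (\<lambda>x. ?E j x * (LINT t|lborel. cmod (G t)))"
        using gaussian_fourier(1)[OF e0] by (intro integrable_mult_left)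
      show "AE x in lborel. cmod (?K x) \<le> norm (?E j x * (LINT t|lborel. cmod (G t)))"
        using ft_bound[of G] by (auto simp: norm_mult abs_mult intro!: mult_left_mono intro: order_trans)
    qed auto
    have I: "integrable (lborel \<Otimes>\<^sub>M lborel) (\<lambda>(x, t). ?K x * cnj (G t))"
      using integrable_pair_mult[OF _ _ K integrable_cnj[OF G]] by (simp add: sigma_finite_lborel)
    have I2: "integrable (lborel \<Otimes>\<^sub>M lborel) (\<lambda>(x, t). ?K x * cnj (cis (x * t) * G t))"
      by (rule Bochner_Integration.integrable_bound[OF I]) (auto simp: norm_mult case_prod_beta)
    have "complex_of_real (LINT x|lborel. ?f j x) = (LINT x|lborel. complex_of_real (?f j x))"
      by (rule integral_complex_of_real[symmetric])
    also have "\<dots> = (LINT x|lborel. ?K x * cnj (ft G x))"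
      by (intro Bochner_Integration.integral_cong refl) (simp add: complex_norm_square[unfolded of_real_power] mult_ac)
    also have "\<dots> = (LINT x|lborel. LINT t|lborel. ?K x * cnj (cis (x * t) * G t))"
      unfolding ft_def by (simp add: integral_cnj del: complex_cnj_mult)
    also have "\<dots> = (LINT t|lborel. LINT x|lborel. ?K x * cnj (cis (x * t) * G t))"
      using lborel_pair.Fubini_integral[OF I2] by simp
    also have "\<dots> = (LINT t|lborel. cnj (G t) * (LINT x|lborel. cis (- (x * t)) * of_real (?E j x) * ft G x))"
      by (simp add: cis_cnj mult_ac flip: integral_mult_right_zero)
    also have "\<dots> = (LINT y|lborel. cnj (G y) * (2 * of_real pi * gauss_mean (?e j) G y))"
      by (simp only: gauss_regularised_inversion[OF G e0])
    finally show ?thesis .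
  qed
  have "(\<lambda>j. LINT y|lborel. cnj (G y) * (2 * of_real pi * gauss_mean (?e j) G y)) \<longlonglongrightarrow>
         (LINT y|lborel. cnj (G y) * (2 * of_real pi * G y))"
  proof (rule integral_dominated_convergence)
    show "integrable lborel (\<lambda>y. cmod (G y) * (2 * pi * B))"
      using G by (intro integrable_mult_left integrable_norm)
    show "AE y in lborel. (\<lambda>j. cnj (G y) * (2 * of_real pi * gauss_mean (?e j) G y))
        \<longlonglongrightarrow> cnj (G y) * (2 * of_real pi * G y)"
      using c
    proof eventually_elim
      case (elim y)
      show ?case by (intro tendsto_intros gauss_mean_tendsto[OF _ B elim e]) simp
    qed
    show "AE y in lborel. cmod (cnj (G y) * (2 * of_real pi * gauss_mean (?e j) G y)) \<le> cmod (G y) * (2 * pi * B)" for j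
      using gauss_mean_bound[OF _ B]
      by (intro AE_I2) (simp add: norm_mult mult_left_mono)
    show "(\<lambda>y. cnj (G y) * (2 * of_real pi * gauss_mean (?e j) G y)) \<in> borel_measurable lborel" for j
      unfolding gauss_mean_def by measurable
  qed measurable
  also have "(LINT y|lborel. cnj (G y) * (2 * of_real pi * G y)) = (LINT y|lborel. complex_of_real (2 * pi * (cmod (G y))\<^sup>2))"
    by (intro Bochner_Integration.integral_cong refl) (simp only: of_real_mult complex_norm_square, simp)
  also have "\<dots> = complex_of_real (2 * pi * (LINT y|lborel. (cmod (G y))\<^sup>2))"
    by (simp only: integral_complex_of_real integral_mult_right_zero)
  finally have "(\<lambda>j. complex_of_real (LINT x|lborel. ?f j x)) \<longlonglongrightarrow> complex_of_real (2 * pi * (LINT y|lborel. (cmod (G y))\<^sup>2))"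
    by (simp only: key)
  then have lim: "(\<lambda>j. LINT x|lborel. ?f j x) \<longlonglongrightarrow> 2 * pi * (LINT y|lborel. (cmod (G y))\<^sup>2)"
    by (simp only: tendsto_of_real_iff)
  have int: "integrable lborel (?f j)" for j
  proof (rule Bochner_Integration.integrable_bound)
    show "integrable lborel (\<lambda>x. ?E j x * (LINT t|lborel. cmod (G t))\<^sup>2)"
      using gaussian_fourier(1)[OF e0] by (intro integrable_mult_left)
    show "AE x in lborel. norm (?f j x) \<le> norm (?E j x * (LINT t|lborel. cmod (G t))\<^sup>2)"
      using ft_bound[of G] by (auto simp: norm_mult abs_mult intro!: mult_left_mono power_mono)
  qed auto
  \<comment> \<open>The parameters of the Gaussians decrease with j, so the weights
    increase.\<close>
  have mono: "mono (\<lambda>j. ?f j x)" for x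
  proof (rule monoI)
    fix i j :: nat assume "i \<le> j"
    then have "?e j \<le> ?e i" by (auto simp: field_simps)
    then have "(?e j)\<^sup>2 \<le> (?e i)\<^sup>2" by (intro power_mono) auto
    then have "(?e j)\<^sup>2 * x\<^sup>2 \<le> (?e i)\<^sup>2 * x\<^sup>2" by (intro mult_right_mono) auto
    then show "?f i x \<le> ?f j x"
      by (intro mult_right_mono) (auto simp: power_mult_distrib)
  qed
  have pt: "(\<lambda>j. ?f j x) \<longlonglongrightarrow> (cmod (ft G x))\<^sup>2" for x
  proof -
    have "(\<lambda>j. ?f j x) \<longlonglongrightarrow> exp (- (0 * x)\<^sup>2 / 2) * (cmod (ft G x))\<^sup>2"
      by (intro tendsto_intros e) auto
    then show ?thesis by simp
  qed
  \<comment> \<open>Integrability is an output of monotone convergence: the integrals of the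
    increasing approximants have a finite limit.\<close>
  show "integrable lborel (\<lambda>x. (cmod (ft G x))\<^sup>2)"
    by (rule integrable_monotone_convergence[OF int _ _ lim]) (use mono pt in auto)
  show "(LINT x|lborel. (cmod (ft G x))\<^sup>2) = 2 * pi * (LINT y|lborel. (cmod (G y))\<^sup>2)"
    by (rule integral_monotone_convergence[OF int _ _ lim]) (use mono pt in auto)
qed


lemma ft_isCont:
  assumes G: "integrable lborel G"
  shows "isCont (ft G) x"
proof -
  have [measurable, simp]: "G \<in> borel_measurable borel" using borel_measurable_integrable[OF G] by simp
  have "(\<lambda>j. ft G (X j)) \<longlonglongrightarrow> ft G x" if X: "X \<longlonglongrightarrow> x" for X
    unfolding ft_def
  proof (rule integral_dominated_convergence[OF _ _ integrable_norm[OF G]])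
    show "AE t in lborel. (\<lambda>j. cis (X j * t) * G t) \<longlonglongrightarrow> cis (x * t) * G t"
      by (intro AE_I2 tendsto_intros X)
  qed (auto simp: norm_mult)
  then show ?thesis
    by (auto simp: continuous_within tendsto_at_iff_sequentially comp_def)
qed

lemma integrable_reflect:
  fixes f :: "real \<Rightarrow> 'a::{banach, second_countable_topology}"
  shows "integrable lborel f \<Longrightarrow> integrable lborel (\<lambda>x. f (- x))"
  using lborel_integrable_real_affine[of f "-1" 0] by simp

lemma integral_reflect:
  fixes f :: "real \<Rightarrow> 'a::{banach, second_countable_topology}"
  shows "(LINT x|lborel. f (- x)) = (LINT x|lborel. f x)"
  using lborel_integral_real_affine[of "-1" f 0] by simp

text \<open>The truncation \<open>K 1\<^sub>[\<^sub>-\<^sub>L\<^sub>,\<^sub>L\<^sub>]\<close> of the inverse transform \<open>K\<close> satisfies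
  \<open>\<langle>F(K\<^sub>L), G\<rangle> = 2 \<pi> \<parallel>K\<^sub>L\<parallel>\<^sup>2 = \<parallel>F(K\<^sub>L)\<parallel>\<^sup>2\<close>, so that the truncation error is exactly
  \<open>\<parallel>G\<parallel>\<^sup>2 - 2 \<pi> \<parallel>K\<^sub>L\<parallel>\<^sup>2\<close>.\<close>

lemma L2_fourier_ft:
  assumes G: "integrable lborel G" and B: "\<And>t. cmod (G t) \<le> B" and c: "AE y in lborel. isCont G y"
  shows "L2_fourier (\<lambda>x. ft G x / (2 * of_real pi)) G"
proof -
  have [measurable, simp]: "G \<in> borel_measurable borel" using borel_measurable_integrable[OF G] by simp
  define K where "K x = ft G x / (2 * of_real pi)" for x
  have [measurable]: "K \<in> borel_measurable borel" unfolding K_def by measurable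
  define B' where "B' = (LINT t|lborel. cmod (G t)) / (2 * pi)"
  have KB: "cmod (K x) \<le> B'" for x
    using ft_bound[of G x] by (simp add: K_def B'_def norm_divide norm_mult divide_right_mono)
  have B'0: "0 \<le> B'" using order_trans[OF norm_ge_zero KB] .
  have K2: "integrable lborel (\<lambda>x. (cmod (K x))\<^sup>2)"
    using plancherel(1)[OF G B c] by (simp add: K_def norm_divide power_divide)
  have K2i: "2 * pi * (LINT x|lborel. (cmod (K x))\<^sup>2) = (LINT x|lborel. (cmod (G x))\<^sup>2)"
    using plancherel(2)[OF G B c] by (simp add: K_def norm_divide power_divide field_simps power2_eq_square)
  have G2: "integrable lborel (\<lambda>x. (cmod (G x))\<^sup>2)" by (rule square_integrable_bounded[OF G B])
  define k where "k L x = indicator {-L..L} x *\<^sub>R K x" for L x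
  have [measurable]: "k L \<in> borel_measurable borel" for L unfolding k_def by measurable
  have kint: "integrable lborel (k L)" for L
    by (rule integrableI_bounded_set[of "{-L..L}" _ _ B'])
       (use KB B'0 in \<open>auto simp: k_def emeasure_lborel_Icc_eq split: split_indicator intro!: AE_I2\<close>)
  have kB: "cmod (k L x) \<le> B'" for L x using KB B'0 by (auto simp: k_def split: split_indicator)
  \<comment> \<open>The truncation jumps at L and -L, so Plancherel is needed for functions that are
    continuous only almost everywhere.\<close>
  have kc: "AE x in lborel. isCont (k L) x" for L
  proof (rule AE_mp[OF AE_lborel_singleton[of L] AE_mp[OF AE_lborel_singleton[of "-L"]]], intro AE_I2 impI)
    fix x assume x: "x \<noteq> -L" "x \<noteq> L"
    have "isCont K x" unfolding K_def by (intro continuous_intros ft_isCont G) auto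
    moreover have "isCont (indicator {-L..L} :: real \<Rightarrow> real) x"
      using x by (auto simp: isCont_indicator frontier_def)
    ultimately show "isCont (k L) x" unfolding k_def by (intro continuous_intros)
  qed
  have pl: "integrable lborel (\<lambda>x. (cmod (ft (k L) (- x)))\<^sup>2)"
      "(LINT x|lborel. (cmod (ft (k L) (- x)))\<^sup>2) = 2 * pi * (LINT x|lborel. (cmod (k L x))\<^sup>2)" for L
    using integrable_reflect[OF plancherel(1)[OF kint kB kc]] plancherel(2)[OF kint kB kc]
      integral_reflect[of "\<lambda>x. (cmod (ft (k L) x))\<^sup>2"] by simp_all
  \<comment> \<open>Fubini moves the transform from \<open>k L\<close> onto \<open>G\<close>; on
    [-L, L] the transform of \<open>G\<close> is 2 pi times \<open>k L\<close>.\<close>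
  have cross: "(LINT \<xi>|lborel. cnj (G \<xi>) * ft (k L) (- \<xi>)) = of_real (2 * pi * (LINT x|lborel. (cmod (k L x))\<^sup>2))"
    and crossi: "integrable lborel (\<lambda>\<xi>. cnj (G \<xi>) * ft (k L) (- \<xi>))" for L
  proof -
    have I: "integrable (lborel \<Otimes>\<^sub>M lborel) (\<lambda>(\<xi>, x). cnj (G \<xi>) * k L x)"
      using integrable_pair_mult[OF _ _ integrable_cnj[OF G] kint] by (simp add: sigma_finite_lborel)
    have I2: "integrable (lborel \<Otimes>\<^sub>M lborel) (\<lambda>(\<xi>, x). cnj (G \<xi>) * (cis (- \<xi> * x) * k L x))"
      by (rule Bochner_Integration.integrable_bound[OF I]) (auto simp: norm_mult case_prod_beta)
    have "(LINT \<xi>|lborel. cnj (G \<xi>) * ft (k L) (- \<xi>)) = (LINT \<xi>|lborel. LINT x|lborel. cnj (G \<xi>) * (cis (- \<xi> * x) * k L x))"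
      unfolding ft_def by simp
    also have "\<dots> = (LINT x|lborel. LINT \<xi>|lborel. cnj (G \<xi>) * (cis (- \<xi> * x) * k L x))"
      using lborel_pair.Fubini_integral[OF I2] by simp
    also have "\<dots> = (LINT x|lborel. k L x * cnj (ft G x))"
    proof (intro Bochner_Integration.integral_cong refl)
      fix x
      have "(LINT \<xi>|lborel. cnj (G \<xi>) * (cis (- \<xi> * x) * k L x)) = (LINT \<xi>|lborel. k L x * cnj (cis (x * \<xi>) * G \<xi>))"
        by (intro Bochner_Integration.integral_cong refl) (simp add: cis_cnj mult_ac)
      also have "\<dots> = k L x * cnj (ft G x)"
        unfolding ft_def by (simp only: integral_mult_right_zero Bochner_Integration.integral_cnj)
      finally show "(LINT \<xi>|lborel. cnj (G \<xi>) * (cis (- \<xi> * x) * k L x)) = k L x * cnj (ft G x)" .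
    qed
    also have "\<dots> = (LINT x|lborel. of_real (2 * pi * (cmod (k L x))\<^sup>2))"
      unfolding of_real_mult complex_norm_square
      by (intro Bochner_Integration.integral_cong) (auto simp: k_def K_def split: split_indicator)
    also have "\<dots> = of_real (2 * pi * (LINT x|lborel. (cmod (k L x))\<^sup>2))"
      by (simp only: integral_complex_of_real integral_mult_right_zero)
    finally show "(LINT \<xi>|lborel. cnj (G \<xi>) * ft (k L) (- \<xi>)) = of_real (2 * pi * (LINT x|lborel. (cmod (k L x))\<^sup>2))" .
    show "integrable lborel (\<lambda>\<xi>. cnj (G \<xi>) * ft (k L) (- \<xi>))"
      using lborel_pair.integrable_fst[OF I2] unfolding ft_def by simp
  qed
  have err: "integrable lborel (\<lambda>\<xi>. (cmod (G \<xi> - ft (k L) (- \<xi>)))\<^sup>2)"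
     "(LINT \<xi>|lborel. (cmod (G \<xi> - ft (k L) (- \<xi>)))\<^sup>2) =
        (LINT x|lborel. (cmod (G x))\<^sup>2) - 2 * pi * (LINT x|lborel. (cmod (k L x))\<^sup>2)" for L
  proof -
    \<comment> \<open>The cross term (before doubling) and the last square have the same integral,
      so the error collapses to a difference of two squared norms.\<close>
    have eq: "(cmod (G \<xi> - ft (k L) (- \<xi>)))\<^sup>2 = (cmod (G \<xi>))\<^sup>2 - 2 * Re (cnj (G \<xi>) * ft (k L) (- \<xi>)) + (cmod (ft (k L) (- \<xi>)))\<^sup>2" for \<xi>
      unfolding cmod_power2 by (simp add: power2_eq_square algebra_simps)
    have R: "integrable lborel (\<lambda>\<xi>. Re (cnj (G \<xi>) * ft (k L) (- \<xi>)))"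
      "(LINT \<xi>|lborel. Re (cnj (G \<xi>) * ft (k L) (- \<xi>))) = 2 * pi * (LINT x|lborel. (cmod (k L x))\<^sup>2)"
      using crossi cross by (simp_all only: integrable_Re integral_Re Re_complex_of_real)
    show "integrable lborel (\<lambda>\<xi>. (cmod (G \<xi> - ft (k L) (- \<xi>)))\<^sup>2)"
      unfolding eq by (intro Bochner_Integration.integrable_add Bochner_Integration.integrable_diff integrable_mult_right G2 R pl)
    show "(LINT \<xi>|lborel. (cmod (G \<xi> - ft (k L) (- \<xi>)))\<^sup>2) =
        (LINT x|lborel. (cmod (G x))\<^sup>2) - 2 * pi * (LINT x|lborel. (cmod (k L x))\<^sup>2)"
      unfolding eq
      by (simp only: Bochner_Integration.integral_add Bochner_Integration.integral_diff integral_mult_right_zero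
        G2 R pl Bochner_Integration.integrable_diff integrable_mult_right)
  qed
  have klim: "((\<lambda>L. LINT x|lborel. (cmod (k L x))\<^sup>2) \<longlongrightarrow> (LINT x|lborel. (cmod (K x))\<^sup>2)) at_top"
  proof (rule integral_dominated_convergence_at_top[OF _ _ K2])
    show "AE x in lborel. ((\<lambda>L. (cmod (k L x))\<^sup>2) \<longlongrightarrow> (cmod (K x))\<^sup>2) at_top"
    proof (rule AE_I2, rule tendsto_eventually)
      fix x
      show "\<forall>\<^sub>F L in at_top. (cmod (k L x))\<^sup>2 = (cmod (K x))\<^sup>2"
        using eventually_ge_at_top[of "\<bar>x\<bar>"] by eventually_elim (auto simp: k_def indicator_def)
    qed
  qed (auto simp: k_def split: split_indicator intro!: always_eventually)
  have "((\<lambda>L. (LINT x|lborel. (cmod (G x))\<^sup>2) - 2 * pi * (LINT x|lborel. (cmod (k L x))\<^sup>2)) \<longlongrightarrow>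
     (LINT x|lborel. (cmod (G x))\<^sup>2) - 2 * pi * (LINT x|lborel. (cmod (K x))\<^sup>2)) at_top"
    by (intro tendsto_intros klim)
  then have "((\<lambda>L. ennreal (LINT \<xi>|lborel. (cmod (G \<xi> - ft (k L) (- \<xi>)))\<^sup>2)) \<longlongrightarrow> ennreal 0) at_top"
    unfolding K2i err by (intro tendsto_ennrealI) simp
  then have "((\<lambda>L. \<integral>\<^sup>+\<xi>. ennreal ((cmod (G \<xi> - ft (k L) (- \<xi>)))\<^sup>2) \<partial>lborel) \<longlongrightarrow> 0) at_top"
    by (simp add: nn_integral_eq_integral err(1))
  moreover have "ft (k L) (- \<xi>) = (LINT x:{-L..L}|lborel. cis (- (\<xi> * x)) * K x)" for L \<xi>
    unfolding ft_def set_lebesgue_integral_def k_def by (simp add: mult.commute)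
  ultimately show ?thesis
    unfolding L2_fourier_def K_def[symmetric]
    using nn_integral_eq_integral[OF K2] nn_integral_eq_integral[OF G2] by (auto)
qed

section \<open>Fourier synthesis in time and azimuth\<close>

lemma measurable_pair_countable2:
  assumes "countable A" and "\<And>y. y \<in> A \<Longrightarrow> (\<lambda>x. f (x, y)) \<in> measurable N K"
  shows "f \<in> measurable (N \<Otimes>\<^sub>M count_space A) K"
  unfolding measurable_pair_swap_iff[of f]
  by (rule measurable_pair_measure_countable1[OF assms(1)]) (simp add: assms(2))

lemma integral_cis_period:
  "(LINT \<phi>:{0..2 * pi}|lborel. cis (of_int k * \<phi>)) = (if k = 0 then 2 * of_real pi else 0)"
proof (cases "k = 0")
  case True
  then show ?thesis by (simp add: set_lebesgue_integral_def scaleR_conv_of_real)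
next
  case False
  let ?F = "\<lambda>\<phi>. cis (of_int k * \<phi>) / (\<i> * of_int k)"
  have "((\<lambda>\<phi>. cis (of_int k * \<phi>)) has_vector_derivative \<i> * of_int k * cis (of_int k * x)) (at x)" for x
  proof -
    have "((\<lambda>\<phi>. \<i> * of_real (of_int k * \<phi>)) has_vector_derivative \<i> * of_int k) (at x)"
      by (auto intro!: derivative_eq_intros)
    from field_vector_diff_chain_at[OF this DERIV_exp]
    show ?thesis by (simp add: cis_conv_exp o_def)
  qed
  then have d: "(?F has_vector_derivative cis (of_int k * x)) (at x)" for x
    using has_vector_derivative_divide[of "\<lambda>\<phi>. cis (of_int k * \<phi>)" "\<i> * of_int k * cis (of_int k * x)" "at x" "\<i> * of_int k"] False
    by simp
  have "(LBINT \<phi>=ereal 0..ereal (2*pi). cis (of_int k * \<phi>)) = ?F (2 * pi) - ?F 0"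
    by (rule interval_integral_FTC_finite)
       (auto intro!: continuous_intros has_vector_derivative_at_within[OF d])
  also have "cis (of_int k * (2 * pi)) = 1"
    using cis_multiple_2pi[of "of_int k"] by (simp add: mult.commute)
  finally show ?thesis using False
    by (simp add: interval_integral_Icc del: zero_ereal_def)
qed

text \<open>The series is written as a Bochner integral for counting measure, so that Fubini,
  domination and the measurability of parameter integrals apply to it directly.\<close>

definition fourier_series :: "(int \<Rightarrow> complex) \<Rightarrow> real \<Rightarrow> complex" where
  "fourier_series c \<phi> = (LINT k|count_space UNIV. cis (of_int k * \<phi>) * c k)"

lemma sigma_finite_int: "sigma_finite_measure (count_space (UNIV :: int set))"
  by (rule sigma_finite_measure_count_space)

lemma fourier_series_measurable [measurable]:
  "fourier_series c \<in> borel_measurable borel"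
proof -
  interpret sigma_finite_measure "count_space (UNIV :: int set)" by (rule sigma_finite_int)
  have "(\<lambda>(\<phi>, k). cis (of_int k * \<phi>) * c k) \<in> borel_measurable (borel \<Otimes>\<^sub>M count_space UNIV)"
    by (rule measurable_pair_countable2) auto
  then show ?thesis unfolding fourier_series_def by (rule borel_measurable_lebesgue_integral)
qed

lemma norm_fourier_series_le:
  "cmod (fourier_series c \<phi>) \<le> (LINT k|count_space UNIV. cmod (c k))"
proof (cases "integrable (count_space UNIV) (\<lambda>k. cis (of_int k * \<phi>) * c k)")
  case True
  then show ?thesis unfolding fourier_series_def
    using integral_norm_bound[of "count_space UNIV" "\<lambda>k. cis (of_int k * \<phi>) * c k"] by (simp add: norm_mult)
next
  case False
  then show ?thesis unfolding fourier_series_def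
    by (simp add: not_integrable_integral_eq integral_nonneg_AE)
qed

text \<open>Summability of \<open>c\<close> gives Fubini for Lebesgue times counting measure;
  orthogonality of the exponentials leaves the term \<open>k = n\<close>.\<close>

lemma fourier_series_coefficient:
  assumes c: "integrable (count_space UNIV) c"
  shows "(LINT \<phi>:{0..2 * pi}|lborel. cis (- (of_int n * \<phi>)) * fourier_series c \<phi>) = 2 * of_real pi * c n"
proof -
  interpret pair_sigma_finite lborel "count_space (UNIV :: int set)"
    by (intro pair_sigma_finite.intro sigma_finite_int sigma_finite_lborel)
  let ?I = "\<lambda>\<phi>. complex_of_real (indicator {0..2 * pi} \<phi>)"
  have I: "integrable lborel ?I"
    by (intro integrable_of_real) (simp add: emeasure_lborel_Icc_eq)
  have P: "integrable (lborel \<Otimes>\<^sub>M count_space UNIV) (\<lambda>(\<phi>, k). ?I \<phi> * c k)"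
    by (rule integrable_pair_mult[OF sigma_finite_lborel sigma_finite_int I c])
  have m: "(\<lambda>(\<phi>, k). ?I \<phi> * (cis (of_int (k - n) * \<phi>) * c k)) \<in> borel_measurable (lborel \<Otimes>\<^sub>M count_space UNIV)"
    by (rule measurable_pair_countable2) auto
  have P2: "integrable (lborel \<Otimes>\<^sub>M count_space UNIV) (\<lambda>(\<phi>, k). ?I \<phi> * (cis (of_int (k - n) * \<phi>) * c k))"
    by (rule Bochner_Integration.integrable_bound[OF P m]) (auto simp: norm_mult)
  have "(LINT \<phi>:{0..2 * pi}|lborel. cis (- (of_int n * \<phi>)) * fourier_series c \<phi>)
    = (LINT \<phi>|lborel. LINT k|count_space UNIV. ?I \<phi> * (cis (of_int (k - n) * \<phi>) * c k))"
    unfolding set_lebesgue_integral_def fourier_series_def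
  proof (intro Bochner_Integration.integral_cong refl)
    fix \<phi>
    have "indicator {0..2 * pi} \<phi> *\<^sub>R (cis (- (of_int n * \<phi>)) * (LINT k|count_space UNIV. cis (of_int k * \<phi>) * c k))
      = (LINT k|count_space UNIV. (?I \<phi> * cis (- (of_int n * \<phi>))) * (cis (of_int k * \<phi>) * c k))"
      by (subst integral_mult_right_zero) (simp add: scaleR_conv_of_real)
    also have "\<dots> = (LINT k|count_space UNIV. ?I \<phi> * (cis (of_int (k - n) * \<phi>) * c k))"
    proof (intro Bochner_Integration.integral_cong refl)
      fix k
      have "cis (of_int (k - n) * \<phi>) = cis (- (of_int n * \<phi>)) * cis (of_int k * \<phi>)"
        by (simp add: cis_mult algebra_simps)
      then show "(?I \<phi> * cis (- (of_int n * \<phi>))) * (cis (of_int k * \<phi>) * c k) = ?I \<phi> * (cis (of_int (k - n) * \<phi>) * c k)"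
        by simp
    qed
    finally show "indicator {0..2 * pi} \<phi> *\<^sub>R (cis (- (of_int n * \<phi>)) * (LINT k|count_space UNIV. cis (of_int k * \<phi>) * c k))
      = (LINT k|count_space UNIV. ?I \<phi> * (cis (of_int (k - n) * \<phi>) * c k))" .
  qed
  also have "\<dots> = (LINT k|count_space UNIV. LINT \<phi>|lborel. ?I \<phi> * (cis (of_int (k - n) * \<phi>) * c k))"
    using Fubini_integral[OF P2] by simp
  also have "\<dots> = (LINT k|count_space UNIV. (LINT \<phi>:{0..2 * pi}|lborel. cis (of_int (k - n) * \<phi>)) * c k)"
    unfolding set_lebesgue_integral_def
    by (simp add: scaleR_conv_of_real mult.assoc flip: integral_mult_left_zero)
  also have "\<dots> = (LINT k|count_space UNIV. (if k = n then 2 * of_real pi * c n else 0))"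
    by (intro Bochner_Integration.integral_cong refl) (simp only: integral_cis_period, simp)
  also have "\<dots> = 2 * of_real pi * c n"
    by (subst lebesgue_integral_count_space_finite_support) (auto simp: if_distrib cong: if_cong)
  finally show ?thesis .
qed

text \<open>One factor of the squared modulus is expanded into its series and integrated against the
  conjugate of the other; the coefficient formula identifies each term.\<close>

lemma parseval_fourier_series:
  assumes c: "integrable (count_space UNIV) c"
  shows "(\<integral>\<^sup>+ \<phi>. indicator {0..2 * pi} \<phi> * ennreal ((cmod (fourier_series c \<phi>))\<^sup>2) \<partial>lborel)
    = ennreal (2 * pi) * (\<integral>\<^sup>+ k. ennreal ((cmod (c k))\<^sup>2) \<partial>count_space UNIV)"
proof -
  interpret pair_sigma_finite lborel "count_space (UNIV :: int set)"
    by (intro pair_sigma_finite.intro sigma_finite_int sigma_finite_lborel)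
  let ?S = "fourier_series c"
  define B where "B = (LINT k|count_space UNIV. cmod (c k))"
  have SB: "cmod (?S \<phi>) \<le> B" for \<phi> unfolding B_def by (rule norm_fourier_series_le)
  have B0: "0 \<le> B" using order_trans[OF norm_ge_zero SB] .
  let ?J = "\<lambda>\<phi>. indicator {0..2 * pi} \<phi> *\<^sub>R cnj (?S \<phi>)"
  have J: "integrable lborel ?J"
    by (rule integrableI_bounded_set[of "{0..2*pi}" _ _ B])
       (use SB B0 in \<open>auto simp: emeasure_lborel_Icc_eq split: split_indicator intro!: AE_I2\<close>)
  have P: "integrable (lborel \<Otimes>\<^sub>M count_space UNIV) (\<lambda>(\<phi>, k). ?J \<phi> * c k)"
    by (rule integrable_pair_mult[OF sigma_finite_lborel sigma_finite_int J c])
  have m: "(\<lambda>(\<phi>, k). ?J \<phi> * (cis (of_int k * \<phi>) * c k)) \<in> borel_measurable (lborel \<Otimes>\<^sub>M count_space UNIV)"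
    by (rule measurable_pair_countable2) auto
  have P2: "integrable (lborel \<Otimes>\<^sub>M count_space UNIV) (\<lambda>(\<phi>, k). ?J \<phi> * (cis (of_int k * \<phi>) * c k))"
    by (rule Bochner_Integration.integrable_bound[OF P m]) (auto simp: norm_mult)
  have S2: "integrable lborel (\<lambda>\<phi>. indicator {0..2 * pi} \<phi> *\<^sub>R (cmod (?S \<phi>))\<^sup>2)"
    by (rule integrableI_bounded_set[of "{0..2*pi}" _ _ "B\<^sup>2"])
       (use SB B0 in \<open>auto simp: emeasure_lborel_Icc_eq power_mono split: split_indicator intro!: AE_I2\<close>)
  have c2: "integrable (count_space UNIV) (\<lambda>k. (cmod (c k))\<^sup>2)"
  proof (rule Bochner_Integration.integrable_bound)
    show "integrable (count_space UNIV) (\<lambda>k. B * cmod (c k))"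
      using c by (intro integrable_mult_right integrable_norm)
    \<comment> \<open>The coefficient formula bounds every coefficient by the bound \<open>B\<close>
      of the series, so |c k|^2 \<le> B |c k| is summable.\<close>
    have "2 * pi * cmod (c k) \<le> 2 * pi * B" for k
    proof -
      have "2 * pi * cmod (c k) = cmod (LINT \<phi>:{0..2 * pi}|lborel. cis (- (of_int k * \<phi>)) * ?S \<phi>)"
        by (simp add: fourier_series_coefficient[OF c] norm_mult)
      also have "\<dots> \<le> (LINT \<phi>:{0..2 * pi}|lborel. B)"
        unfolding set_lebesgue_integral_def
      proof (rule Bochner_Integration.integral_norm_bound_integral)
        show "integrable lborel (\<lambda>x. indicator {0..2 * pi} x *\<^sub>R (cis (- (of_int k * x)) * ?S x))"
          by (rule integrableI_bounded_set[of "{0..2*pi}" _ _ B])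
            (use SB B0 in \<open>auto simp: emeasure_lborel_Icc_eq norm_mult split: split_indicator intro!: AE_I2\<close>)
      qed (use SB B0 in \<open>auto simp: emeasure_lborel_Icc_eq norm_mult split: split_indicator\<close>)
      also have "\<dots> = 2 * pi * B" by (simp add: set_lebesgue_integral_def)
      finally show ?thesis .
    qed
    then show "AE k in count_space UNIV. norm ((cmod (c k))\<^sup>2) \<le> norm (B * cmod (c k))"
      using B0 by (auto simp: power2_eq_square abs_mult intro!: mult_right_mono)
  qed simp
  have "complex_of_real (LINT \<phi>|lborel. indicator {0..2 * pi} \<phi> *\<^sub>R (cmod (?S \<phi>))\<^sup>2)
     = (LINT \<phi>|lborel. complex_of_real (indicator {0..2 * pi} \<phi> *\<^sub>R (cmod (?S \<phi>))\<^sup>2))"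
    by (rule integral_complex_of_real[symmetric])
  also have "\<dots> = (LINT \<phi>|lborel. LINT k|count_space UNIV. ?J \<phi> * (cis (of_int k * \<phi>) * c k))"
  proof (intro Bochner_Integration.integral_cong refl)
    fix \<phi>
    have "complex_of_real (indicator {0..2 * pi} \<phi> *\<^sub>R (cmod (?S \<phi>))\<^sup>2) = ?J \<phi> * ?S \<phi>"
      by (simp only: scaleR_conv_of_real of_real_mult complex_norm_square id_apply of_real_eq_id) (simp add: mult_ac)
    also have "\<dots> = (LINT k|count_space UNIV. ?J \<phi> * (cis (of_int k * \<phi>) * c k))"
      unfolding fourier_series_def by (rule integral_mult_right_zero[symmetric])
    finally show "complex_of_real (indicator {0..2 * pi} \<phi> *\<^sub>R (cmod (?S \<phi>))\<^sup>2) =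
      (LINT k|count_space UNIV. ?J \<phi> * (cis (of_int k * \<phi>) * c k))" .
  qed
  also have "\<dots> = (LINT k|count_space UNIV. LINT \<phi>|lborel. ?J \<phi> * (cis (of_int k * \<phi>) * c k))"
    using Fubini_integral[OF P2] by simp
  also have "\<dots> = (LINT k|count_space UNIV. of_real (2 * pi * (cmod (c k))\<^sup>2))"
  proof (intro Bochner_Integration.integral_cong refl)
    fix k
    have "(LINT \<phi>|lborel. ?J \<phi> * (cis (of_int k * \<phi>) * c k))
      = (LINT \<phi>|lborel. cnj (indicator {0..2 * pi} \<phi> *\<^sub>R (cis (- (of_int k * \<phi>)) * ?S \<phi>)) * c k)"
      by (intro Bochner_Integration.integral_cong refl) (simp add: cis_cnj scaleR_conv_of_real mult_ac)
    also have "\<dots> = cnj (2 * of_real pi * c k) * c k"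
      unfolding fourier_series_coefficient[OF c, symmetric] set_lebesgue_integral_def
      by (simp only: integral_mult_left_zero Bochner_Integration.integral_cnj)
    also have "\<dots> = of_real (2 * pi * (cmod (c k))\<^sup>2)"
      by (simp only: of_real_mult complex_norm_square) simp
    finally show "(LINT \<phi>|lborel. ?J \<phi> * (cis (of_int k * \<phi>) * c k)) = of_real (2 * pi * (cmod (c k))\<^sup>2)" .
  qed
  also have "\<dots> = of_real (2 * pi * (LINT k|count_space UNIV. (cmod (c k))\<^sup>2))"
    by (simp only: integral_complex_of_real integral_mult_right_zero)
  finally have eq: "(LINT \<phi>|lborel. indicator {0..2 * pi} \<phi> *\<^sub>R (cmod (?S \<phi>))\<^sup>2) = 2 * pi * (LINT k|count_space UNIV. (cmod (c k))\<^sup>2)"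
    by (simp only: of_real_eq_iff)
  have "(\<integral>\<^sup>+ \<phi>. indicator {0..2 * pi} \<phi> * ennreal ((cmod (?S \<phi>))\<^sup>2) \<partial>lborel)
     = (\<integral>\<^sup>+ \<phi>. ennreal (indicator {0..2 * pi} \<phi> *\<^sub>R (cmod (?S \<phi>))\<^sup>2) \<partial>lborel)"
    by (intro nn_integral_cong) (auto split: split_indicator)
  also have "\<dots> = ennreal (2 * pi * (LINT k|count_space UNIV. (cmod (c k))\<^sup>2))"
    by (subst nn_integral_eq_integral[OF S2]) (auto simp only: eq, auto)
  also have "\<dots> = ennreal (2 * pi) * ennreal (LINT k|count_space UNIV. (cmod (c k))\<^sup>2)"
    by (rule ennreal_mult') (auto intro!: integral_nonneg_AE)
  also have "ennreal (LINT k|count_space UNIV. (cmod (c k))\<^sup>2) = (\<integral>\<^sup>+ k. ennreal ((cmod (c k))\<^sup>2) \<partial>count_space UNIV)"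
    by (rule nn_integral_eq_integral[symmetric, OF c2]) auto
  finally show ?thesis .
qed


section \<open>Fields synthesised from frequency data with quadratic decay\<close>

lemma integrable_inverse_square_int:
  "integrable (count_space UNIV) (\<lambda>n::int. 1 / (1 + (real_of_int n)\<^sup>2))"
proof -
  have "Infinite_Set_Sum.abs_summable_on (\<lambda>n::int. 1 / (1 + (real_of_int n)\<^sup>2)) (UNIV)"
  proof -
    have s: "summable (\<lambda>n. inverse ((real n) ^ 2))" by (rule inverse_power_summable) auto
    have a: "Infinite_Set_Sum.abs_summable_on (\<lambda>n::nat. 1 / (1 + (real n)\<^sup>2)) (UNIV)"
      unfolding abs_summable_on_nat_iff'
    proof (rule summable_comparison_test_ev[OF _ s], rule eventually_sequentiallyI[of 1])
      fix n :: nat assume "1 \<le> n"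
      then show "norm (norm (1 / (1 + (real n)\<^sup>2))) \<le> inverse ((real n)\<^sup>2)"
        by (simp add: field_simps abs_of_pos add_pos_nonneg)
    qed
    have "Infinite_Set_Sum.abs_summable_on (\<lambda>n::int. 1 / (1 + (real_of_int n)\<^sup>2)) ((range int \<union> range (\<lambda>n. - int n)))"
    proof (rule abs_summable_on_union)
      show "Infinite_Set_Sum.abs_summable_on (\<lambda>n::int. 1 / (1 + (real_of_int n)\<^sup>2)) (range int)"
        by (subst abs_summable_on_reindex_iff[symmetric]) (use a in \<open>auto simp: inj_on_def\<close>)
      show "Infinite_Set_Sum.abs_summable_on (\<lambda>n::int. 1 / (1 + (real_of_int n)\<^sup>2)) (range (\<lambda>n. - int n))"
        by (subst abs_summable_on_reindex_iff[symmetric]) (use a in \<open>auto simp: inj_on_def\<close>)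
    qed
    moreover have "range int \<union> range (\<lambda>n. - int n) = UNIV"
    proof (safe)
      fix x :: int assume "x \<notin> range (\<lambda>n. - int n)" show "x \<in> range int"
      proof (cases "x \<ge> 0")
        case True then show ?thesis by (intro image_eqI[of _ _ "nat x"]) auto
      next
        case False
        then have "x = - int (nat (- x))" by simp
        then show ?thesis using \<open>x \<notin> _\<close> by blast
      qed
    qed auto
    ultimately show ?thesis by simp
  qed
  then show ?thesis by (simp add: abs_summable_on_def)
qed

lemma integrable_inverse_square_real:
  "integrable lborel (\<lambda>\<xi>::real. 1 / (1 + \<xi>\<^sup>2))"
proof -
  have "set_integrable lborel (einterval (-\<infinity>) \<infinity>) (\<lambda>\<xi>::real. 1 / (1 + \<xi>\<^sup>2))"
  proof (rule interval_integral_FTC_nonneg(1)[where F = arctan and A = "- pi / 2" and B = "pi / 2"])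
    show "DERIV arctan x :> 1 / (1 + x\<^sup>2)" for x
      using DERIV_arctan[of x] by (simp add: inverse_eq_divide)
    have p: "1 + x\<^sup>2 \<noteq> 0" for x :: real using zero_le_power2[of x] by linarith
    show "isCont (\<lambda>\<xi>. 1 / (1 + \<xi>\<^sup>2)) x" for x :: real using p by (intro continuous_intros) auto
    show "((arctan \<circ> real_of_ereal) \<longlongrightarrow> - pi / 2) (at_right (-\<infinity>))"
      using tendsto_arctan_at_bot by (simp add: ereal_tendsto_simps1)
    show "((arctan \<circ> real_of_ereal) \<longlongrightarrow> pi / 2) (at_left \<infinity>)"
      using tendsto_arctan_at_top by (simp add: ereal_tendsto_simps1)
  qed auto
  then show ?thesis by (simp add: set_integrable_def einterval_def)
qed

text \<open>The factor 1/(2 pi) turns \<open>ft\<close> into the inverse of the transform in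
  \<open>L2_fourier\<close>. Every field that the theorem claims to exist is given in this
  form.\<close>

definition fourier_synthesis :: "(int \<Rightarrow> real \<Rightarrow> real \<Rightarrow> complex) \<Rightarrow> field" where
  "fourier_synthesis b = (\<lambda>(x, \<theta>, \<phi>). fourier_series (\<lambda>n. ft (\<lambda>\<xi>. b n \<xi> \<theta>) x / (2 * of_real pi)) \<phi>)"

text \<open>Continuity is asked for almost every frequency only, since the projections jump and the
  symbol of the radiation field may be discontinuous at \<xi> = 0. Decay of order two in \<xi> and
  in n, uniform in the polar angle, makes all integrals and sums absolutely convergent.\<close>

definition admissible :: "(int \<Rightarrow> real \<Rightarrow> real \<Rightarrow> complex) \<Rightarrow> bool" where
  "admissible b \<longleftrightarrow>
     (\<forall>n. (\<lambda>(\<xi>, \<theta>). b n \<xi> \<theta>) \<in> borel_measurable borel) \<and>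
     (\<forall>n \<theta>. AE \<xi> in lborel. isCont (\<lambda>\<xi>. b n \<xi> \<theta>) \<xi>) \<and>
     (\<exists>C. \<forall>n \<xi> \<theta>. cmod (b n \<xi> \<theta>) \<le> C * (1 / (1 + (real_of_int n)\<^sup>2)) * (1 / (1 + \<xi>\<^sup>2)))"

context
  fixes b assumes b: "admissible b"
begin

lemma admissible_bound:
  "\<exists>C\<ge>0. \<forall>n \<xi> \<theta>. cmod (b n \<xi> \<theta>) \<le> C * (1 / (1 + (real_of_int n)\<^sup>2)) * (1 / (1 + \<xi>\<^sup>2))"
proof -
  obtain C where C: "\<And>n \<xi> \<theta>. cmod (b n \<xi> \<theta>) \<le> C * (1 / (1 + (real_of_int n)\<^sup>2)) * (1 / (1 + \<xi>\<^sup>2))"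
    using b unfolding admissible_def by blast
  have "0 \<le> C" using order_trans[OF norm_ge_zero C[of 0 0 0]] by simp
  with C show ?thesis by blast
qed

lemma admissible_measurable_pair: "(\<lambda>(\<xi>, \<theta>). b n \<xi> \<theta>) \<in> borel_measurable (borel \<Otimes>\<^sub>M borel)"
  using b unfolding admissible_def borel_prod by blast

lemma admissible_measurable [measurable]: "(\<lambda>\<xi>. b n \<xi> \<theta>) \<in> borel_measurable borel"
  using measurable_compose[OF measurable_Pair2' admissible_measurable_pair, of \<theta>] by simp

lemma admissible_integrable: "integrable lborel (\<lambda>\<xi>. b n \<xi> \<theta>)"
proof -
  obtain C where C: "C \<ge> 0" "\<And>n \<xi> \<theta>. cmod (b n \<xi> \<theta>) \<le> C * (1 / (1 + (real_of_int n)\<^sup>2)) * (1 / (1 + \<xi>\<^sup>2))"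
    using admissible_bound by blast
  show ?thesis
    by (rule Bochner_Integration.integrable_bound
        [OF integrable_mult_right[OF integrable_inverse_square_real, of "C * (1 / (1 + (real_of_int n)\<^sup>2))"]])
      (use C in \<open>auto intro!: AE_I2 order_trans[OF _ abs_ge_self]\<close>)
qed

lemma admissible_bounded: obtains B where "\<And>n \<xi> \<theta>. cmod (b n \<xi> \<theta>) \<le> B"
proof -
  obtain C where C: "C \<ge> 0" "\<And>n \<xi> \<theta>. cmod (b n \<xi> \<theta>) \<le> C * (1 / (1 + (real_of_int n)\<^sup>2)) * (1 / (1 + \<xi>\<^sup>2))"
    using admissible_bound by blast
  have "cmod (b n \<xi> \<theta>) \<le> C" for n \<xi> \<theta>
  proof -
    have "C * (1 / (1 + (real_of_int n)\<^sup>2)) * (1 / (1 + \<xi>\<^sup>2)) \<le> C * 1 * 1"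
      using C(1) by (intro mult_mono) (auto simp: divide_le_eq_1 add_pos_nonneg intro!: mult_nonneg_nonneg)
    then show ?thesis using C(2)[of n \<xi> \<theta>] by simp
  qed
  then show thesis by (rule that)
qed

lemma admissible_cont: "AE \<xi> in lborel. isCont (\<lambda>\<xi>. b n \<xi> \<theta>) \<xi>"
  using b unfolding admissible_def by blast

lemma L2_fourier_admissible: "L2_fourier (\<lambda>x. ft (\<lambda>\<xi>. b n \<xi> \<theta>) x / (2 * of_real pi)) (\<lambda>\<xi>. b n \<xi> \<theta>)"
proof -
  obtain B where "\<And>n \<xi> \<theta>. cmod (b n \<xi> \<theta>) \<le> B" using admissible_bounded by blast
  then show ?thesis by (intro L2_fourier_ft[of _ B] admissible_integrable admissible_cont)
qed

lemma fourier_synthesis_coeff_integrable: "integrable (count_space UNIV) (\<lambda>n. ft (\<lambda>\<xi>. b n \<xi> \<theta>) x / (2 * of_real pi))"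
proof -
  obtain C where C: "C \<ge> 0" "\<And>n \<xi> \<theta>. cmod (b n \<xi> \<theta>) \<le> C * (1 / (1 + (real_of_int n)\<^sup>2)) * (1 / (1 + \<xi>\<^sup>2))"
    using admissible_bound by blast
  define I where "I = (LINT \<xi>|lborel. 1 / (1 + \<xi>\<^sup>2 :: real))"
  have bd: "cmod (ft (\<lambda>\<xi>. b n \<xi> \<theta>) x) \<le> C * I * (1 / (1 + (real_of_int n)\<^sup>2))" for n
  proof -
    have "cmod (ft (\<lambda>\<xi>. b n \<xi> \<theta>) x) \<le> (LINT \<xi>|lborel. cmod (b n \<xi> \<theta>))" by (rule ft_bound)
    also have "\<dots> \<le> (LINT \<xi>|lborel. C * (1 / (1 + (real_of_int n)\<^sup>2)) * (1 / (1 + \<xi>\<^sup>2)))"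
      by (intro integral_mono integrable_norm admissible_integrable integrable_mult_right integrable_inverse_square_real C)
    also have "\<dots> = C * I * (1 / (1 + (real_of_int n)\<^sup>2))"
      unfolding I_def by (subst integral_mult_right_zero) simp
    finally show ?thesis .
  qed
  have "0 \<le> I" unfolding I_def by (intro integral_nonneg_AE AE_I2) (simp add: add_nonneg_nonneg)
  then have CI: "\<bar>C * I\<bar> = C * I" using C(1) by simp
  show ?thesis
    by (intro integrable_divide_zero Bochner_Integration.integrable_bound
        [OF integrable_mult_right[OF integrable_inverse_square_int, of "C * I"]])
      (use bd CI in auto)
qed

lemma az_mode_synthesis: "az_mode n (fourier_synthesis b) \<theta> x = ft (\<lambda>\<xi>. b n \<xi> \<theta>) x / (2 * of_real pi)"
  unfolding az_mode_def fourier_synthesis_def by (simp add: fourier_series_coefficient[OF fourier_synthesis_coeff_integrable])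

lemma fourier_mult_L2_synthesis: "L2_fourier (az_mode n (fourier_synthesis b) \<theta>) (\<lambda>\<xi>. b n \<xi> \<theta>)"
  unfolding az_mode_synthesis[abs_def] by (rule L2_fourier_admissible)

lemma fourier_synthesis_measurable: "fourier_synthesis b \<in> borel_measurable borel"
proof -
  have f: "(\<lambda>(x, \<theta>). ft (\<lambda>\<xi>. b n \<xi> \<theta>) x / (2 * of_real pi)) \<in> borel_measurable (borel \<Otimes>\<^sub>M borel)" for n
  proof -
    have [measurable]: "(\<lambda>z. b n (fst z) (snd z)) \<in> borel_measurable (borel \<Otimes>\<^sub>M borel)"
      using admissible_measurable_pair[of n] by (simp add: case_prod_beta)
    have "(\<lambda>p. cis (fst (fst p) * snd p) * b n (fst (snd p, snd (fst p))) (snd (snd p, snd (fst p)))) \<in> borel_measurable ((borel \<Otimes>\<^sub>M borel) \<Otimes>\<^sub>M lborel)"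
      by measurable
    then have "(\<lambda>(x, \<theta>). LINT \<xi>|lborel. cis (x * \<xi>) * b n \<xi> \<theta>) \<in> borel_measurable (borel \<Otimes>\<^sub>M borel)"
      using lborel.borel_measurable_lebesgue_integral[of "\<lambda>p \<xi>. cis (fst p * \<xi>) * b n \<xi> (snd p)" "borel \<Otimes>\<^sub>M borel"]
      by (simp add: case_prod_beta)
    then show ?thesis unfolding ft_def by (simp add: case_prod_beta)
  qed
  interpret sigma_finite_measure "count_space (UNIV :: int set)" by (rule sigma_finite_int)
  have g: "(\<lambda>(p, k). cis (of_int k * snd (snd p)) * (ft (\<lambda>\<xi>. b k \<xi> (fst (snd p))) (fst p) / (2 * of_real pi)))
     \<in> borel_measurable ((borel \<Otimes>\<^sub>M (borel \<Otimes>\<^sub>M borel)) \<Otimes>\<^sub>M count_space UNIV)"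
  proof (rule measurable_pair_countable2)
    fix k :: int
    have [measurable]: "(\<lambda>z. ft (\<lambda>\<xi>. b k \<xi> (snd z)) (fst z) / (2 * of_real pi)) \<in> borel_measurable (borel \<Otimes>\<^sub>M borel)"
      using f[of k] by (simp add: case_prod_beta)
    have "(\<lambda>p :: real \<times> real \<times> real. ft (\<lambda>\<xi>. b k \<xi> (snd (fst p, fst (snd p)))) (fst (fst p, fst (snd p))) / (2 * of_real pi))
      \<in> borel_measurable (borel \<Otimes>\<^sub>M (borel \<Otimes>\<^sub>M borel))"
      by measurable
    then have [measurable]: "(\<lambda>p :: real \<times> real \<times> real. ft (\<lambda>\<xi>. b k \<xi> (fst (snd p))) (fst p) / (2 * of_real pi))
      \<in> borel_measurable (borel \<Otimes>\<^sub>M (borel \<Otimes>\<^sub>M borel))" by simp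
    have "(\<lambda>p. cis (of_int k * snd (snd p)) * (ft (\<lambda>\<xi>. b k \<xi> (fst (snd p))) (fst p) / (2 * of_real pi)))
      \<in> borel_measurable (borel \<Otimes>\<^sub>M (borel \<Otimes>\<^sub>M borel))" by measurable
    then show "(\<lambda>p. case (p, k) of (p, k) \<Rightarrow> cis (of_int k * snd (snd p)) * (ft (\<lambda>\<xi>. b k \<xi> (fst (snd p))) (fst p) / (2 * of_real pi)))
      \<in> borel_measurable (borel \<Otimes>\<^sub>M (borel \<Otimes>\<^sub>M borel))" by simp
  qed auto
  have "fourier_synthesis b \<in> borel_measurable (borel \<Otimes>\<^sub>M (borel \<Otimes>\<^sub>M borel))"
    using borel_measurable_lebesgue_integral[OF g] by (simp add: fourier_synthesis_def fourier_series_def case_prod_beta)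
  then show ?thesis by (simp add: borel_prod)
qed

text \<open>Parseval in the azimuth, then Plancherel in time, at a fixed polar angle.\<close>

lemma nn_integral_synthesis_slice:
  "(\<integral>\<^sup>+ x. \<integral>\<^sup>+ \<phi>. indicator {0..2 * pi} \<phi> * ennreal ((cmod (fourier_synthesis b (x, \<theta>, \<phi>)))\<^sup>2) \<partial>lborel \<partial>lborel)
     = (\<integral>\<^sup>+ n. \<integral>\<^sup>+ \<xi>. ennreal ((cmod (b n \<xi> \<theta>))\<^sup>2) \<partial>lborel \<partial>count_space UNIV)"
proof -
  obtain B where B: "\<And>n \<xi> \<theta>. cmod (b n \<xi> \<theta>) \<le> B" using admissible_bounded by blast
  let ?c = "\<lambda>x n. ft (\<lambda>\<xi>. b n \<xi> \<theta>) x / (2 * of_real pi)"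
  have "(\<integral>\<^sup>+ x. \<integral>\<^sup>+ \<phi>. indicator {0..2 * pi} \<phi> * ennreal ((cmod (fourier_synthesis b (x, \<theta>, \<phi>)))\<^sup>2) \<partial>lborel \<partial>lborel)
    = (\<integral>\<^sup>+ x. \<integral>\<^sup>+ n. ennreal (2 * pi) * ennreal ((cmod (?c x n))\<^sup>2) \<partial>count_space UNIV \<partial>lborel)"
    unfolding fourier_synthesis_def prod.case parseval_fourier_series[OF fourier_synthesis_coeff_integrable] by (subst nn_integral_cmult) auto
  also have "\<dots> = (\<integral>\<^sup>+ n. \<integral>\<^sup>+ x. ennreal (2 * pi) * ennreal ((cmod (?c x n))\<^sup>2) \<partial>lborel \<partial>count_space UNIV)"
    by (rule nn_integral_count_space_nn_integral) auto
  also have "\<dots> = (\<integral>\<^sup>+ n. \<integral>\<^sup>+ \<xi>. ennreal ((cmod (b n \<xi> \<theta>))\<^sup>2) \<partial>lborel \<partial>count_space UNIV)"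
  proof (rule nn_integral_cong)
    fix n :: int
    \<comment> \<open>The constants cancel: 2 pi from Parseval, 1/(2 pi)^2 from the synthesis, 2 pi
      from Plancherel.\<close>
    note pl = plancherel[OF admissible_integrable B admissible_cont, of n \<theta>]
    have "(\<integral>\<^sup>+ x. ennreal (2 * pi) * ennreal ((cmod (?c x n))\<^sup>2) \<partial>lborel)
        = (\<integral>\<^sup>+ x. ennreal ((1 / (2 * pi)) * (cmod (ft (\<lambda>\<xi>. b n \<xi> \<theta>) x))\<^sup>2) \<partial>lborel)"
      by (intro nn_integral_cong) (simp add: norm_divide norm_mult power_divide power2_eq_square field_simps flip: ennreal_mult)
    also have "\<dots> = ennreal (LINT x|lborel. (1 / (2 * pi)) * (cmod (ft (\<lambda>\<xi>. b n \<xi> \<theta>) x))\<^sup>2)"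
      by (intro nn_integral_eq_integral integrable_mult_right pl) auto
    also have "\<dots> = ennreal (LINT \<xi>|lborel. (cmod (b n \<xi> \<theta>))\<^sup>2)"
      by (subst integral_mult_right_zero) (simp add: pl)
    also have "\<dots> = (\<integral>\<^sup>+ \<xi>. ennreal ((cmod (b n \<xi> \<theta>))\<^sup>2) \<partial>lborel)"
      by (intro nn_integral_eq_integral[symmetric] square_integrable_bounded[OF admissible_integrable B]) auto
    finally show "(\<integral>\<^sup>+ x. ennreal (2 * pi) * ennreal ((cmod (?c x n))\<^sup>2) \<partial>lborel) = (\<integral>\<^sup>+ \<xi>. ennreal ((cmod (b n \<xi> \<theta>))\<^sup>2) \<partial>lborel)" .
  qed
  finally show ?thesis .
qed

text \<open>The weight of \<open>cyl\<close> depends on the polar angle alone, so Tonelli brings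
  that variable outside and the slice identity applies inside.\<close>

lemma nn_integral_synthesis:
  "(\<integral>\<^sup>+ z. ennreal ((cmod (fourier_synthesis b z))\<^sup>2) \<partial>cyl) =
     (\<integral>\<^sup>+ \<theta>. indicator {0..pi} \<theta> * ennreal (sin \<theta>) *
       (\<integral>\<^sup>+ n. \<integral>\<^sup>+ \<xi>. ennreal ((cmod (b n \<xi> \<theta>))\<^sup>2) \<partial>lborel \<partial>count_space UNIV) \<partial>lborel)"
proof -
  have [measurable]: "fourier_synthesis b \<in> borel_measurable (borel \<Otimes>\<^sub>M (borel \<Otimes>\<^sub>M borel))"
    using fourier_synthesis_measurable by (simp add: borel_prod)
  let ?w = "\<lambda>(x::real, \<theta>, \<phi>). indicator ({0..pi} \<times> {0..2 * pi}) (\<theta>, \<phi>) * ennreal (sin \<theta>)"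
  have w: "?w = (\<lambda>z. indicator {0..pi} (fst (snd z)) * ennreal (sin (fst (snd z))) * indicator {0..2 * pi} (snd (snd z)))"
    by (auto simp: fun_eq_iff split: split_indicator)
  have [measurable]: "sin \<in> borel_measurable (borel :: real measure)"
    by (intro borel_measurable_continuous_onI continuous_intros)
  have "(\<integral>\<^sup>+ z. ennreal ((cmod (fourier_synthesis b z))\<^sup>2) \<partial>cyl) = (\<integral>\<^sup>+ z. ?w z * ennreal ((cmod (fourier_synthesis b z))\<^sup>2) \<partial>lborel)"
    unfolding cyl_def w by (rule nn_integral_density) (auto simp: borel_prod[symmetric])
  also have "\<dots> = (\<integral>\<^sup>+ z. ?w z * ennreal ((cmod (fourier_synthesis b z))\<^sup>2) \<partial>(lborel \<Otimes>\<^sub>M (lborel \<Otimes>\<^sub>M lborel)))"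
    by (simp add: lborel_prod)
  also have "\<dots> = (\<integral>\<^sup>+ x. \<integral>\<^sup>+ y. ?w (x, y) * ennreal ((cmod (fourier_synthesis b (x, y)))\<^sup>2) \<partial>(lborel \<Otimes>\<^sub>M lborel) \<partial>lborel)"
    unfolding w
    by (intro sigma_finite_measure.nn_integral_fst[symmetric] sigma_finite_pair_measure sigma_finite_lborel)
       (auto)
  also have "\<dots> = (\<integral>\<^sup>+ x. \<integral>\<^sup>+ \<theta>. \<integral>\<^sup>+ \<phi>. ?w (x, \<theta>, \<phi>) * ennreal ((cmod (fourier_synthesis b (x, \<theta>, \<phi>)))\<^sup>2) \<partial>lborel \<partial>lborel \<partial>lborel)"
    unfolding w
    by (intro nn_integral_cong lborel.nn_integral_fst[symmetric]) auto
  also have "\<dots> = (\<integral>\<^sup>+ \<theta>. \<integral>\<^sup>+ x. \<integral>\<^sup>+ \<phi>. ?w (x, \<theta>, \<phi>) * ennreal ((cmod (fourier_synthesis b (x, \<theta>, \<phi>)))\<^sup>2) \<partial>lborel \<partial>lborel \<partial>lborel)"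
    unfolding w by (rule lborel_pair.Fubini') auto
  also have "\<dots> = (\<integral>\<^sup>+ \<theta>. indicator {0..pi} \<theta> * ennreal (sin \<theta>) *
     (\<integral>\<^sup>+ x. \<integral>\<^sup>+ \<phi>. indicator {0..2 * pi} \<phi> * ennreal ((cmod (fourier_synthesis b (x, \<theta>, \<phi>)))\<^sup>2) \<partial>lborel \<partial>lborel) \<partial>lborel)"
  proof (rule nn_integral_cong)
    fix \<theta>
    have "(\<integral>\<^sup>+ x. \<integral>\<^sup>+ \<phi>. ?w (x, \<theta>, \<phi>) * ennreal ((cmod (fourier_synthesis b (x, \<theta>, \<phi>)))\<^sup>2) \<partial>lborel \<partial>lborel)
      = (\<integral>\<^sup>+ x. \<integral>\<^sup>+ \<phi>. (indicator {0..pi} \<theta> * ennreal (sin \<theta>)) * (indicator {0..2 * pi} \<phi> * ennreal ((cmod (fourier_synthesis b (x, \<theta>, \<phi>)))\<^sup>2)) \<partial>lborel \<partial>lborel)"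
      unfolding w by (simp add: mult_ac)
    also have "\<dots> = (\<integral>\<^sup>+ x. (indicator {0..pi} \<theta> * ennreal (sin \<theta>)) * (\<integral>\<^sup>+ \<phi>. indicator {0..2 * pi} \<phi> * ennreal ((cmod (fourier_synthesis b (x, \<theta>, \<phi>)))\<^sup>2) \<partial>lborel) \<partial>lborel)"
      by (intro nn_integral_cong nn_integral_cmult) auto
    also have "\<dots> = indicator {0..pi} \<theta> * ennreal (sin \<theta>) *
     (\<integral>\<^sup>+ x. \<integral>\<^sup>+ \<phi>. indicator {0..2 * pi} \<phi> * ennreal ((cmod (fourier_synthesis b (x, \<theta>, \<phi>)))\<^sup>2) \<partial>lborel \<partial>lborel)"
      by (intro nn_integral_cmult) auto
    finally show "(\<integral>\<^sup>+ x. \<integral>\<^sup>+ \<phi>. ?w (x, \<theta>, \<phi>) * ennreal ((cmod (fourier_synthesis b (x, \<theta>, \<phi>)))\<^sup>2) \<partial>lborel \<partial>lborel) = indicator {0..pi} \<theta> * ennreal (sin \<theta>) *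
     (\<integral>\<^sup>+ x. \<integral>\<^sup>+ \<phi>. indicator {0..2 * pi} \<phi> * ennreal ((cmod (fourier_synthesis b (x, \<theta>, \<phi>)))\<^sup>2) \<partial>lborel \<partial>lborel)" .
  qed
  finally show ?thesis unfolding nn_integral_synthesis_slice .
qed

lemma L2_field_synthesis: "L2_field (fourier_synthesis b)"
proof -
  obtain C where C: "C \<ge> 0" "\<And>n \<xi> \<theta>. cmod (b n \<xi> \<theta>) \<le> C * (1 / (1 + (real_of_int n)\<^sup>2)) * (1 / (1 + \<xi>\<^sup>2))"
    using admissible_bound by blast
  let ?u = "\<lambda>n. 1 / (1 + (real_of_int n)\<^sup>2)" and ?w = "\<lambda>\<xi>. 1 / (1 + \<xi>\<^sup>2) :: real"
  have u1: "0 \<le> ?u n" "?u n \<le> 1" for n by (auto simp: divide_le_eq_1 add_pos_nonneg)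
  have w1: "0 \<le> ?w \<xi>" "?w \<xi> \<le> 1" for \<xi> by (auto simp: divide_le_eq_1 add_pos_nonneg)
  define K where "K = (\<integral>\<^sup>+ n. \<integral>\<^sup>+ \<xi>. ennreal (C\<^sup>2) * (ennreal (?u n) * ennreal (?w \<xi>)) \<partial>lborel \<partial>count_space UNIV)"
  have "(\<integral>\<^sup>+ \<xi>. ennreal (?w \<xi>) \<partial>lborel) < \<infinity>"
    using integrable_inverse_square_real unfolding integrable_iff_bounded by simp
  moreover have "(\<integral>\<^sup>+ n. ennreal (?u n) \<partial>count_space UNIV) < \<infinity>"
    using integrable_inverse_square_int unfolding integrable_iff_bounded by simp
  ultimately have K: "K < \<infinity>" unfolding K_def
    by (simp add: nn_integral_cmult nn_integral_multc ennreal_mult_less_top)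
  \<comment> \<open>Both weights are at most 1, so their squares may be replaced by first powers,
    whose integrals are known to be finite.\<close>
  have sq: "(cmod (b n \<xi> \<theta>))\<^sup>2 \<le> C\<^sup>2 * (?u n * ?w \<xi>)" for n \<xi> \<theta>
  proof -
    have "(cmod (b n \<xi> \<theta>))\<^sup>2 \<le> (C * ?u n * ?w \<xi>)\<^sup>2" using C by (intro power_mono) auto
    also have "\<dots> = C\<^sup>2 * ((?u n)\<^sup>2 * (?w \<xi>)\<^sup>2)" by (simp only: power_mult_distrib mult.assoc)
    also have "\<dots> \<le> C\<^sup>2 * (?u n * ?w \<xi>)"
      using power_decreasing[of 1 2, OF _ u1(1,2)[of n]] power_decreasing[of 1 2, OF _ w1(1,2)[of \<xi>]] u1(1)[of n]
      by (intro mult_left_mono mult_mono) simp_all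
    finally show ?thesis .
  qed
  have "(\<integral>\<^sup>+ n. \<integral>\<^sup>+ \<xi>. ennreal ((cmod (b n \<xi> \<theta>))\<^sup>2) \<partial>lborel \<partial>count_space UNIV) \<le> K" for \<theta>
    unfolding K_def
  proof (intro nn_integral_mono)
    fix n \<xi>
    show "ennreal ((cmod (b n \<xi> \<theta>))\<^sup>2) \<le> ennreal (C\<^sup>2) * (ennreal (?u n) * ennreal (?w \<xi>))"
      using sq[of n \<xi> \<theta>] u1[of n] w1[of \<xi>] C(1)
      by (subst ennreal_mult[symmetric], simp, simp, subst ennreal_mult[symmetric]) (auto intro!: ennreal_leI)
  qed
  then have "(\<integral>\<^sup>+ z. ennreal ((cmod (fourier_synthesis b z))\<^sup>2) \<partial>cyl) \<le> (\<integral>\<^sup>+ \<theta>. indicator {0..pi} \<theta> * 1 * K \<partial>lborel)"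
    unfolding nn_integral_synthesis by (intro nn_integral_mono mult_mono) auto
  also have "\<dots> = emeasure lborel {0..pi} * K" by (simp add: nn_integral_multc)
  also have "\<dots> < \<infinity>" using K by (simp add: ennreal_mult_less_top emeasure_lborel_Icc_eq)
  finally show ?thesis unfolding L2_field_def
    using fourier_synthesis_measurable by (simp add: cyl_def)
qed

end

text \<open>Reduces the construction of a multiplied field to two checks: admissibility of the
  multiplied data, and knowledge of the transforms \<open>g\<close> of the modes of \<open>f\<close>
  for polar angles in [0, pi].\<close>

lemma fourier_mult_synthesis:
  assumes "admissible (\<lambda>n \<xi> \<theta>. of_real (\<mu> \<xi> n) * g n \<xi> \<theta>)"
    and "\<And>n \<theta>. 0 \<le> \<theta> \<Longrightarrow> \<theta> \<le> pi \<Longrightarrow> L2_fourier (az_mode n f \<theta>) (\<lambda>\<xi>. g n \<xi> \<theta>)"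
  shows "fourier_mult \<mu> f (fourier_synthesis (\<lambda>n \<xi> \<theta>. of_real (\<mu> \<xi> n) * g n \<xi> \<theta>))"
  unfolding fourier_mult_def
  using L2_field_synthesis[OF assms(1)] fourier_mult_L2_synthesis[OF assms(1)] assms(2) by blast

section \<open>The Mellin integral\<close>

lemma has_vector_derivative_iff_lim:
  fixes f :: "real \<Rightarrow> 'a::real_normed_vector"
  shows "(f has_vector_derivative d) (at x) \<longleftrightarrow> ((\<lambda>y. (1 / (y - x)) *\<^sub>R (f y - f x)) \<longlongrightarrow> d) (at x)"
proof -
  have "norm (f y - f x - (y - x) *\<^sub>R d) / norm (y - x) = dist ((1 / (y - x)) *\<^sub>R (f y - f x)) d" if "y \<noteq> x" for y
  proof -
    have "(1 / (y - x)) *\<^sub>R (f y - f x) - d = (1 / (y - x)) *\<^sub>R (f y - f x - (y - x) *\<^sub>R d)"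
      using that by (simp add: scaleR_diff_right)
    then show ?thesis by (simp add: dist_norm divide_inverse)
  qed
  then show ?thesis
    unfolding has_vector_derivative_def has_derivative_at' Lim_at dist_norm[of _ x]
    by (auto simp: bounded_linear_scaleR_left)
qed

text \<open>The mean value inequality dominates the difference quotients by \<open>g\<close>, so
  dominated convergence applies along every sequence tending to the point.\<close>

lemma has_vector_derivative_integral_dominated:
  fixes f f' :: "real \<Rightarrow> 'a \<Rightarrow> 'b::{banach, second_countable_topology}"
  assumes x: "x \<in> {a<..<b}"
    and int: "\<And>x. x \<in> {a<..<b} \<Longrightarrow> integrable M (f x)"
    and meas: "f' x \<in> borel_measurable M"
    and der: "\<And>x s. x \<in> {a<..<b} \<Longrightarrow> s \<in> space M \<Longrightarrow> ((\<lambda>x. f x s) has_vector_derivative f' x s) (at x)"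
    and g: "integrable M g"
    and bd: "\<And>x s. x \<in> {a<..<b} \<Longrightarrow> s \<in> space M \<Longrightarrow> norm (f' x s) \<le> g s"
  shows "((\<lambda>x. LINT s|M. f x s) has_vector_derivative (LINT s|M. f' x s)) (at x)"
proof -
  have "((\<lambda>y. (1 / (y - x)) *\<^sub>R ((LINT s|M. f y s) - (LINT s|M. f x s))) \<longlongrightarrow> (LINT s|M. f' x s)) (at x within {a<..<b})"
    unfolding tendsto_at_iff_sequentially comp_def
  proof (intro allI impI)
    fix X :: "nat \<Rightarrow> real"
    assume X: "\<forall>i. X i \<in> {a<..<b} - {x}" and lim: "X \<longlonglongrightarrow> x"
    note [measurable] = borel_measurable_integrable[OF int] meas
    have "(\<lambda>i. LINT s|M. (1 / (X i - x)) *\<^sub>R (f (X i) s - f x s)) \<longlonglongrightarrow> (LINT s|M. f' x s)"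
    proof (rule integral_dominated_convergence[OF meas _ g])
      show "(\<lambda>s. (1 / (X i - x)) *\<^sub>R (f (X i) s - f x s)) \<in> borel_measurable M" for i
        using int[of "X i"] int[OF x] X by auto
      show "AE s in M. (\<lambda>i. (1 / (X i - x)) *\<^sub>R (f (X i) s - f x s)) \<longlonglongrightarrow> f' x s"
      proof (rule AE_I2)
        fix s assume s: "s \<in> space M"
        have "((\<lambda>y. (1 / (y - x)) *\<^sub>R (f y s - f x s)) \<longlongrightarrow> f' x s) (at x)"
          using der[OF x s] by (simp add: has_vector_derivative_iff_lim)
        then show "(\<lambda>i. (1 / (X i - x)) *\<^sub>R (f (X i) s - f x s)) \<longlonglongrightarrow> f' x s"
          unfolding tendsto_at_iff_sequentially comp_def using X lim by auto
      qed
      show "AE s in M. norm ((1 / (X i - x)) *\<^sub>R (f (X i) s - f x s)) \<le> g s" for i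
      proof (rule AE_I2)
        fix s assume s: "s \<in> space M"
        have "norm (f (X i) s - f x s) \<le> g s * norm (X i - x)"
        proof (rule differentiable_bound[where S = "{a<..<b}" and f' = "\<lambda>y t. t *\<^sub>R f' y s"])
          show "((\<lambda>x. f x s) has_derivative (\<lambda>t. t *\<^sub>R f' y s)) (at y within {a<..<b})" if "y \<in> {a<..<b}" for y
            using der[OF that s] by (auto simp: has_vector_derivative_def intro: has_derivative_at_withinI)
          show "onorm (\<lambda>t. t *\<^sub>R f' y s) \<le> g s" if "y \<in> {a<..<b}" for y
            using bd[OF that s] by (auto intro!: onorm_le mult_left_mono simp: mult.commute[of "g s"])
        qed (use X x in auto)
        then show "norm ((1 / (X i - x)) *\<^sub>R (f (X i) s - f x s)) \<le> g s"
          using X[rule_format, of i] by (simp add: pos_divide_le_eq del: scaleR_diff_right flip: scaleR_diff_right)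
      qed
    qed
    then show "(\<lambda>i. (1 / (X i - x)) *\<^sub>R ((LINT s|M. f (X i) s) - (LINT s|M. f x s))) \<longlonglongrightarrow> (LINT s|M. f' x s)"
      using X int x by auto
  qed
  moreover have "at x within {a<..<b} = at x" using x by (intro at_within_open) auto
  ultimately show ?thesis
    by (simp add: has_vector_derivative_iff_lim)
qed


text \<open>The squared modulus of Gamma(1 + i\<beta>) (i\<xi>)^(-i\<beta>) as a function of x =
  \<beta> sgn \<xi>. The value at 0 is the limit of the quotient.\<close>

definition mellin_weight :: "real \<Rightarrow> real" where
  "mellin_weight x = (if x = 0 then 1 else 2 * pi * x / (1 - exp (- (2 * pi * x))))"

text \<open>Apart from signs, the input is the tangent inequality \<open>1 + y \<le> exp y\<close>,
  at \<open>y\<close> and at \<open>- y\<close>. The disjunctions restrict a bound to one sign of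
  \<open>y\<close>.\<close>

lemma one_minus_exp_bounds:
  fixes y :: real
  assumes "y \<noteq> 0"
  shows "1 \<le> y / (1 - exp (- y)) \<or> y < 0" "y \<le> y / (1 - exp (- y))" "y / (1 - exp (- y)) \<le> 1 + \<bar>y\<bar>" "exp y \<le> y / (1 - exp (- y)) \<or> y > 0" "y / (1 - exp (- y)) > 0"
proof -
  have e: "1 - y \<le> exp (- y)" "1 + y \<le> exp y" using exp_ge_add_one_self[of "-y"] exp_ge_add_one_self[of y] by auto
  have m: "exp y * exp (- y) = 1" by (simp add: exp_minus)
  show "y / (1 - exp (- y)) > 0"
    using assms by (cases "y > 0") (auto simp: divide_neg_neg)
  show "1 \<le> y / (1 - exp (- y)) \<or> y < 0"
    using assms e by (cases "y > 0") (auto simp: field_simps)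
  show "y \<le> y / (1 - exp (- y))"
    using \<open>y / (1 - exp (- y)) > 0\<close> assms by (cases "y > 0") (simp_all add: pos_le_divide_eq)
  show "y / (1 - exp (- y)) \<le> 1 + \<bar>y\<bar>"
  proof (cases "y > 0")
    case True
    have "(1 + y) * exp (- y) \<le> exp y * exp (- y)" using e by (intro mult_right_mono) auto
    then show ?thesis using True m by (simp add: field_simps)
  next
    case False
    then have y: "y < 0" using assms by simp
    have "y / (1 - exp (- y)) \<le> 1" using y e by (simp add: field_simps)
    then show ?thesis by simp
  qed
  show "exp y \<le> y / (1 - exp (- y)) \<or> y > 0"
  proof (cases "y > 0")
    case False
    then have y: "y < 0" using assms by simp
    have "exp y * (exp (- y) - 1) \<le> - y" using e m by (simp add: algebra_simps)
    then have "exp y \<le> (- y) / (exp (- y) - 1)" using y by (subst pos_le_divide_eq) auto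
    also have "\<dots> = y / (1 - exp (- y))" using minus_divide_divide[of y "1 - exp (- y)"] by simp
    finally show ?thesis by simp
  qed auto
qed

lemma mellin_weight_ge_nonneg: "x \<ge> 0 \<Longrightarrow> mellin_weight x \<ge> 1" "x \<ge> 0 \<Longrightarrow> mellin_weight x \<ge> 2 * pi * x"
  using one_minus_exp_bounds(1,2)[of "2 * pi * x"] by (auto simp: mellin_weight_def mult_less_0_iff)

text \<open>For negative arguments the weight is exponentially small. This bound is sharp up to a
  linear factor and is the origin of \<open>exp (2 * pi * M)\<close> in the final constant.\<close>

lemma mellin_weight_ge_neg: "x \<le> 0 \<Longrightarrow> mellin_weight x \<ge> exp (2 * pi * x)"
  using one_minus_exp_bounds(4)[of "2 * pi * x"] by (auto simp: mellin_weight_def zero_less_mult_iff)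

lemma mellin_weight_le: "mellin_weight x \<le> 1 + 2 * pi * \<bar>x\<bar>"
  using one_minus_exp_bounds(3)[of "2 * pi * x"] by (auto simp: mellin_weight_def abs_mult)

text \<open>Conjugation symmetry turns the squared modulus into Gamma(1 + z) Gamma(1 - z) with z =
  i\<beta>, which the reflection formula evaluates. The modulus is even in \<beta>, so only |x| is
  tied to |\<beta>|; the sign of x will be that of \<beta>\<xi>.\<close>

lemma norm_Gamma_one_plus_imaginary:
  assumes "\<bar>x\<bar> = \<bar>\<beta>\<bar>"
  shows "(cmod (Gamma (1 + \<i> * of_real \<beta>)))\<^sup>2 * exp (pi * x) = mellin_weight x"
proof (cases "\<beta> = 0")
  case True
  then show ?thesis using assms by (simp add: mellin_weight_def)
next
  case False
  let ?z = "\<i> * complex_of_real \<beta>"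
  have G1: "Gamma (1 + ?z) = ?z * Gamma ?z"
  proof -
    have "?z \<notin> \<int>\<^sub>\<le>\<^sub>0" using False by (auto elim!: nonpos_Ints_cases simp: complex_eq_iff)
    then show ?thesis using Gamma_plus1[of ?z] by (simp add: add.commute)
  qed
  have "complex_of_real ((cmod (Gamma (1 + ?z)))\<^sup>2) = Gamma (1 + ?z) * Gamma (cnj (1 + ?z))"
    by (simp only: complex_norm_square cnj_Gamma)
  also have "\<dots> = ?z * (Gamma ?z * Gamma (1 - ?z))" using G1 by simp
  also have "\<dots> = ?z * (of_real pi / sin (of_real pi * ?z))" by (simp only: Gamma_reflection_complex)
  also have "sin (of_real pi * ?z) = \<i> * of_real ((exp (pi * \<beta>) - exp (- (pi * \<beta>))) / 2)"
    unfolding sin_exp_eq by (simp add: exp_of_real mult_ac field_simps flip: exp_of_real)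
  also have "?z * (of_real pi / (\<i> * of_real ((exp (pi * \<beta>) - exp (- (pi * \<beta>))) / 2))) = of_real (2 * pi * \<beta> / (exp (pi * \<beta>) - exp (- (pi * \<beta>))))"
    by (simp add: mult.commute[of _ \<i>] del: of_real_diff of_real_divide) (simp add: mult_ac)
  finally have "(cmod (Gamma (1 + ?z)))\<^sup>2 = 2 * pi * \<beta> / (exp (pi * \<beta>) - exp (- (pi * \<beta>)))"
    by (simp only: of_real_eq_iff)
  also have "\<dots> = 2 * pi * x / (exp (pi * x) - exp (- (pi * x)))"
  proof (cases "x = \<beta>")
    case False
    then have [simp]: "x = - \<beta>" using assms by auto
    show ?thesis using minus_divide_divide[of "2 * pi * \<beta>" "exp (pi * \<beta>) - exp (- (pi * \<beta>))"] by simp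
  qed simp
  also have "\<dots> * exp (pi * x) = mellin_weight x"
  proof -
    have x: "x \<noteq> 0" using False assms by auto
    have "exp (pi * x) * (1 - exp (- (2 * pi * x))) = exp (pi * x) - exp (- (pi * x))"
      by (simp add: algebra_simps flip: exp_add)
    then have "2 * pi * x / (exp (pi * x) - exp (- (pi * x))) * exp (pi * x) = 2 * pi * x * exp (pi * x) / (exp (pi * x) * (1 - exp (- (2 * pi * x))))"
      by simp
    also have "\<dots> = mellin_weight x" using x by (simp add: mellin_weight_def)
    finally show ?thesis .
  qed
  finally show ?thesis .
qed

section \<open>The damped Mellin integral, its value and its limit\<close>

lemma integrable_power_exp:
  fixes \<epsilon> :: real
  assumes "\<epsilon> > 0"
  shows "set_integrable lborel {0<..} (\<lambda>s. s ^ k * exp (- (\<epsilon> * s)))"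
proof -
  have "integrable lborel (\<lambda>x. indicator {0..} x *\<^sub>R (x ^ k * exp (- x)) :: real)"
  proof (rule integrableI_nonneg)
    have "(\<integral>\<^sup>+x. ennreal (indicator {0..} x *\<^sub>R (x^k * exp (-x))) \<partial>lborel) = real_of_nat (fact k)"
      using nn_intergal_power_times_exp_Ici[of k]
      by (auto intro!: nn_integral_cong split: split_indicator elim!: trans[rotated])
    then show "(\<integral>\<^sup>+x. ennreal (indicator {0..} x *\<^sub>R (x^k * exp (-x))) \<partial>lborel) < \<infinity>" by simp
  qed (auto split: split_indicator)
  from lborel_integrable_real_affine[OF this, of \<epsilon> 0] assms
  have "integrable lborel (\<lambda>x. (1 / \<epsilon> ^ k) *\<^sub>R (indicator {0..} (\<epsilon> * x) *\<^sub>R ((\<epsilon> * x) ^ k * exp (- (\<epsilon> * x))) :: real))"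
    by (intro integrable_scaleR_right) simp
  also have "(\<lambda>x. (1 / \<epsilon> ^ k) *\<^sub>R (indicator {0..} (\<epsilon> * x) *\<^sub>R ((\<epsilon> * x) ^ k * exp (- (\<epsilon> * x))) :: real)) =
    (\<lambda>x. indicator {0..} x *\<^sub>R (x ^ k * exp (- (\<epsilon> * x))))"
    using assms by (auto simp: fun_eq_iff indicator_def power_mult_distrib zero_le_mult_iff)
  finally have "set_integrable lborel {0..} (\<lambda>s. s ^ k * exp (- (\<epsilon> * s)))"
    unfolding set_integrable_def .
  then show ?thesis by (rule set_integrable_subset) auto
qed

text \<open>\<open>cis (\<beta> * ln s)\<close> is \<open>s\<^sup>i\<^sup>\<beta>\<close>.\<close>

definition mellin_kernel :: "real \<Rightarrow> real \<Rightarrow> real \<Rightarrow> real \<Rightarrow> complex" where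
  "mellin_kernel \<epsilon> \<beta> \<xi> s = of_real (exp (- (\<epsilon> * s))) * cis (\<beta> * ln s - \<xi> * s)"

lemma mellin_kernel_measurable [measurable]: "mellin_kernel \<epsilon> \<beta> \<xi> \<in> borel_measurable borel"
  unfolding mellin_kernel_def cis_conv_exp by measurable

lemma norm_mellin_kernel [simp]: "cmod (mellin_kernel \<epsilon> \<beta> \<xi> s) = exp (- (\<epsilon> * s))"
  by (simp add: mellin_kernel_def norm_mult)

lemma set_integrable_mellin_kernel:
  assumes "\<epsilon> > 0"
  shows "set_integrable lborel {0<..} (\<lambda>s. of_real (s ^ k) * mellin_kernel \<epsilon> \<beta> \<xi> s)"
  by (rule set_integrable_bound[OF integrable_power_exp[OF assms, of k]])
     (auto simp: norm_mult norm_power set_borel_measurable_def intro!: borel_measurable_scaleR AE_I2)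

text \<open>The derivative of s times the kernel is integrated over the half-line. The extra factor
  s removes the boundary term at 0, where the kernel itself oscillates like s^(i\<beta>), and the
  damping removes the one at infinity.\<close>

lemma mellin_kernel_by_parts:
  assumes e: "\<epsilon> > 0"
  shows "(of_real \<epsilon> + \<i> * of_real \<xi>) * (LINT s:{0<..}|lborel. of_real s * mellin_kernel \<epsilon> \<beta> \<xi> s)
     = (1 + \<i> * of_real \<beta>) * (LINT s:{0<..}|lborel. mellin_kernel \<epsilon> \<beta> \<xi> s)"
proof -
  let ?E = "mellin_kernel \<epsilon> \<beta> \<xi>"
  let ?F = "\<lambda>s. of_real s * ?E s"
  let ?f = "\<lambda>s. (1 + \<i> * of_real \<beta>) * ?E s - (of_real \<epsilon> + \<i> * of_real \<xi>) * (of_real s * ?E s)"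
  have alt: "?E s = exp (of_real (- (\<epsilon> * s)) + \<i> * of_real (\<beta> * ln s - \<xi> * s))" for s
    unfolding mellin_kernel_def cis_conv_exp by (simp only: exp_add exp_of_real)
  have E': "(?E has_vector_derivative (of_real (- \<epsilon>) + \<i> * of_real (\<beta> / s - \<xi>)) * ?E s) (at s)" if "s > 0" for s
  proof -
    have "((\<lambda>s. of_real (- (\<epsilon> * s)) + \<i> * of_real (\<beta> * ln s - \<xi> * s)) has_vector_derivative (of_real (- \<epsilon>) + \<i> * of_real (\<beta> / s - \<xi>))) (at s)"
      using that by (auto intro!: derivative_eq_intros simp: divide_inverse)
    from field_vector_diff_chain_at[OF this DERIV_exp]
    show ?thesis unfolding alt[abs_def] o_def by (simp add: mult.commute)
  qed
  have F': "(?F has_vector_derivative ?f s) (at s)" if "s > 0" for s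
    using that by (auto intro!: derivative_eq_intros E' simp: algebra_simps scaleR_conv_of_real)
  have fi: "set_integrable lborel {0<..} ?f"
    using set_integrable_mellin_kernel[OF e, of 0 \<beta> \<xi>] set_integrable_mellin_kernel[OF e, of 1 \<beta> \<xi>]
    by (intro set_integral_diff set_integrable_mult_right) auto
  have "(LBINT s=0..\<infinity>. ?f s) = 0 - 0"
  proof (rule interval_integral_FTC_integrable[where F = ?F])
    have "((\<lambda>s. s * exp (- (\<epsilon> * s))) \<longlongrightarrow> 0) at_top" using e by real_asymp
    then have "(?F \<longlongrightarrow> 0) at_top"
      by (rule Lim_null_comparison[rotated]) (auto simp: norm_mult eventually_at_top_linorder intro!: exI[of _ 0])
    then show "((?F \<circ> real_of_ereal) \<longlongrightarrow> 0) (at_left \<infinity>)"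
      by (simp add: ereal_tendsto_simps1)
    have "((\<lambda>s. s * exp (- (\<epsilon> * s))) \<longlongrightarrow> 0) (at_right 0)" by real_asymp
    then have "(?F \<longlongrightarrow> 0) (at_right 0)"
      by (rule Lim_null_comparison[rotated]) (auto simp: norm_mult eventually_at_right_less eventually_at_filter intro!: always_eventually)
    then show "((?F \<circ> real_of_ereal) \<longlongrightarrow> 0) (at_right 0)"
      by (simp add: ereal_tendsto_simps1 zero_ereal_def)
    show "isCont ?f x" if "0 < ereal x" for x
      using that has_vector_derivative_continuous[OF E', of x] by (intro continuous_intros) auto
  qed (use F' fi in \<open>auto simp: zero_ereal_def einterval_def greaterThan_def\<close>)
  then have "(LINT s:{0<..}|lborel. ?f s) = 0"
    by (simp add: interval_lebesgue_integral_def zero_ereal_def einterval_def greaterThan_def)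
  then show ?thesis
    using set_integrable_mellin_kernel[OF e, of 0 \<beta> \<xi>] set_integrable_mellin_kernel[OF e, of 1 \<beta> \<xi>]
    by (subst (asm) set_integral_diff) (auto intro!: set_integrable_mult_right)
qed


lemma Re_gt_0_powr_nonzero: "\<epsilon> > 0 \<Longrightarrow> of_real \<epsilon> + \<i> * of_real \<xi> \<notin> \<real>\<^sub>\<le>\<^sub>0"
  by (auto simp: complex_nonpos_Reals_iff)

text \<open>A differential equation in \<xi> replaces contour rotation. Differentiation brings down
  -is, integration by parts returns the integral itself, and so \<zeta>^z times the integral is
  constant, where \<zeta> = \<epsilon> + i\<xi> and z = 1 + i\<beta>. The constant is computed at
  \<xi> = 0.\<close>

lemma mellin_kernel_integral:
  assumes e: "\<epsilon> > 0"
  shows "(LINT s:{0<..}|lborel. mellin_kernel \<epsilon> \<beta> \<xi> s)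
     = Gamma (1 + \<i> * of_real \<beta>) * (of_real \<epsilon> + \<i> * of_real \<xi>) powr (- (1 + \<i> * of_real \<beta>))"
proof -
  let ?z = "1 + \<i> * complex_of_real \<beta>"
  let ?\<zeta> = "\<lambda>\<xi>. complex_of_real \<epsilon> + \<i> * complex_of_real \<xi>"
  define y where "y \<xi> = (LINT s:{0<..}|lborel. mellin_kernel \<epsilon> \<beta> \<xi> s)" for \<xi>
  define y1 where "y1 \<xi> = (LINT s:{0<..}|lborel. of_real s * mellin_kernel \<epsilon> \<beta> \<xi> s)" for \<xi>
  have z0: "?\<zeta> \<xi> \<noteq> 0" for \<xi> using e by (auto simp: complex_eq_iff)
  have parts: "?\<zeta> \<xi> * y1 \<xi> = ?z * y \<xi>" for \<xi>
    unfolding y_def y1_def by (rule mellin_kernel_by_parts[OF e])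
  have y': "(y has_vector_derivative (- \<i> * y1 \<xi>)) (at \<xi>)" for \<xi>
  proof -
    have "((\<lambda>\<xi>. LINT s|lborel. indicator {0<..} s *\<^sub>R mellin_kernel \<epsilon> \<beta> \<xi> s) has_vector_derivative
       (LINT s|lborel. indicator {0<..} s *\<^sub>R (- \<i> * (of_real s * mellin_kernel \<epsilon> \<beta> \<xi> s)))) (at \<xi>)"
    proof (rule has_vector_derivative_integral_dominated[where a = "\<xi> - 1" and b = "\<xi> + 1"])
      show "integrable lborel (\<lambda>s. indicator {0<..} s *\<^sub>R mellin_kernel \<epsilon> \<beta> \<xi> s)" for \<xi>
        using set_integrable_mellin_kernel[OF e, of 0] by (simp add: set_integrable_def)
      show "integrable lborel (\<lambda>s. indicator {0<..} s *\<^sub>R (s ^ 1 * exp (- (\<epsilon> * s))))"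
        using integrable_power_exp[OF e, of 1] by (simp only: set_integrable_def)
      show "((\<lambda>\<xi>. indicator {0<..} s *\<^sub>R mellin_kernel \<epsilon> \<beta> \<xi> s) has_vector_derivative
          indicator {0<..} s *\<^sub>R (- \<i> * (of_real s * mellin_kernel \<epsilon> \<beta> \<xi> s))) (at \<xi>)" for \<xi> s
      proof -
        have "((\<lambda>\<xi>. \<i> * of_real (\<beta> * ln s - \<xi> * s)) has_vector_derivative (\<i> * of_real (- s))) (at \<xi>)"
          by (auto intro!: derivative_eq_intros)
        from field_vector_diff_chain_at[OF this DERIV_exp]
        have "((\<lambda>\<xi>. cis (\<beta> * ln s - \<xi> * s)) has_vector_derivative (- \<i> * of_real s * cis (\<beta> * ln s - \<xi> * s))) (at \<xi>)"
          by (simp add: o_def cis_conv_exp)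
        then have "((\<lambda>\<xi>. mellin_kernel \<epsilon> \<beta> \<xi> s) has_vector_derivative (of_real (exp (- (\<epsilon> * s))) * (- \<i> * of_real s * cis (\<beta> * ln s - \<xi> * s)))) (at \<xi>)"
          unfolding mellin_kernel_def by (rule has_vector_derivative_mult_right)
        then have "((\<lambda>\<xi>. mellin_kernel \<epsilon> \<beta> \<xi> s) has_vector_derivative (- \<i> * (of_real s * mellin_kernel \<epsilon> \<beta> \<xi> s))) (at \<xi>)"
          by (simp add: mellin_kernel_def mult_ac)
        then show ?thesis
            by (intro bounded_linear.has_vector_derivative[OF bounded_linear_scaleR_right])
      qed
    qed (auto simp: norm_mult split: split_indicator)
    then show ?thesis
      unfolding y_def y1_def set_lebesgue_integral_def
      by (simp add: scaleR_conv_of_real mult.left_commute[of _ \<i>])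
  qed
  have "((\<lambda>\<xi>. ?\<zeta> \<xi> powr ?z * y \<xi>) has_vector_derivative 0) (at \<xi>)" for \<xi>
  proof -
    have "(?\<zeta> has_vector_derivative \<i>) (at \<xi>)"
      by (auto intro!: derivative_eq_intros)
    moreover have "((\<lambda>w. w powr ?z) has_field_derivative ?z * ?\<zeta> \<xi> powr (?z - 1)) (at (?\<zeta> \<xi>))"
      using Re_gt_0_powr_nonzero[OF e] by (intro has_field_derivative_powr) auto
    ultimately have "((\<lambda>\<xi>. ?\<zeta> \<xi> powr ?z) has_vector_derivative \<i> * (?z * ?\<zeta> \<xi> powr (?z - 1))) (at \<xi>)"
      using field_vector_diff_chain_at by (fastforce simp: o_def)
    from has_vector_derivative_mult[OF this y'[of \<xi>]]
    have "((\<lambda>\<xi>. ?\<zeta> \<xi> powr ?z * y \<xi>) has_vector_derivative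
       (?\<zeta> \<xi> powr ?z * (- \<i> * y1 \<xi>) + \<i> * (?z * ?\<zeta> \<xi> powr (?z - 1)) * y \<xi>)) (at \<xi>)" .
    moreover have "?\<zeta> \<xi> powr ?z = ?\<zeta> \<xi> powr (?z - 1) * ?\<zeta> \<xi>"
      using z0[of \<xi>] by (simp only: powr_diff powr_to_1) simp
    then have "?\<zeta> \<xi> powr ?z * (- \<i> * y1 \<xi>) = - \<i> * ?\<zeta> \<xi> powr (?z - 1) * (?\<zeta> \<xi> * y1 \<xi>)" by simp
    then have "?\<zeta> \<xi> powr ?z * (- \<i> * y1 \<xi>) + \<i> * (?z * ?\<zeta> \<xi> powr (?z - 1)) * y \<xi> = 0"
      unfolding parts by simp
    ultimately show ?thesis by (simp only:)
  qed
  then obtain c where c: "\<And>\<xi>. ?\<zeta> \<xi> powr ?z * y \<xi> = c"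
    using has_vector_derivative_zero_constant[of UNIV "\<lambda>\<xi>. ?\<zeta> \<xi> powr ?z * y \<xi>"] by auto
  \<comment> \<open>Euler's integral is the case \<epsilon> = 1, \<xi> = 0; the substitution t =
    \<epsilon>s carries it to the given \<epsilon> and produces the factor \<epsilon>^z.\<close>
  have "Gamma ?z = integral {0<..} (\<lambda>t. of_real t powr (?z - 1) / of_real (exp t))"
    using Gamma_integral_complex'[of ?z] by (simp add: integral_unique)
  also have "\<dots> = integral {0<..} (mellin_kernel 1 \<beta> 0)"
    by (intro Henstock_Kurzweil_Integration.integral_cong)
       (auto simp: mellin_kernel_def powr_def cis_conv_exp Ln_of_real exp_minus divide_inverse mult_ac simp flip: exp_of_real)
  also have "\<dots> = (LINT t:{0<..}|lborel. mellin_kernel 1 \<beta> 0 t)"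
    using set_integrable_mellin_kernel[of 1 0 \<beta> 0] by (intro set_borel_integral_eq_integral(2)[symmetric]) simp
  also have "\<dots> = \<bar>\<epsilon>\<bar> *\<^sub>R (LINT s|lborel. indicator {0<..} (0 + \<epsilon> * s) *\<^sub>R mellin_kernel 1 \<beta> 0 (0 + \<epsilon> * s))"
    unfolding set_lebesgue_integral_def using e by (intro lborel_integral_real_affine) auto
  also have "(LINT s|lborel. indicator {0<..} (0 + \<epsilon> * s) *\<^sub>R mellin_kernel 1 \<beta> 0 (0 + \<epsilon> * s))
     = (LINT s|lborel. cis (\<beta> * ln \<epsilon>) * (indicator {0<..} s *\<^sub>R mellin_kernel \<epsilon> \<beta> 0 s))"
    using e by (intro Bochner_Integration.integral_cong refl)
      (auto simp: mellin_kernel_def indicator_def zero_less_mult_iff ln_mult cis_mult algebra_simps)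
  also have "\<dots> = cis (\<beta> * ln \<epsilon>) * y 0"
    unfolding y_def set_lebesgue_integral_def by (rule integral_mult_right_zero)
  also have "\<bar>\<epsilon>\<bar> *\<^sub>R (cis (\<beta> * ln \<epsilon>) * y 0) = ?\<zeta> 0 powr ?z * y 0"
    using e by (simp add: powr_def Ln_of_real algebra_simps exp_add cis_conv_exp scaleR_conv_of_real exp_of_real)
  also have "\<dots> = ?\<zeta> \<xi> powr ?z * y \<xi>" by (simp only: c)
  finally show ?thesis
    using z0[of \<xi>] unfolding y_def[symmetric] powr_minus by (simp add: field_simps)
qed

text \<open>The limit for \<epsilon> -> 0 of i\<xi> times the damped integral, with the factor
  i\<xi> absorbed into the power. Since \<open>0 powr w\<close> is 0, the symbol vanishes at \<xi> =
  0.\<close>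

definition mellin_symbol :: "real \<Rightarrow> real \<Rightarrow> complex" where
  "mellin_symbol \<beta> \<xi> = Gamma (1 + \<i> * of_real \<beta>) * (\<i> * of_real \<xi>) powr (- (\<i> * of_real \<beta>))"

text \<open>The principal argument of i\<xi> is pi/2 times sgn \<xi>, so the imaginary power has
  modulus e^(pi \<beta> sgn \<xi> / 2): it is large or small according to the sign of
  \<beta>\<xi>.\<close>

lemma norm_mellin_symbol:
  assumes "\<xi> \<noteq> 0"
  shows "(cmod (mellin_symbol \<beta> \<xi>))\<^sup>2 = mellin_weight (\<beta> * sgn \<xi>)"
proof -
  have "Im (Ln (\<i> * of_real \<xi>)) = sgn \<xi> * (pi / 2)"
  proof (cases "\<xi> > 0")
    case True
    then show ?thesis by (simp add: Ln_times_of_real mult.commute[of \<i>])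
  next
    case False
    then have "\<i> * of_real \<xi> = of_real (- \<xi>) * (- \<i>)" "- \<xi> > 0" using assms by auto
    have "Ln (\<i> * of_real \<xi>) = Ln (of_real (- \<xi>) * (- \<i>))"
      by (simp only: \<open>\<i> * of_real \<xi> = of_real (- \<xi>) * (- \<i>)\<close>)
    also have "\<dots> = of_real (ln (- \<xi>)) + Ln (- \<i>)"
      using Ln_times_of_real[OF \<open>- \<xi> > 0\<close>, of "- \<i>"] Ln_of_real[OF \<open>- \<xi> > 0\<close>]
      by (simp only: neg_equal_0_iff_equal complex_i_not_zero not_False_eq_True True_implies_equals)
    finally have "Ln (\<i> * of_real \<xi>) = of_real (ln (- \<xi>)) + Ln (- \<i>)" .
    then show ?thesis using False assms by simp
  qed
  then have "(cmod ((\<i> * of_real \<xi>) powr (- (\<i> * of_real \<beta>))))\<^sup>2 = (exp (\<beta> * (sgn \<xi> * (pi / 2))))\<^sup>2"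
    using assms by (simp add: powr_def)
  also have "\<dots> = exp (pi * (\<beta> * sgn \<xi>))" by (simp add: exp_double[symmetric] mult_ac)
  finally show ?thesis
    using norm_Gamma_one_plus_imaginary[of "\<beta> * sgn \<xi>" \<beta>] assms
    by (simp add: mellin_symbol_def norm_mult power_mult_distrib abs_mult abs_sgn_eq)
qed

text \<open>Uniform in \<epsilon>, as domination requires: |\<xi>| is at most |\<zeta>| for \<zeta>
  = \<epsilon> + i\<xi>, which cancels the singular factor, and the argument of \<zeta> stays within
  pi/2 because its real part is positive.\<close>

lemma mellin_integral_bound:
  assumes e: "\<epsilon> > 0"
  shows "(cmod (\<i> * of_real \<xi> * (LINT s:{0<..}|lborel. mellin_kernel \<epsilon> \<beta> \<xi> s)))\<^sup>2 \<le> 1 + 2 * pi * \<bar>\<beta>\<bar>"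
proof -
  let ?\<zeta> = "complex_of_real \<epsilon> + \<i> * complex_of_real \<xi>"
  have z0: "?\<zeta> \<noteq> 0" using e by (auto simp: complex_eq_iff)
  have "\<bar>Im (Ln ?\<zeta>)\<bar> \<le> pi / 2" using Re_Ln_pos_le[OF z0] e by simp
  then have "\<bar>\<beta>\<bar> * \<bar>Im (Ln ?\<zeta>)\<bar> \<le> \<bar>\<beta>\<bar> * (pi / 2)" by (intro mult_left_mono) auto
  then have b: "\<beta> * Im (Ln ?\<zeta>) \<le> \<bar>\<beta>\<bar> * pi / 2"
    using abs_ge_self[of "\<beta> * Im (Ln ?\<zeta>)"] by (simp add: abs_mult)
  have "cmod (?\<zeta> powr (- (1 + \<i> * of_real \<beta>))) = exp (- ln (cmod ?\<zeta>) + \<beta> * Im (Ln ?\<zeta>))"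
    using z0 by (simp add: powr_def Re_Ln algebra_simps)
  also have "\<dots> = exp (\<beta> * Im (Ln ?\<zeta>)) / cmod ?\<zeta>"
    using z0 by (simp add: exp_diff divide_inverse mult.commute)
  also have "\<dots> \<le> exp (\<bar>\<beta>\<bar> * pi / 2) / cmod ?\<zeta>"
    using b by (intro divide_right_mono) auto
  finally have "\<bar>\<xi>\<bar> * cmod (?\<zeta> powr (- (1 + \<i> * of_real \<beta>))) \<le> \<bar>\<xi>\<bar> * (exp (\<bar>\<beta>\<bar> * pi / 2) / cmod ?\<zeta>)"
    by (intro mult_left_mono) auto
  also have "\<dots> \<le> exp (\<bar>\<beta>\<bar> * pi / 2)"
    using abs_Im_le_cmod[of ?\<zeta>] z0 by (simp add: field_simps)
  finally have "cmod (\<i> * of_real \<xi> * (LINT s:{0<..}|lborel. mellin_kernel \<epsilon> \<beta> \<xi> s)) \<le> cmod (Gamma (1 + \<i> * of_real \<beta>)) * exp (\<bar>\<beta>\<bar> * pi / 2)"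
    unfolding mellin_kernel_integral[OF e] norm_mult
    by (simp add: mult.left_commute[of _ "cmod (Gamma _)"] mult_left_mono)
  then have "(cmod (\<i> * of_real \<xi> * (LINT s:{0<..}|lborel. mellin_kernel \<epsilon> \<beta> \<xi> s)))\<^sup>2 \<le> (cmod (Gamma (1 + \<i> * of_real \<beta>)) * exp (\<bar>\<beta>\<bar> * pi / 2))\<^sup>2"
    by (intro power_mono) auto
  also have "\<dots> = (cmod (Gamma (1 + \<i> * of_real \<beta>)))\<^sup>2 * exp (pi * \<bar>\<beta>\<bar>)"
    by (simp add: power_mult_distrib exp_double[symmetric] mult_ac)
  also have "\<dots> \<le> 1 + 2 * pi * \<bar>\<beta>\<bar>"
    using mellin_weight_le[of "\<bar>\<beta>\<bar>"] by (subst norm_Gamma_one_plus_imaginary) auto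
  finally show ?thesis .
qed

lemma mellin_integral_tendsto:
  assumes "\<xi> \<noteq> 0" and e: "\<And>j. \<epsilon> j > 0" "\<epsilon> \<longlonglongrightarrow> 0"
  shows "(\<lambda>j. \<i> * of_real \<xi> * (LINT s:{0<..}|lborel. mellin_kernel (\<epsilon> j) \<beta> \<xi> s)) \<longlonglongrightarrow> mellin_symbol \<beta> \<xi>"
proof -
  have n: "\<i> * of_real \<xi> \<notin> \<real>\<^sub>\<le>\<^sub>0" using assms(1) by (auto simp: complex_nonpos_Reals_iff)
  have "(\<lambda>j. \<i> * of_real \<xi> * (Gamma (1 + \<i> * of_real \<beta>) * (of_real (\<epsilon> j) + \<i> * of_real \<xi>) powr (- (1 + \<i> * of_real \<beta>))))
     \<longlonglongrightarrow> \<i> * of_real \<xi> * (Gamma (1 + \<i> * of_real \<beta>) * (of_real 0 + \<i> * of_real \<xi>) powr (- (1 + \<i> * of_real \<beta>)))"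
    using n by (intro tendsto_intros tendsto_powr_complex e(2)) auto
  also have "\<i> * of_real \<xi> * (Gamma (1 + \<i> * of_real \<beta>) * (of_real 0 + \<i> * of_real \<xi>) powr (- (1 + \<i> * of_real \<beta>))) = mellin_symbol \<beta> \<xi>"
  proof -
    have "- (1 + \<i> * complex_of_real \<beta>) = - (\<i> * complex_of_real \<beta>) - 1" by simp
    then have "(\<i> * of_real \<xi>) powr (- (1 + \<i> * of_real \<beta>)) = (\<i> * of_real \<xi>) powr (- (\<i> * of_real \<beta>)) / (\<i> * of_real \<xi>)"
      using assms(1) by (simp only: powr_diff powr_to_1)
    then show ?thesis using assms(1) by (simp add: mellin_symbol_def)
  qed
  finally show ?thesis using e(1) by (simp only: mellin_kernel_integral)
qed

text \<open>For nonzero \<xi> the base i\<xi> avoids the branch cut of the power, and 1 + i\<beta>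
  avoids the poles of Gamma.\<close>

lemma mellin_symbol_isCont:
  assumes "\<xi> \<noteq> 0" and f: "isCont f \<xi>"
  shows "isCont (\<lambda>\<xi>. mellin_symbol (f \<xi>) \<xi>) \<xi>"
proof -
  have n: "\<i> * of_real \<xi> \<notin> \<real>\<^sub>\<le>\<^sub>0" using assms(1) by (auto simp: complex_nonpos_Reals_iff)
  have g: "1 + \<i> * of_real b \<notin> \<int>\<^sub>\<le>\<^sub>0" for b by (auto elim!: nonpos_Ints_cases simp: complex_eq_iff)
  show ?thesis unfolding mellin_symbol_def
    using n g f unfolding isCont_def by (intro tendsto_intros tendsto_powr_complex) auto
qed

section \<open>Derivatives of the field on the horizon\<close>

lemma frechet_derivative_cong_open:
  assumes "open U" "x \<in> U" "\<And>y. y \<in> U \<Longrightarrow> f y = g y"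
  shows "frechet_derivative f (at x) = frechet_derivative g (at x)"
proof -
  have "(f has_derivative D) (at x) \<longleftrightarrow> (g has_derivative D) (at x)" for D
  proof
    assume "(f has_derivative D) (at x)"
    then show "(g has_derivative D) (at x)"
      by (rule has_derivative_transform_within_open[OF _ assms(1,2)]) (rule assms(3))
  next
    assume "(g has_derivative D) (at x)"
    then show "(f has_derivative D) (at x)"
      by (rule has_derivative_transform_within_open[OF _ assms(1,2)]) (rule assms(3)[symmetric])
  qed
  then show ?thesis by (simp add: frechet_derivative_def)
qed

lemma Ck_cong:
  assumes U: "open U" and "Ck k U f" and "\<And>y. y \<in> U \<Longrightarrow> f y = g y"
  shows "Ck k U g"
  using assms(2,3)
proof (induction k arbitrary: f g)
  case 0
  then show ?case using continuous_on_cong[of U U f g] by simp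
next
  case (Suc k)
  have "g differentiable_on U"
    unfolding differentiable_on_def
  proof
    fix x assume x: "x \<in> U"
    have "f differentiable at x within U" using Suc.prems(1) x by (simp add: differentiable_on_def)
    then show "g differentiable at x within U"
      by (rule differentiable_transform_within[OF _ zero_less_one x]) (rule Suc.prems(2))
  qed
  moreover have "Ck k U (\<lambda>x. frechet_derivative g (at x) e)" for e
  proof (rule Suc.IH[of "\<lambda>x. frechet_derivative f (at x) e"])
    show "Ck k U (\<lambda>x. frechet_derivative f (at x) e)" using Suc.prems by simp
    show "frechet_derivative f (at y) e = frechet_derivative g (at y) e" if "y \<in> U" for y
      by (rule fun_cong[OF frechet_derivative_cong_open[OF U that Suc.prems(2)]])
  qed
  ultimately show ?case by simp
qed

lemma Ck_Suc_imp: "Ck (Suc k) U f \<Longrightarrow> Ck k U f"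
proof (induction k arbitrary: f)
  case 0
  then show ?case by (simp add: differentiable_imp_continuous_on)
next
  case (Suc k)
  then show ?case unfolding Ck.simps(2)[of "Suc k"] Ck.simps(2)[of k U f] by blast
qed

lemma differentiable_on_open_at:
  assumes "open U" "f differentiable_on U" "x \<in> U"
  shows "(f has_derivative frechet_derivative f (at x)) (at x)"
  using assms differentiable_on_eq_differentiable_at[OF assms(1)] frechet_derivative_works by blast

lemma Ck_bounded_linear:
  assumes "open U" "bounded_linear L"
  shows "Ck k U f \<Longrightarrow> Ck k U (\<lambda>x. L (f x))"
proof (induction k arbitrary: f)
  case 0
  then show ?case by (auto intro: bounded_linear.continuous_on[OF assms(2)])
next
  case (Suc k)
  have d: "((\<lambda>x. L (f x)) has_derivative (\<lambda>e. L (frechet_derivative f (at x) e))) (at x)" if "x \<in> U" for x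
    using bounded_linear.has_derivative[OF assms(2) differentiable_on_open_at[OF assms(1) _ that]] Suc.prems by auto
  have "Ck k U (\<lambda>x. frechet_derivative (\<lambda>x. L (f x)) (at x) e)" for e
  proof (rule Ck_cong[OF assms(1) Suc.IH])
    show "Ck k U (\<lambda>x. frechet_derivative f (at x) e)" using Suc.prems by simp
    show "L (frechet_derivative f (at y) e) = frechet_derivative (\<lambda>x. L (f x)) (at y) e" if "y \<in> U" for y
      using fun_cong[OF frechet_derivative_at[OF d[OF that]], of e] by simp
  qed
  then show ?case using d assms(1) by (auto simp: differentiable_on_eq_differentiable_at differentiable_def)
qed

lemma Ck_add:
  assumes "open U"
  shows "Ck k U f \<Longrightarrow> Ck k U g \<Longrightarrow> Ck k U (\<lambda>x. f x + g x)"
proof (induction k arbitrary: f g)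
  case 0
  then show ?case by (auto intro: continuous_on_add)
next
  case (Suc k)
  have d: "((\<lambda>x. f x + g x) has_derivative (\<lambda>e. frechet_derivative f (at x) e + frechet_derivative g (at x) e)) (at x)" if "x \<in> U" for x
    by (intro has_derivative_add differentiable_on_open_at[OF assms(1) _ that]) (use Suc.prems in auto)
  have "Ck k U (\<lambda>x. frechet_derivative (\<lambda>x. f x + g x) (at x) e)" for e
  proof (rule Ck_cong[OF assms(1) Suc.IH])
    show "Ck k U (\<lambda>x. frechet_derivative f (at x) e)" "Ck k U (\<lambda>x. frechet_derivative g (at x) e)" using Suc.prems by simp_all
    show "frechet_derivative f (at y) e + frechet_derivative g (at y) e = frechet_derivative (\<lambda>x. f x + g x) (at y) e" if "y \<in> U" for y
      using fun_cong[OF frechet_derivative_at[OF d[OF that]], of e] by simp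
  qed
  then show ?case using d assms(1) by (auto simp: differentiable_on_eq_differentiable_at differentiable_def)
qed

text \<open>Serves the rotation field about the axis, whose coefficients are linear functions on the
  ambient space.\<close>

lemma Ck_linear_scaleR:
  assumes "open U" "bounded_linear c"
  shows "Ck k U f \<Longrightarrow> Ck k U (\<lambda>x. c x *\<^sub>R f x)"
proof (induction k arbitrary: f)
  case 0
  then show ?case by (auto intro!: continuous_on_scaleR linear_continuous_on[OF assms(2)])
next
  case (Suc k)
  have d: "((\<lambda>x. c x *\<^sub>R f x) has_derivative (\<lambda>e. c x *\<^sub>R frechet_derivative f (at x) e + c e *\<^sub>R f x)) (at x)" if "x \<in> U" for x
    using has_derivative_scaleR[OF bounded_linear_imp_has_derivative[OF assms(2)] differentiable_on_open_at[OF assms(1) _ that]] Suc.prems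
    by auto
  have "Ck k U (\<lambda>x. frechet_derivative (\<lambda>x. c x *\<^sub>R f x) (at x) e)" for e
  proof (rule Ck_cong[OF assms(1) Ck_add[OF assms(1)]])
    show "Ck k U (\<lambda>x. c x *\<^sub>R frechet_derivative f (at x) e)" using Suc.prems by (intro Suc.IH) simp
    show "Ck k U (\<lambda>x. c e *\<^sub>R f x)"
      using Ck_Suc_imp[OF Suc.prems] by (intro Ck_bounded_linear[OF assms(1) bounded_linear_scaleR_right])
    show "c y *\<^sub>R frechet_derivative f (at y) e + c e *\<^sub>R f y = frechet_derivative (\<lambda>x. c x *\<^sub>R f x) (at y) e" if "y \<in> U" for y
      using fun_cong[OF frechet_derivative_at[OF d[OF that]], of e] by simp
  qed
  then show ?case using d assms(1) by (auto simp: differentiable_on_eq_differentiable_at differentiable_def)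
qed

text \<open>Iterated \<open>\<partial>\<^sub>v\<close> (\<open>True\<close>) and \<open>\<partial>\<^sub>\<phi>\<close> (\<open>False\<close>) derivatives, indexed by words: this way the
  symmetry of mixed derivatives is not needed.\<close>

definition field_tower :: "real \<Rightarrow> (bool list \<Rightarrow> field) \<Rightarrow> bool" where
  "field_tower V P \<longleftrightarrow> 0 < V \<and> (\<forall>w.
     continuous_on UNIV (P w) \<and>
     (\<exists>B. \<forall>z. cmod (P w z) \<le> B) \<and>
     (\<forall>x \<theta> \<phi>. V < \<bar>x\<bar> \<longrightarrow> P w (x, \<theta>, \<phi>) = 0) \<and>
     (\<forall>x \<theta> \<phi>. ((\<lambda>s. P w (s, \<theta>, \<phi>)) has_vector_derivative P (True # w) (x, \<theta>, \<phi>)) (at x)) \<and>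
     (\<forall>x \<theta> \<phi>. ((\<lambda>s. P w (x, \<theta>, s)) has_vector_derivative P (False # w) (x, \<theta>, \<phi>)) (at \<phi>)) \<and>
     (\<forall>x \<theta> \<phi>. P w (x, \<theta>, \<phi> + 2 * pi) = P w (x, \<theta>, \<phi>)))"

section \<open>The tower of tangential derivatives on the horizon\<close>

lemma sph_alt: "sph \<theta> \<phi> = (sin \<theta> * cos \<phi>) *\<^sub>R axis 1 1 + (sin \<theta> * sin \<phi>) *\<^sub>R axis 2 1 + cos \<theta> *\<^sub>R axis 3 1"
  by (simp add: sph_def vec_eq_iff forall_3 axis_def)

lemma sph_in_sphere: "sph \<theta> \<phi> \<in> sphere 0 1"
proof -
  have "sph \<theta> \<phi> \<bullet> sph \<theta> \<phi> = sin \<theta> * cos \<phi> * (sin \<theta> * cos \<phi>) + sin \<theta> * sin \<phi> * (sin \<theta> * sin \<phi>) + cos \<theta> * cos \<theta>"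
    by (simp add: inner_vec_def sum_3 sph_def)
  also have "\<dots> = 1"
    using sin_cos_squared_add[of \<theta>] sin_cos_squared_add[of \<phi>] by algebra
  finally show ?thesis by (simp add: norm_eq_sqrt_inner)
qed

lemma continuous_on_sph [continuous_intros]:
  fixes f g :: "'a::t2_space \<Rightarrow> real"
  shows "continuous_on A f \<Longrightarrow> continuous_on A g \<Longrightarrow> continuous_on A (\<lambda>x. sph (f x) (g x))"
  unfolding sph_alt by (intro continuous_intros)

text \<open>\<open>False\<close> is the rotation field x1 d/dx2 - x2 d/dx1 of the ambient space: it
  restricts to the azimuthal derivative on the sphere and is smooth at the poles. The newest
  derivative stands at the head of the word.\<close>

fun tower_ext :: "(real \<times> real \<times> (real ^ 3) \<Rightarrow> complex) \<Rightarrow> bool list \<Rightarrow> real \<times> real \<times> (real ^ 3) \<Rightarrow> complex" where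
  "tower_ext F [] = F"
| "tower_ext F (True # w) = (\<lambda>x. frechet_derivative (tower_ext F w) (at x) (1, 0, 0))"
| "tower_ext F (False # w) = (\<lambda>x.
     (snd (snd x) $ 1) *\<^sub>R frechet_derivative (tower_ext F w) (at x) (0, 0, axis 2 1) +
     (snd (snd x) $ 2) *\<^sub>R - frechet_derivative (tower_ext F w) (at x) (0, 0, axis 1 1))"

text \<open>All orders \<open>k\<close> are carried through the induction together, since each
  letter costs one derivative.\<close>

lemma Ck_tower_ext:
  assumes "open U" "\<And>k. Ck k U F"
  shows "Ck k U (tower_ext F w)"
proof (induction w arbitrary: k)
  case Nil
  then show ?case using assms by simp
next
  case (Cons d w)
  have e: "Ck k U (\<lambda>x. frechet_derivative (tower_ext F w) (at x) e)" for e k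
    using Cons[of "Suc k"] unfolding Ck.simps by blast
  have b: "bounded_linear (\<lambda>x :: real \<times> real \<times> (real ^ 3). snd (snd x) $ i)" for i
    by (intro bounded_linear_compose[OF bounded_linear_vec_nth] bounded_linear_compose[OF bounded_linear_snd] bounded_linear_snd)
  show ?case
  proof (cases d)
    case True
    then show ?thesis using e by simp
  next
    case False
    then show ?thesis
      using e by (simp del: scaleR_minus_right add_uminus_conv_diff) (intro Ck_add[OF assms(1)] Ck_linear_scaleR[OF assms(1) b] Ck_bounded_linear[OF assms(1) bounded_linear_minus[OF bounded_linear_ident]] e)
  qed
qed

text \<open>Acceptability bounds r and v + h(r) on the support. As \<open>h\<close> is continuous up
  to the horizon, it is bounded on the resulting compact range of r, and this bounds v. Here
  \<open>rm\<close> is a radius beyond the support, not the inner horizon.\<close>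

lemma acceptable_support:
  assumes t: "kerr_time m a rstar h" and acc: "acceptable m a h psi"
  obtains V rm where "V > 0" "rm > rplus m a"
    "\<And>v r \<omega>. r \<ge> rplus m a \<Longrightarrow> \<omega> \<in> sphere 0 1 \<Longrightarrow> psi (v, r, \<omega>) \<noteq> 0 \<Longrightarrow> \<bar>v\<bar> \<le> V \<and> r \<le> rm"
proof -
  obtain K where K: "compact K" "\<And>v r \<omega>. (v, r, \<omega>) \<in> exterior m a \<Longrightarrow> psi (v, r, \<omega>) \<noteq> 0 \<Longrightarrow> (v + h r, r) \<in> K"
    using conjunct2[OF acc[unfolded acceptable_def]] by blast
  obtain b where b: "\<And>z. z \<in> K \<Longrightarrow> norm z \<le> b" using compact_imp_bounded[OF K(1)] unfolding bounded_iff by blast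
  obtain U H where U': "open U" "{rplus m a..} \<subseteq> U" "\<forall>k. Ck k U H" "\<forall>r\<in>{rplus m a..}. H r = h r"
    using conjunct1[OF t[unfolded kerr_time_def]] unfolding smooth_upto_def by (elim exE conjE)
  note U = U'(1,2) U'(3,4)[rule_format]
  have "continuous_on U H" using U(3)[of 0] by simp
  then have "continuous_on {rplus m a..} H" using U(2) continuous_on_subset by blast
  then have hc: "continuous_on {rplus m a..} h" by (rule continuous_on_eq) (rule U(4))
  define rm where "rm = max b (rplus m a) + 1"
  have "compact (h ` {rplus m a..rm})"
    by (intro compact_continuous_image continuous_on_subset[OF hc]) auto
  then have "bounded (h ` {rplus m a..rm})" by (rule compact_imp_bounded)
  then obtain c where c: "\<forall>r \<in> {rplus m a..rm}. \<bar>h r\<bar> \<le> c"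
    unfolding bounded_iff by auto
  show thesis
  proof (rule that[of "max 1 (b + c)" rm])
    fix v r and \<omega> :: "real ^ 3"
    assume r: "r \<ge> rplus m a" and w: "\<omega> \<in> sphere 0 1" and n: "psi (v, r, \<omega>) \<noteq> 0"
    have "(v + h r, r) \<in> K" using K(2)[OF _ n] r w by (simp add: exterior_def)
    then have "norm (v + h r, r) \<le> b" by (rule b)
    then have *: "\<bar>v + h r\<bar> \<le> b" "\<bar>r\<bar> \<le> b"
      using norm_fst_le[of "v + h r" r] norm_snd_le[of r "v + h r"] by auto
    then have "r \<le> rm" unfolding rm_def by linarith
    moreover have "\<bar>h r\<bar> \<le> c" using r \<open>r \<le> rm\<close> c by auto
    ultimately show "\<bar>v\<bar> \<le> max 1 (b + c) \<and> r \<le> rm" using * by linarith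
  qed (auto simp: rm_def)
qed

text \<open>The derivatives are those of a smooth extension, evaluated along the horizon.
  Translation in v and rotation are tangent to the horizon, so differentiating the restriction gives
  the restricted derivatives.\<close>

lemma horizon_field_tower:
  assumes t: "kerr_time m a rstar h" and acc: "acceptable m a h psi"
  obtains V P where "field_tower V P" "P [] = horizon_field m a psi"
proof -
  obtain V rm where V: "V > 0" "\<And>v r \<omega>. r \<ge> rplus m a \<Longrightarrow> \<omega> \<in> sphere 0 1 \<Longrightarrow> psi (v, r, \<omega>) \<noteq> 0 \<Longrightarrow> \<bar>v\<bar> \<le> V \<and> r \<le> rm"
    using acceptable_support[OF t acc] by metis
  obtain U F where U': "open U" "exterior m a \<subseteq> U" "\<forall>k. Ck k U F" "\<forall>x\<in>exterior m a. F x = psi x"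
    using conjunct1[OF acc[unfolded acceptable_def]] unfolding smooth_upto_def by (elim exE conjE)
  note U = U'(1,2) U'(3,4)[rule_format]
  define G where "G = tower_ext F"
  have GC: "Ck k U (G w)" for k w unfolding G_def by (rule Ck_tower_ext[OF U(1,3)])
  define p where "p x \<theta> \<phi> = (x, rplus m a, sph \<theta> \<phi>)" for x \<theta> \<phi> :: real
  have pU: "p x \<theta> \<phi> \<in> U" for x \<theta> \<phi>
    using sph_in_sphere[of \<theta> \<phi>] by (intro subsetD[OF U(2)]) (simp add: p_def exterior_def)
  define P where "P w = (\<lambda>(x, \<theta>, \<phi>). G w (p x \<theta> \<phi>))" for w
  have P0: "P [] = horizon_field m a psi"
  proof (rule ext, clarify)
    fix x \<theta> \<phi>
    have "p x \<theta> \<phi> \<in> exterior m a" using sph_in_sphere[of \<theta> \<phi>] by (simp add: p_def exterior_def)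
    then show "P [] (x, \<theta>, \<phi>) = horizon_field m a psi (x, \<theta>, \<phi>)"
      using U(4) by (simp add: P_def G_def p_def horizon_field_def)
  qed
  have cont: "continuous_on UNIV (P w)" for w
    unfolding P_def case_prod_beta
    by (rule continuous_on_compose2[of U "G w"])
       (use GC[of 0 w] pU in \<open>auto simp: p_def intro!: continuous_intros\<close>)
  have dG: "(G w has_derivative frechet_derivative (G w) (at (p x \<theta> \<phi>))) (at (p x \<theta> \<phi>))" for w x \<theta> \<phi>
    using GC[of "Suc 0" w] by (intro differentiable_on_open_at[OF U(1) _ pU]) simp
  have dv: "((\<lambda>s. P w (s, \<theta>, \<phi>)) has_vector_derivative P (True # w) (x, \<theta>, \<phi>)) (at x)" for w x \<theta> \<phi>
  proof -
    have "((\<lambda>s. p s \<theta> \<phi>) has_vector_derivative (1, 0, 0)) (at x)"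
      unfolding p_def by (auto intro!: derivative_eq_intros has_vector_derivative_Pair simp: zero_prod_def)
    from vector_derivative_diff_chain_within[OF this has_derivative_at_withinI[OF dG[of w x \<theta> \<phi>]]]
    show ?thesis by (simp add: P_def o_def G_def has_derivative_at_withinI)
  qed
  have dph: "((\<lambda>s. P w (x, \<theta>, s)) has_vector_derivative P (False # w) (x, \<theta>, \<phi>)) (at \<phi>)" for w x \<theta> \<phi>
  proof -
    let ?D = "frechet_derivative (G w) (at (p x \<theta> \<phi>))"
    have lin: "linear ?D" using dG by (rule has_derivative_linear)
    have "(sph \<theta> has_vector_derivative (sin \<theta> * cos \<phi>) *\<^sub>R axis 2 1 - (sin \<theta> * sin \<phi>) *\<^sub>R axis 1 1) (at \<phi>)"
      unfolding sph_alt[abs_def] by (auto intro!: derivative_eq_intros simp: mult.commute)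
    then have "((\<lambda>s. p x \<theta> s) has_vector_derivative (0, 0, (sin \<theta> * cos \<phi>) *\<^sub>R axis 2 1 - (sin \<theta> * sin \<phi>) *\<^sub>R axis 1 1)) (at \<phi>)"
      unfolding p_def by (intro has_vector_derivative_Pair has_vector_derivative_const)
    from vector_derivative_diff_chain_within[OF this has_derivative_at_withinI[OF dG[of w x \<theta> \<phi>]]]
    have "((\<lambda>s. P w (x, \<theta>, s)) has_vector_derivative ?D (0, 0, (sin \<theta> * cos \<phi>) *\<^sub>R axis 2 1 - (sin \<theta> * sin \<phi>) *\<^sub>R axis 1 1)) (at \<phi>)"
      by (simp add: P_def o_def has_derivative_at_withinI)
    also have "(0, 0, (sin \<theta> * cos \<phi>) *\<^sub>R axis 2 1 - (sin \<theta> * sin \<phi>) *\<^sub>R axis 1 1) =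
       (sin \<theta> * cos \<phi>) *\<^sub>R (0::real, 0::real, axis 2 1 :: real ^ 3) + (sin \<theta> * sin \<phi>) *\<^sub>R - (0, 0, axis 1 1)"
      by simp
    also have "?D \<dots> = P (False # w) (x, \<theta>, \<phi>)"
      unfolding linear_add[OF lin] linear_cmul[OF lin] linear_neg[OF lin]
      by (simp add: P_def G_def p_def sph_def)
    finally show ?thesis .
  qed
  \<comment> \<open>Vanishing passes to both derivatives: the set |x| > V is open in the time
    variable, and in the azimuth the whole line vanishes.\<close>
  have supp: "P w (x, \<theta>, \<phi>) = 0" if "V < \<bar>x\<bar>" for w x \<theta> \<phi>
    using that
  proof (induction w arbitrary: x \<phi>)
    case Nil
    then show ?case using V(2)[of "rplus m a" "sph \<theta> \<phi>" x] sph_in_sphere[of \<theta> \<phi>] by (auto simp: P0 horizon_field_def)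
  next
    case (Cons d w)
    show ?case
    proof (cases d)
      case True
      have "open {s. V < \<bar>s\<bar>}" by (intro open_Collect_less continuous_intros)
      then have "((\<lambda>s. P w (s, \<theta>, \<phi>)) has_vector_derivative 0) (at x)"
        using Cons by (intro has_vector_derivative_transform_within_open[OF has_vector_derivative_const[of 0]]) auto
      then show ?thesis using vector_derivative_unique_at[OF dv] True by metis
    next
      case False
      have "((\<lambda>s. P w (x, \<theta>, s)) has_vector_derivative 0) (at \<phi>)"
        using Cons by simp
      then show ?thesis using vector_derivative_unique_at[OF dph] False by metis
    qed
  qed
  have bdd: "\<exists>B. \<forall>z. cmod (P w z) \<le> B" for w
  proof -
    let ?K = "{-V..V} \<times> {rplus m a} \<times> sphere (0::real^3) 1"
    have "?K \<subseteq> U" using U(2) by (auto simp: exterior_def)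
    then have "continuous_on ?K (G w)" using GC[of 0 w] continuous_on_subset by auto
    then have "compact (G w ` ?K)" by (intro compact_continuous_image compact_Times) auto
    then have "bounded (G w ` ?K)" by (rule compact_imp_bounded)
    then obtain B where B: "\<And>z. z \<in> ?K \<Longrightarrow> cmod (G w z) \<le> B"
      unfolding bounded_iff by blast
    have "cmod (P w (x, \<theta>, \<phi>)) \<le> max B 0" for x \<theta> \<phi>
    proof (cases "V < \<bar>x\<bar>")
      case True
      then show ?thesis by (simp add: supp)
    next
      case False
      then have "p x \<theta> \<phi> \<in> ?K" using sph_in_sphere[of \<theta> \<phi>] by (auto simp: p_def)
      then have "cmod (G w (p x \<theta> \<phi>)) \<le> B" by (rule B)
      then show ?thesis by (simp add: P_def)
    qed
    then show ?thesis by (intro exI[of _ "max B 0"]) auto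
  qed
  have per: "P w (x, \<theta>, \<phi> + 2 * pi) = P w (x, \<theta>, \<phi>)" for w x \<theta> \<phi>
    by (simp add: P_def p_def sph_def)
  have "field_tower V P"
    unfolding field_tower_def using V(1) cont bdd supp dv dph per by blast
  then show thesis using P0 that by blast
qed

section \<open>Transforms of compactly supported functions\<close>

lemma has_vector_derivative_cis_linear:
  "((\<lambda>t. cis (c * t)) has_vector_derivative \<i> * of_real c * cis (c * x)) (at x)"
proof -
  have "((\<lambda>t. \<i> * of_real (c * t)) has_vector_derivative \<i> * of_real c) (at x)"
    by (auto intro!: derivative_eq_intros)
  from field_vector_diff_chain_at[OF this DERIV_exp]
  show ?thesis by (simp add: cis_conv_exp o_def)
qed

lemma set_integral_FTC:
  fixes F :: "real \<Rightarrow> complex"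
  assumes "a \<le> b" "\<And>x. (F has_vector_derivative f x) (at x)" "continuous_on UNIV f"
  shows "(LINT x:{a..b}|lborel. f x) = F b - F a"
proof -
  have "(LBINT x=ereal a..ereal b. f x) = F b - F a"
    by (rule interval_integral_FTC_finite)
       (use assms in \<open>auto intro: continuous_on_subset has_vector_derivative_at_within\<close>)
  then show ?thesis using assms(1) by (simp add: interval_integral_Icc)
qed

lemma set_integrable_continuous:
  fixes f :: "real \<Rightarrow> complex"
  assumes "continuous_on UNIV f"
  shows "set_integrable lborel {a..b} f"
  using assms by (intro borel_integrable_atLeastAtMost') (auto intro: continuous_on_subset)

lemma ft_eq_set_integral:
  assumes "\<And>t. V < \<bar>t\<bar> \<Longrightarrow> A t = 0" "V \<le> L"
  shows "ft A x = (LINT t:{-L..L}|lborel. cis (x * t) * A t)"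
proof -
  have "indicator {-L..L} t *\<^sub>R (cis (x * t) * A t) = cis (x * t) * A t" for t
    using assms(1)[of t] assms(2) by (cases "t \<in> {-L..L}") auto
  then show ?thesis by (simp add: ft_def set_lebesgue_integral_def)
qed

lemma ft_derivative:
  assumes d: "\<And>t. (A has_vector_derivative A' t) (at t)" and c: "continuous_on UNIV A'"
    and s: "\<And>t. V < \<bar>t\<bar> \<Longrightarrow> A t = 0" "\<And>t. V < \<bar>t\<bar> \<Longrightarrow> A' t = 0" and "0 \<le> V"
  shows "ft A' x = - (\<i> * of_real x * ft A x)"
proof -
  \<comment> \<open>Strictly larger than V: vanishing is assumed for |t| > V only, and the boundary
    terms sit at L and -L.\<close>
  define L where "L = V + 1"
  have L: "V \<le> L" "0 \<le> L" "- L \<le> L" using \<open>0 \<le> V\<close> by (auto simp: L_def)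
  have Ac: "continuous_on UNIV A"
    by (rule continuous_at_imp_continuous_on) (use has_vector_derivative_continuous[OF d] in blast)
  have cisc: "continuous_on UNIV (\<lambda>t. cis (x * t))" by (intro continuous_intros)
  have "(LINT t:{-L..L}|lborel. cis (x * t) * A' t + \<i> * of_real x * cis (x * t) * A t) = cis (x * L) * A L - cis (x * - L) * A (- L)"
    by (rule set_integral_FTC[OF L(3)])
       (auto intro!: has_vector_derivative_mult[OF has_vector_derivative_cis_linear d] continuous_intros c Ac)
  also have "\<dots> = 0" using s(1)[of L] s(1)[of "-L"] \<open>0 \<le> V\<close> by (simp add: L_def)
  finally have "(LINT t:{-L..L}|lborel. cis (x * t) * A' t) + (LINT t:{-L..L}|lborel. \<i> * of_real x * (cis (x * t) * A t)) = 0"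
    by (subst (asm) set_integral_add) (auto intro!: set_integrable_continuous continuous_intros c Ac simp: mult.assoc)
  then show ?thesis
    using ft_eq_set_integral[OF s(1) L(1), where x = x] ft_eq_set_integral[OF s(2) L(1), where x = x]
    by (simp add: add_eq_0_iff2)
qed

section \<open>Azimuthal modes of the horizon field and the decay of their transforms\<close>

locale tower =
  fixes V :: real and P :: "bool list \<Rightarrow> field"
  assumes tower: "field_tower V P"
begin

lemma V_pos: "0 < V" using tower by (simp add: field_tower_def)

lemma P_cont: "continuous_on UNIV (P w)" using tower by (simp add: field_tower_def)

lemma P_measurable [measurable]: "P w \<in> borel_measurable borel"
  by (rule borel_measurable_continuous_onI[OF P_cont])

lemma P_measurable' [measurable]: "P w \<in> borel_measurable (borel \<Otimes>\<^sub>M (borel \<Otimes>\<^sub>M borel))"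
  using P_measurable by (simp add: borel_prod)

lemma P_comp_cont:
  assumes "continuous_on A f" "continuous_on A g" "continuous_on A h"
  shows "continuous_on A (\<lambda>x. P w (f x, g x, h x))"
  by (rule continuous_on_compose2[OF P_cont]) (auto intro!: continuous_intros assms)

definition bd :: "bool list \<Rightarrow> real" where "bd w = (SOME B. \<forall>z. cmod (P w z) \<le> B)"

lemma P_bound: "cmod (P w z) \<le> bd w"
proof -
  have "\<exists>B. \<forall>z. cmod (P w z) \<le> B" using tower by (simp add: field_tower_def)
  then show ?thesis unfolding bd_def by (rule someI2_ex) blast
qed

lemma bd_nonneg: "0 \<le> bd w" using order_trans[OF norm_ge_zero P_bound] .

lemma P_support: "V < \<bar>x\<bar> \<Longrightarrow> P w (x, \<theta>, \<phi>) = 0" using tower by (simp add: field_tower_def)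

lemma P_deriv_v: "((\<lambda>s. P w (s, \<theta>, \<phi>)) has_vector_derivative P (True # w) (x, \<theta>, \<phi>)) (at x)"
  using tower by (simp add: field_tower_def)

lemma P_deriv_phi: "((\<lambda>s. P w (x, \<theta>, s)) has_vector_derivative P (False # w) (x, \<theta>, \<phi>)) (at \<phi>)"
  using tower by (simp add: field_tower_def)

lemma P_periodic: "P w (x, \<theta>, \<phi> + 2 * pi) = P w (x, \<theta>, \<phi>)" using tower by (simp add: field_tower_def)

abbreviation A :: "bool list \<Rightarrow> int \<Rightarrow> real \<Rightarrow> real \<Rightarrow> complex" where
  "A w n \<theta> \<equiv> az_mode n (P w) \<theta>"

lemma integrable_mode:
  "integrable lborel (\<lambda>\<phi>. indicator {0..2 * pi} \<phi> *\<^sub>R (cis (- (of_int n * \<phi>)) * P w (x, \<theta>, \<phi>)))"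
proof -
  have "set_integrable lborel {0..2 * pi} (\<lambda>\<phi>. cis (- (of_int n * \<phi>)) * P w (x, \<theta>, \<phi>))"
    by (intro set_integrable_continuous continuous_intros P_comp_cont)
  then show ?thesis by (simp add: set_integrable_def)
qed

lemma A_deriv: "(A w n \<theta> has_vector_derivative A (True # w) n \<theta> x) (at x)"
proof -
  have "((\<lambda>x. LINT \<phi>|lborel. indicator {0..2 * pi} \<phi> *\<^sub>R (cis (- (of_int n * \<phi>)) * P w (x, \<theta>, \<phi>))) has_vector_derivative
     (LINT \<phi>|lborel. indicator {0..2 * pi} \<phi> *\<^sub>R (cis (- (of_int n * \<phi>)) * P (True # w) (x, \<theta>, \<phi>)))) (at x)"
  proof (rule has_vector_derivative_integral_dominated[where a = "x - 1" and b = "x + 1"])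
    show "integrable lborel (\<lambda>\<phi>. indicator {0..2 * pi} \<phi> *\<^sub>R bd (True # w))"
      by (intro integrable_scaleR_left) (simp add: emeasure_lborel_Icc_eq)
    show "((\<lambda>x. indicator {0..2 * pi} \<phi> *\<^sub>R (cis (- (of_int n * \<phi>)) * P w (x, \<theta>, \<phi>))) has_vector_derivative
        indicator {0..2 * pi} \<phi> *\<^sub>R (cis (- (of_int n * \<phi>)) * P (True # w) (x, \<theta>, \<phi>))) (at x)" for x \<phi>
      by (intro bounded_linear.has_vector_derivative[OF bounded_linear_scaleR_right] has_vector_derivative_mult_right P_deriv_v)
    show "integrable lborel (\<lambda>\<phi>. indicator {0..2 * pi} \<phi> *\<^sub>R (cis (- (of_int n * \<phi>)) * P w (x, \<theta>, \<phi>)))" for x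
      by (rule integrable_mode)
    show "norm (indicator {0..2 * pi} \<phi> *\<^sub>R (cis (- (of_int n * \<phi>)) * P (True # w) (x, \<theta>, \<phi>))) \<le> indicator {0..2 * pi} \<phi> *\<^sub>R bd (True # w)" for x \<phi>
      using P_bound by (auto simp: norm_mult split: split_indicator)
  qed (use borel_measurable_integrable[OF integrable_mode] in auto)
  then show ?thesis
    unfolding az_mode_def[abs_def] set_lebesgue_integral_def by (rule has_vector_derivative_divide)
qed

lemma A_cont: "continuous_on UNIV (A w n \<theta>)"
  by (rule continuous_at_imp_continuous_on) (use has_vector_derivative_continuous[OF A_deriv] in blast)

lemma A_measurable [measurable]: "A w n \<theta> \<in> borel_measurable borel"
  by (rule borel_measurable_continuous_onI[OF A_cont])

text \<open>Integration by parts over a full period; the boundary terms cancel because both factors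
  have period 2 pi.\<close>

lemma A_phi: "A (False # w) n \<theta> x = \<i> * of_int n * A w n \<theta> x"
proof -
  have "(LINT \<phi>:{0..2 * pi}|lborel. cis (- of_int n * \<phi>) * P (False # w) (x, \<theta>, \<phi>) + \<i> * of_real (- of_int n) * cis (- of_int n * \<phi>) * P w (x, \<theta>, \<phi>))
     = cis (- of_int n * (2 * pi)) * P w (x, \<theta>, 2 * pi) - cis (- of_int n * 0) * P w (x, \<theta>, 0)"
    by (rule set_integral_FTC[OF _ has_vector_derivative_mult[OF has_vector_derivative_cis_linear P_deriv_phi]])
       (auto intro!: continuous_intros P_comp_cont)
  also have "cis (- of_int n * (2 * pi)) = 1"
    using cis_multiple_2pi[of "- of_int n"] by (simp add: mult_ac)
  also have "1 * P w (x, \<theta>, 2 * pi) - cis (- of_int n * 0) * P w (x, \<theta>, 0) = 0"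
    using P_periodic[of w x \<theta> 0] by simp
  finally have "(LINT \<phi>:{0..2 * pi}|lborel. cis (- of_int n * \<phi>) * P (False # w) (x, \<theta>, \<phi>)) +
     (LINT \<phi>:{0..2 * pi}|lborel. (- \<i> * of_int n) * (cis (- of_int n * \<phi>) * P w (x, \<theta>, \<phi>))) = 0"
    by (subst (asm) set_integral_add) (auto intro!: set_integrable_continuous continuous_intros P_comp_cont simp: mult.assoc)
  then have "(LINT \<phi>:{0..2 * pi}|lborel. cis (- of_int n * \<phi>) * P (False # w) (x, \<theta>, \<phi>)) =
     \<i> * of_int n * (LINT \<phi>:{0..2 * pi}|lborel. cis (- of_int n * \<phi>) * P w (x, \<theta>, \<phi>))"
    unfolding set_integral_mult_right by (simp add: add_eq_0_iff2)
  then show ?thesis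
    unfolding az_mode_def by simp
qed

lemma A_bound: "cmod (A w n \<theta> x) \<le> bd w"
proof -
  have "cmod (LINT \<phi>:{0..2 * pi}|lborel. cis (- (of_int n * \<phi>)) * P w (x, \<theta>, \<phi>)) \<le> (LINT \<phi>:{0..2 * pi}|lborel. bd w)"
    unfolding set_lebesgue_integral_def
    by (rule Bochner_Integration.integral_norm_bound_integral[OF integrable_mode])
       (use P_bound in \<open>auto simp: norm_mult emeasure_lborel_Icc_eq split: split_indicator\<close>)
  also have "\<dots> = 2 * pi * bd w" by (simp add: set_lebesgue_integral_def)
  finally show ?thesis by (simp add: az_mode_def norm_divide norm_mult divide_le_eq mult.commute)
qed

lemma A_support: "V < \<bar>x\<bar> \<Longrightarrow> A w n \<theta> x = 0"
  by (simp add: az_mode_def P_support set_lebesgue_integral_def)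

lemma A_integrable: "integrable lborel (A w n \<theta>)"
  by (rule integrableI_bounded_set[of "{-V..V}" _ _ "bd w"])
     (use A_bound A_support in \<open>auto simp: emeasure_lborel_Icc_eq intro!: AE_I2\<close>)

text \<open>The argument \<open>- \<xi>\<close> converts \<open>ft\<close> into the transform of the
  statement.\<close>

definition W :: "bool list \<Rightarrow> int \<Rightarrow> real \<Rightarrow> real \<Rightarrow> complex" where
  "W w n \<xi> \<theta> = ft (A w n \<theta>) (- \<xi>)"

lemma W_True: "W (True # w) n \<xi> \<theta> = \<i> * of_real \<xi> * W w n \<xi> \<theta>"
  unfolding W_def
  by (subst ft_derivative[where A = "A w n \<theta>" and V = V])
     (use A_deriv A_cont A_support V_pos in auto)

lemma W_False: "W (False # w) n \<xi> \<theta> = \<i> * of_int n * W w n \<xi> \<theta>"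
  unfolding W_def ft_def A_phi by (simp add: mult.left_commute[of "cis _"] mult.assoc flip: integral_mult_right_zero)

lemma W_bound: "cmod (W w n \<xi> \<theta>) \<le> 2 * V * bd w"
proof -
  have "W w n \<xi> \<theta> = (LINT t:{-V..V}|lborel. cis (- \<xi> * t) * A w n \<theta> t)"
    unfolding W_def by (rule ft_eq_set_integral[OF A_support]) auto
  also have "cmod \<dots> \<le> (LINT t:{-V..V}|lborel. bd w)"
    unfolding set_lebesgue_integral_def
  proof (rule Bochner_Integration.integral_norm_bound_integral)
    have "set_integrable lborel {-V..V} (\<lambda>t. cis (- \<xi> * t) * A w n \<theta> t)"
      by (intro set_integrable_continuous continuous_intros A_cont)
    then show "integrable lborel (\<lambda>x. indicat_real {- V..V} x *\<^sub>R (cis (- \<xi> * x) * A w n \<theta> x))"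
      by (simp add: set_integrable_def)
  qed (use A_bound in \<open>auto simp: norm_mult emeasure_lborel_Icc_eq split: split_indicator\<close>)
  also have "\<dots> = 2 * V * bd w" using V_pos by (simp add: set_lebesgue_integral_def)
  finally show ?thesis .
qed

text \<open>Prefixing four letters \<open>True\<close> multiplies the transform by \<xi>^4, four
  letters \<open>False\<close> by n^4, and all eight by the product. Each of the four transforms
  obeys the uniform bound that comes from a sup norm and compact support.\<close>

lemma W_decay: "\<exists>C\<ge>0. \<forall>n \<xi> \<theta>. (1 + \<xi> ^ 4) * (1 + real_of_int n ^ 4) * cmod (W w n \<xi> \<theta>) \<le> C"
proof -
  let ?T = "[True, True, True, True]" and ?F = "[False, False, False, False]"
  let ?B = "\<lambda>w. 2 * V * bd w"
  have T: "cmod (W (?T @ w) n \<xi> \<theta>) = \<xi> ^ 4 * cmod (W w n \<xi> \<theta>)" for w n \<xi> \<theta>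
    by (simp add: W_True norm_mult power4_eq_xxxx)
  have F: "cmod (W (?F @ w) n \<xi> \<theta>) = real_of_int n ^ 4 * cmod (W w n \<xi> \<theta>)" for w n \<xi> \<theta>
    by (simp add: W_False norm_mult power4_eq_xxxx)
  have "(1 + \<xi> ^ 4) * (1 + real_of_int n ^ 4) * cmod (W w n \<xi> \<theta>) \<le> ?B w + ?B (?T @ w) + ?B (?F @ w) + ?B (?T @ ?F @ w)" for n \<xi> \<theta>
  proof -
    have "(1 + \<xi> ^ 4) * (1 + real_of_int n ^ 4) * cmod (W w n \<xi> \<theta>) =
      cmod (W w n \<xi> \<theta>) + cmod (W (?T @ w) n \<xi> \<theta>) + cmod (W (?F @ w) n \<xi> \<theta>) + cmod (W (?T @ ?F @ w) n \<xi> \<theta>)"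
      unfolding T F by (simp add: algebra_simps)
    also have "\<dots> \<le> ?B w + ?B (?T @ w) + ?B (?F @ w) + ?B (?T @ ?F @ w)"
      by (intro add_mono W_bound)
    finally show ?thesis .
  qed
  moreover have "0 \<le> ?B w + ?B (?T @ w) + ?B (?F @ w) + ?B (?T @ ?F @ w)"
    using V_pos bd_nonneg by (intro add_nonneg_nonneg mult_nonneg_nonneg) auto
  ultimately show ?thesis by blast
qed

text \<open>Two powers of \<open>\<xi>\<close> and of \<open>n\<close> of the decay are kept for integrability; the rest absorbs symbols of
  first order in \<open>\<xi>\<close> and in \<open>n\<close>.\<close>

lemma W_decay_symbol:
  "\<exists>C\<ge>0. \<forall>n \<xi> \<theta>. (1 + \<bar>\<xi>\<bar>)\<^sup>2 * (1 + \<bar>real_of_int n\<bar>)\<^sup>2 * cmod (W w n \<xi> \<theta>) \<le> C * (1 / (1 + (real_of_int n)\<^sup>2)) * (1 / (1 + \<xi>\<^sup>2))"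
proof -
  obtain C where C: "C \<ge> 0" "\<forall>n \<xi> \<theta>. (1 + \<xi> ^ 4) * (1 + real_of_int n ^ 4) * cmod (W w n \<xi> \<theta>) \<le> C"
    using W_decay by blast
  \<comment> \<open>From 2|x| \<le> 1 + x^2 and 2x^2 \<le> 1 + x^4. One factor 4 for each variable
    gives the 16 below.\<close>
  have p: "(1 + \<bar>x\<bar>)\<^sup>2 * (1 + x\<^sup>2) \<le> 4 * (1 + x ^ 4)" for x :: real
  proof -
    have "(1 + \<bar>x\<bar>)\<^sup>2 \<le> 2 * (1 + x\<^sup>2)"
      using zero_le_power2[of "1 - \<bar>x\<bar>"] by (simp add: power2_eq_square algebra_simps abs_mult_self_eq)
    then have "(1 + \<bar>x\<bar>)\<^sup>2 * (1 + x\<^sup>2) \<le> 2 * (1 + x\<^sup>2) * (1 + x\<^sup>2)"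
      by (intro mult_right_mono) auto
    also have "\<dots> \<le> 4 * (1 + x ^ 4)"
      using zero_le_power2[of "1 - x\<^sup>2"] by (simp add: power2_eq_square power4_eq_xxxx algebra_simps)
    finally show ?thesis .
  qed
  have "(1 + \<bar>\<xi>\<bar>)\<^sup>2 * (1 + \<bar>real_of_int n\<bar>)\<^sup>2 * cmod (W w n \<xi> \<theta>) \<le> 16 * C * (1 / (1 + (real_of_int n)\<^sup>2)) * (1 / (1 + \<xi>\<^sup>2))" for n \<xi> \<theta>
  proof -
    have "((1 + \<bar>\<xi>\<bar>)\<^sup>2 * (1 + \<xi>\<^sup>2)) * ((1 + \<bar>real_of_int n\<bar>)\<^sup>2 * (1 + (real_of_int n)\<^sup>2)) * cmod (W w n \<xi> \<theta>)
        \<le> (4 * (1 + \<xi> ^ 4)) * (4 * (1 + real_of_int n ^ 4)) * cmod (W w n \<xi> \<theta>)"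
      by (intro mult_right_mono mult_mono p) auto
    also have "\<dots> = 16 * ((1 + \<xi> ^ 4) * (1 + real_of_int n ^ 4) * cmod (W w n \<xi> \<theta>))" by (simp add: algebra_simps)
    also have "\<dots> \<le> 16 * C" using C(2) by (intro mult_left_mono) auto
    finally have "(1 + \<bar>\<xi>\<bar>)\<^sup>2 * (1 + \<bar>real_of_int n\<bar>)\<^sup>2 * cmod (W w n \<xi> \<theta>) * ((1 + (real_of_int n)\<^sup>2) * (1 + \<xi>\<^sup>2)) \<le> 16 * C"
      by (simp only: mult_ac)
    moreover have "0 < (1 + (real_of_int n)\<^sup>2) * (1 + \<xi>\<^sup>2)" by (intro mult_pos_pos) (auto intro: add_pos_nonneg)
    ultimately have "(1 + \<bar>\<xi>\<bar>)\<^sup>2 * (1 + \<bar>real_of_int n\<bar>)\<^sup>2 * cmod (W w n \<xi> \<theta>) \<le> 16 * C / ((1 + (real_of_int n)\<^sup>2) * (1 + \<xi>\<^sup>2))"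
      by (simp only: pos_le_divide_eq)
    then show ?thesis by simp
  qed
  then show ?thesis using C(1) by (intro exI[of _ "16 * C"]) auto
qed

lemma W_cont: "isCont (\<lambda>\<xi>. W w n \<xi> \<theta>) \<xi>"
proof -
  have "isCont (ft (A w n \<theta>)) (- \<xi>)" by (rule ft_isCont[OF A_integrable])
  then show ?thesis unfolding W_def by (rule isCont_o2[rotated]) (intro continuous_intros)
qed

lemma W_measurable: "(\<lambda>(\<xi>, \<theta>). W w n \<xi> \<theta>) \<in> borel_measurable (borel \<Otimes>\<^sub>M borel)"
proof -
  have "(\<lambda>(p, \<phi>). indicator {0..2 * pi} \<phi> *\<^sub>R (cis (- (of_int n * \<phi>)) * P w (snd p, fst p, \<phi>))) \<in> borel_measurable ((borel \<Otimes>\<^sub>M borel) \<Otimes>\<^sub>M lborel)"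
    by measurable
  then have "(\<lambda>p. LINT \<phi>|lborel. indicator {0..2 * pi} \<phi> *\<^sub>R (cis (- (of_int n * \<phi>)) * P w (snd p, fst p, \<phi>))) \<in> borel_measurable (borel \<Otimes>\<^sub>M borel)"
    by (rule lborel.borel_measurable_lebesgue_integral)
  then have [measurable]: "(\<lambda>p. A w n (fst p) (snd p)) \<in> borel_measurable (borel \<Otimes>\<^sub>M borel)"
    unfolding az_mode_def set_lebesgue_integral_def by measurable
  have "(\<lambda>(p, t). cis (- fst p * t) * A w n (fst (snd p, t)) (snd (snd p, t))) \<in> borel_measurable ((borel \<Otimes>\<^sub>M borel) \<Otimes>\<^sub>M lborel)"
    by measurable
  then have "(\<lambda>p. LINT t|lborel. cis (- fst p * t) * A w n (fst (snd p, t)) (snd (snd p, t))) \<in> borel_measurable (borel \<Otimes>\<^sub>M borel)"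
    by (rule lborel.borel_measurable_lebesgue_integral)
  then show ?thesis by (simp add: W_def ft_def case_prod_beta)
qed

lemma W_measurable1 [measurable]: "(\<lambda>\<xi>. W w n \<xi> \<theta>) \<in> borel_measurable borel"
  using measurable_compose[OF measurable_Pair2' W_measurable, of \<theta>] by simp

lemma W_integrable: "integrable lborel (\<lambda>\<xi>. W w n \<xi> \<theta>)"
proof -
  obtain C where C: "C \<ge> 0" "\<forall>n \<xi> \<theta>. (1 + \<bar>\<xi>\<bar>)\<^sup>2 * (1 + \<bar>real_of_int n\<bar>)\<^sup>2 * cmod (W w n \<xi> \<theta>) \<le> C * (1 / (1 + (real_of_int n)\<^sup>2)) * (1 / (1 + \<xi>\<^sup>2))"
    using W_decay_symbol by blast
  have "cmod (W w n \<xi> \<theta>) \<le> C * (1 / (1 + (real_of_int n)\<^sup>2)) * (1 / (1 + \<xi>\<^sup>2))" for \<xi>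
  proof -
    have "1 * 1 * cmod (W w n \<xi> \<theta>) \<le> (1 + \<bar>\<xi>\<bar>)\<^sup>2 * (1 + \<bar>real_of_int n\<bar>)\<^sup>2 * cmod (W w n \<xi> \<theta>)"
      by (intro mult_right_mono mult_mono) (auto simp: one_le_power)
    then show ?thesis using C(2)[rule_format, of \<xi> n \<theta>] by linarith
  qed
  then show ?thesis
    by (intro Bochner_Integration.integrable_bound
        [OF integrable_mult_right[OF integrable_inverse_square_real, of "C * (1 / (1 + (real_of_int n)\<^sup>2))"]])
      (auto simp: abs_of_nonneg[OF C(1)])
qed

lemma A_inversion: "A w n \<theta> x = ft (\<lambda>\<xi>. W w n \<xi> \<theta>) x / (2 * of_real pi)"
proof -
  have i: "integrable lborel (ft (A w n \<theta>))"
    using integrable_reflect[OF W_integrable[of w n \<theta>]] by (simp add: W_def)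
  have "ft (ft (A w n \<theta>)) (- x) = 2 * of_real pi * A w n \<theta> x"
    by (rule fourier_inversion[OF A_integrable A_bound _ i]) (use A_cont in \<open>simp add: continuous_on_eq_continuous_at\<close>)
  moreover have "ft (ft (A w n \<theta>)) (- x) = ft (\<lambda>\<xi>. W w n \<xi> \<theta>) x"
    unfolding ft_def[of "ft (A w n \<theta>)"] ft_def[of "\<lambda>\<xi>. W w n \<xi> \<theta>"]
    by (subst integral_reflect[symmetric]) (simp add: W_def)
  ultimately show ?thesis by simp
qed

text \<open>By compact support the truncated integrals equal the transform as soon as L \<ge> V, so
  the error is eventually 0.\<close>

lemma L2_fourier_A: "L2_fourier (A w n \<theta>) (\<lambda>\<xi>. W w n \<xi> \<theta>)"
proof -
  have a: "integrable lborel (\<lambda>x. (cmod (A w n \<theta> x))\<^sup>2)" by (rule square_integrable_bounded[OF A_integrable A_bound])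
  have b: "integrable lborel (\<lambda>\<xi>. (cmod (W w n \<xi> \<theta>))\<^sup>2)" by (rule square_integrable_bounded[OF W_integrable W_bound])
  have "\<forall>\<^sub>F L in at_top. (\<integral>\<^sup>+ \<xi>. ennreal ((cmod (W w n \<xi> \<theta> - (LINT x:{-L..L}|lborel. cis (- (\<xi> * x)) * A w n \<theta> x)))\<^sup>2) \<partial>lborel) = 0"
    using eventually_ge_at_top[of V]
  proof eventually_elim
    case (elim L)
    then have "W w n \<xi> \<theta> = (LINT x:{-L..L}|lborel. cis (- (\<xi> * x)) * A w n \<theta> x)" for \<xi>
      unfolding W_def using ft_eq_set_integral[OF A_support elim, where x = "- \<xi>"] by simp
    then show ?case by simp
  qed
  then show ?thesis unfolding L2_fourier_def
    using a b by (auto simp: nn_integral_eq_integral intro: tendsto_eventually)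
qed

end

section \<open>Fourier representation of the radiation field\<close>

text \<open>For a primitive \<open>G\<close>, the difference G(x + 2 pi) - G(x) has derivative zero,
  so the integral over a period does not depend on where it starts.\<close>

lemma integral_periodic_shift:
  fixes g :: "real \<Rightarrow> complex"
  assumes c: "continuous_on UNIV g" and p: "\<And>x. g (x + 2 * pi) = g x"
  shows "(LINT \<phi>:{0..2 * pi}|lborel. g (\<phi> + \<tau>)) = (LINT \<phi>:{0..2 * pi}|lborel. g \<phi>)"
proof -
  define G where "G x = (LBINT y=ereal 0..ereal x. g y)" for x
  have G: "(G has_vector_derivative g x) (at x)" for x
  proof -
    have "((\<lambda>u. LBINT y=ereal 0..ereal u. g y) has_vector_derivative g x) (at x within {min 0 x - 1..max 0 x + 1})"
      by (rule interval_integral_FTC2) (auto intro: continuous_on_subset[OF c])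
    moreover have "x \<in> interior {min 0 x - 1..max 0 x + 1}" by (simp add: interior_atLeastAtMost_real) linarith
    ultimately show ?thesis unfolding G_def by (simp only: at_within_interior)
  qed
  have G': "((\<lambda>x. G (x + c)) has_vector_derivative g (x + c)) (at x)" for x c
  proof -
    have "((\<lambda>x. x + c) has_vector_derivative 1) (at x)" by (auto intro!: derivative_eq_intros)
    from vector_diff_chain_at[OF this G] show ?thesis by (simp add: o_def)
  qed
  have "((\<lambda>x. G (x + 2 * pi) - G (x + 0)) has_vector_derivative (g (x + 2 * pi) - g (x + 0))) (at x)" for x
    by (intro has_vector_derivative_diff G')
  then have "((\<lambda>x. G (x + 2 * pi) - G (x + 0)) has_vector_derivative 0) (at x within UNIV)" for x
    by (simp add: p)
  then obtain d where d: "\<And>x. G (x + 2 * pi) - G (x + 0) = d"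
    using has_vector_derivative_zero_constant[of UNIV "\<lambda>x. G (x + 2 * pi) - G (x + 0)"] by auto
  have E: "(LINT \<phi>:{0..2 * pi}|lborel. g (\<phi> + t)) = G (2 * pi + t) - G (0 + t)" for t
    by (rule set_integral_FTC[OF _ G']) (auto intro!: continuous_on_compose2[OF c] continuous_intros)
  show ?thesis using E[of \<tau>] E[of 0] d[of \<tau>] d[of 0] by (simp add: add.commute)
qed

text \<open>The linear term outweighs the logarithm. This confines the s-integral of a field with
  bounded support in v to a bounded interval.\<close>

lemma retarded_time_cutoff:
  fixes lam K :: real
  assumes "lam > 0"
  shows "\<exists>s2>0. \<forall>s>s2. - s + lam * ln s < - K"
proof -
  have "filterlim (\<lambda>s. - s + lam * ln s) at_bot at_top" using assms by real_asymp
  then have "\<forall>\<^sub>F s in at_top. - s + lam * ln s < - K"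
    unfolding filterlim_at_bot_dense by blast
  then obtain N where N: "\<And>s. s \<ge> N \<Longrightarrow> - s + lam * ln s < - K"
    unfolding eventually_at_top_linorder by blast
  show ?thesis
  proof (intro exI[of _ "max N 1"] conjI allI impI)
    fix s :: real assume "max N 1 < s"
    then show "- s + lam * ln s < - K" using N[of s] by simp
  qed auto
qed

text \<open>The half-line average, detached from Kerr: \<open>lam\<close> and \<open>mu\<close> will
  be \<open>lambda_plus m a\<close> and \<open>lambda_plus m a * omega_plus m a\<close>, while
  \<open>c0\<close> and \<open>c1\<close> collect the constants of integration of the
  coordinates.\<close>

locale radiating_tower = tower +
  fixes lam mu c0 c1 :: real
  assumes lam_pos: "lam > 0"
begin

definition delay :: "real \<Rightarrow> real" where "delay s = - s + lam * ln s + c0"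

definition twist :: "real \<Rightarrow> real" where "twist s = mu * ln s + c1"

lemma delay_measurable [measurable]: "delay \<in> borel_measurable borel"
  unfolding delay_def by measurable

lemma twist_measurable [measurable]: "twist \<in> borel_measurable borel"
  unfolding twist_def by measurable

definition Rad :: "field \<Rightarrow> field" where
  "Rad f = (\<lambda>(u, \<theta>, \<phi>). LINT s:{0<..}|lborel. f (u + delay s, \<theta>, \<phi> + twist s))"

lemma delay_cutoff: "\<exists>s2>0. \<forall>s>s2. \<forall>u\<le>u0. u + delay s < - V"
proof -
  obtain s2 where "s2 > 0" "\<forall>s>s2. - s + lam * ln s < - (V + u0 + c0)"
    using retarded_time_cutoff[OF lam_pos] by blast
  then show ?thesis by (intro exI[of _ s2]) (force simp: delay_def)
qed

text \<open>Indexed by an upper bound of the retarded time, so that one interval serves a whole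
  neighbourhood of times when differentiating.\<close>

definition cutoff :: "real \<Rightarrow> real" where
  "cutoff u0 = (SOME s2. s2 > 0 \<and> (\<forall>s>s2. \<forall>u\<le>u0. u + delay s < - V))"

lemma cutoff: "cutoff u0 > 0" "s > cutoff u0 \<Longrightarrow> u \<le> u0 \<Longrightarrow> u + delay s < - V"
proof -
  have "cutoff u0 > 0 \<and> (\<forall>s>cutoff u0. \<forall>u\<le>u0. u + delay s < - V)"
    unfolding cutoff_def by (rule someI_ex) (use delay_cutoff[of u0] in blast)
  then show "cutoff u0 > 0" "s > cutoff u0 \<Longrightarrow> u \<le> u0 \<Longrightarrow> u + delay s < - V" by auto
qed

lemma P_delay_zero: "s > cutoff u0 \<Longrightarrow> u \<le> u0 \<Longrightarrow> P w (u + delay s, \<theta>, \<phi>) = 0"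
  using cutoff(2)[of u0 s u] V_pos by (intro P_support) auto

lemma A_delay_zero: "s > cutoff u0 \<Longrightarrow> u \<le> u0 \<Longrightarrow> A w n \<theta> (u + delay s) = 0"
  using cutoff(2)[of u0 s u] V_pos by (intro A_support) auto

lemma cutoff_integrable: "integrable lborel (\<lambda>s. indicator {0<..cutoff u0} s *\<^sub>R (b::real))"
  using cutoff(1)[of u0] by (intro integrable_scaleR_left) (simp add: emeasure_lborel_Ioc)

lemma Rad_integrand_bound:
  assumes "u \<le> u0"
  shows "cmod (indicator {0<..} s *\<^sub>R P w (u + delay s, \<theta>, \<phi>)) \<le> indicator {0<..cutoff u0} s *\<^sub>R bd w"
  using P_delay_zero[of u0 s u] assms P_bound by (auto split: split_indicator simp: not_le)

lemma Rad_integrable: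
  "integrable lborel (\<lambda>s. indicator {0<..} s *\<^sub>R P w (u + delay s, \<theta>, \<phi> + twist s))"
proof (rule Bochner_Integration.integrable_bound[OF cutoff_integrable[of u "bd w"]])
  show "(\<lambda>s. indicator {0<..} s *\<^sub>R P w (u + delay s, \<theta>, \<phi> + twist s)) \<in> borel_measurable lborel"
    by measurable
qed (use Rad_integrand_bound in \<open>auto intro!: AE_I2 order_trans[OF _ abs_ge_self]\<close>)

lemma Rad_deriv_u: "((\<lambda>u. Rad (P w) (u, \<theta>, \<phi>)) has_vector_derivative Rad (P (True # w)) (u, \<theta>, \<phi>)) (at u)"
  unfolding Rad_def prod.case set_lebesgue_integral_def
\<comment> \<open>The cutoff at u + 1 is valid for every time in the interval (u - 1, u +
  1).\<close>
proof (rule has_vector_derivative_integral_dominated[where a = "u - 1" and b = "u + 1" and g = "\<lambda>s. indicator {0<..cutoff (u + 1)} s *\<^sub>R bd (True # w)"])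
  fix x s :: real
  have "((\<lambda>x. x + delay s) has_vector_derivative 1) (at x)" by (auto intro!: derivative_eq_intros)
  from vector_diff_chain_at[OF this P_deriv_v]
  have "((\<lambda>x. P w (x + delay s, \<theta>, \<phi> + twist s)) has_vector_derivative P (True # w) (x + delay s, \<theta>, \<phi> + twist s)) (at x)"
    by (simp add: o_def)
  then show "((\<lambda>x. indicator {0<..} s *\<^sub>R P w (x + delay s, \<theta>, \<phi> + twist s)) has_vector_derivative
    indicator {0<..} s *\<^sub>R P (True # w) (x + delay s, \<theta>, \<phi> + twist s)) (at x)"
    by (intro bounded_linear.has_vector_derivative[OF bounded_linear_scaleR_right])
qed (use Rad_integrable cutoff_integrable borel_measurable_integrable[OF Rad_integrable] Rad_integrand_bound in auto)

lemma Rad_deriv_phi: "((\<lambda>\<phi>. Rad (P w) (u, \<theta>, \<phi>)) has_vector_derivative Rad (P (False # w)) (u, \<theta>, \<phi>)) (at \<phi>)"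
  unfolding Rad_def prod.case set_lebesgue_integral_def
proof (rule has_vector_derivative_integral_dominated[where a = "\<phi> - 1" and b = "\<phi> + 1" and g = "\<lambda>s. indicator {0<..cutoff u} s *\<^sub>R bd (False # w)"])
  fix x s :: real
  have "((\<lambda>x. x + twist s) has_vector_derivative 1) (at x)" by (auto intro!: derivative_eq_intros)
  from vector_diff_chain_at[OF this P_deriv_phi]
  have "((\<lambda>x. P w (u + delay s, \<theta>, x + twist s)) has_vector_derivative P (False # w) (u + delay s, \<theta>, x + twist s)) (at x)"
    by (simp add: o_def)
  then show "((\<lambda>x. indicator {0<..} s *\<^sub>R P w (u + delay s, \<theta>, x + twist s)) has_vector_derivative
    indicator {0<..} s *\<^sub>R P (False # w) (u + delay s, \<theta>, x + twist s)) (at x)"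
    by (intro bounded_linear.has_vector_derivative[OF bounded_linear_scaleR_right])
qed (use Rad_integrable cutoff_integrable borel_measurable_integrable[OF Rad_integrable] Rad_integrand_bound in auto)

text \<open>After Fubini the azimuthal shift \<open>twist s\<close> is absorbed by periodicity and
  reappears as a phase of frequency n.\<close>

lemma az_mode_Rad:
  "az_mode n (Rad (P w)) \<theta> u = (LINT s:{0<..}|lborel. cis (of_int n * twist s) * A w n \<theta> (u + delay s))"
proof -
  let ?I = "\<lambda>\<phi>. indicator {0..2 * pi} \<phi> :: real" and ?J = "\<lambda>s. indicator {0<..} s :: real"
  let ?f = "\<lambda>\<phi> s. ?I \<phi> *\<^sub>R (cis (- (of_int n * \<phi>)) * (?J s *\<^sub>R P w (u + delay s, \<theta>, \<phi> + twist s)))"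
  have I: "integrable lborel (\<lambda>\<phi>. complex_of_real (?I \<phi>))" "integrable lborel (\<lambda>s. complex_of_real (indicator {0<..cutoff u} s *\<^sub>R bd w))"
    by (intro integrable_of_real cutoff_integrable, simp add: emeasure_lborel_Icc_eq) (intro integrable_of_real cutoff_integrable)
  have P1: "integrable (lborel \<Otimes>\<^sub>M lborel) (\<lambda>(\<phi>, s). complex_of_real (?I \<phi>) * complex_of_real (indicator {0<..cutoff u} s *\<^sub>R bd w))"
    by (rule integrable_pair_mult[OF sigma_finite_lborel sigma_finite_lborel I])
  have P2: "integrable (lborel \<Otimes>\<^sub>M lborel) (\<lambda>(\<phi>, s). ?f \<phi> s)"
  proof (rule Bochner_Integration.integrable_bound[OF P1])
    show "(\<lambda>(\<phi>, s). ?f \<phi> s) \<in> borel_measurable (lborel \<Otimes>\<^sub>M lborel)" by measurable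
    show "AE z in lborel \<Otimes>\<^sub>M lborel. norm (case z of (\<phi>, s) \<Rightarrow> ?f \<phi> s) \<le> norm (case z of (\<phi>, s) \<Rightarrow> complex_of_real (?I \<phi>) * complex_of_real (indicator {0<..cutoff u} s *\<^sub>R bd w))"
    proof (rule AE_I2, clarify)
      fix \<phi> s
      show "norm (?f \<phi> s) \<le> norm (complex_of_real (?I \<phi>) * complex_of_real (indicator {0<..cutoff u} s *\<^sub>R bd w))"
        using Rad_integrand_bound[of u u s w \<theta> "\<phi> + twist s"] bd_nonneg[of w]
        by (auto simp: norm_mult split: split_indicator)
    qed
  qed
  have "(LINT \<phi>:{0..2 * pi}|lborel. cis (- (of_int n * \<phi>)) * Rad (P w) (u, \<theta>, \<phi>)) = (LINT \<phi>|lborel. LINT s|lborel. ?f \<phi> s)"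
    unfolding Rad_def prod.case set_lebesgue_integral_def
    by (simp only: integral_scaleR_right integral_mult_right_zero)
  also have "\<dots> = (LINT s|lborel. LINT \<phi>|lborel. ?f \<phi> s)"
    using lborel_pair.Fubini_integral[OF P2] by simp
  also have "\<dots> = (LINT s|lborel. ?J s *\<^sub>R (cis (of_int n * twist s) * (2 * of_real pi * A w n \<theta> (u + delay s))))"
  proof (intro Bochner_Integration.integral_cong refl)
    fix s
    let ?g = "\<lambda>\<phi>. cis (- (of_int n * \<phi>)) * P w (u + delay s, \<theta>, \<phi>)"
    have per: "?g (\<phi> + 2 * pi) = ?g \<phi>" for \<phi>
    proof -
      have "cis (- (of_int n * (\<phi> + 2 * pi))) = cis (- (of_int n * \<phi>)) * cis (2 * pi * of_int (- n))"
        by (simp add: cis_mult algebra_simps)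
      also have "\<dots> = cis (- (of_int n * \<phi>))" by (subst cis_multiple_2pi) auto
      finally show ?thesis by (simp add: P_periodic)
    qed
    have "(LINT \<phi>|lborel. ?f \<phi> s) = (LINT \<phi>|lborel. (?J s *\<^sub>R cis (of_int n * twist s)) * (?I \<phi> *\<^sub>R ?g (\<phi> + twist s)))"
    proof (intro Bochner_Integration.integral_cong refl)
      fix \<phi>
      have "cis (- (of_int n * \<phi>)) = cis (of_int n * twist s) * cis (- (of_int n * (\<phi> + twist s)))"
        by (simp add: cis_mult algebra_simps)
      then show "?f \<phi> s = (?J s *\<^sub>R cis (of_int n * twist s)) * (?I \<phi> *\<^sub>R ?g (\<phi> + twist s))"
        by (simp add: scaleR_conv_of_real)
    qed
    also have "\<dots> = (?J s *\<^sub>R cis (of_int n * twist s)) * (LINT \<phi>:{0..2 * pi}|lborel. ?g (\<phi> + twist s))"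
      unfolding set_lebesgue_integral_def by (rule integral_mult_right_zero)
    also have "(LINT \<phi>:{0..2 * pi}|lborel. ?g (\<phi> + twist s)) = (LINT \<phi>:{0..2 * pi}|lborel. ?g \<phi>)"
      by (rule integral_periodic_shift[where g = ?g, OF _ per]) (intro continuous_intros P_comp_cont)
    also have "\<dots> = 2 * of_real pi * A w n \<theta> (u + delay s)" by (simp add: az_mode_def)
    finally show "(LINT \<phi>|lborel. ?f \<phi> s) = ?J s *\<^sub>R (cis (of_int n * twist s) * (2 * of_real pi * A w n \<theta> (u + delay s)))"
      by simp
  qed
  also have "\<dots> = (LINT s|lborel. (2 * of_real pi) * (?J s *\<^sub>R (cis (of_int n * twist s) * A w n \<theta> (u + delay s))))"
    by (intro Bochner_Integration.integral_cong refl) (simp add: scaleR_conv_of_real mult_ac)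
  also have "\<dots> = 2 * of_real pi * (LINT s:{0<..}|lborel. cis (of_int n * twist s) * A w n \<theta> (u + delay s))"
    unfolding set_lebesgue_integral_def by (rule integral_mult_right_zero)
  finally show ?thesis by (simp add: az_mode_def)
qed

text \<open>The Fourier multiplier that leads from the horizon to the \<open>T\<close>-derivative of
  the radiation field. The constants \<open>c0\<close> and \<open>c1\<close> contribute only a
  unimodular phase; the first argument of \<open>mellin_symbol\<close> is \<beta>_+ for the Kerr
  values of \<open>lam\<close> and \<open>mu\<close>.\<close>

definition scri_mult :: "int \<Rightarrow> real \<Rightarrow> complex" where
  "scri_mult n \<xi> = cis (\<xi> * c0 + of_int n * c1) * mellin_symbol (lam * \<xi> + mu * of_int n) \<xi>"

lemma scri_mult_isCont: "\<xi> \<noteq> 0 \<Longrightarrow> isCont (scri_mult n) \<xi>"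
  unfolding scri_mult_def cis_conv_exp by (intro continuous_intros mellin_symbol_isCont)

lemma scri_mult_0: "scri_mult n 0 = 0"
  by (simp add: scri_mult_def mellin_symbol_def)

text \<open>Continuous away from 0 and equal to 0 there, so the indicator of the complement of {0}
  may be inserted.\<close>

lemma scri_mult_measurable: "scri_mult n \<in> borel_measurable borel"
proof -
  have "(\<lambda>\<xi>. indicator (- {0}) \<xi> *\<^sub>R scri_mult n \<xi>) \<in> borel_measurable borel"
    by (rule borel_measurable_continuous_on_indicator)
       (auto intro!: continuous_at_imp_continuous_on scri_mult_isCont)
  also have "(\<lambda>\<xi>. indicator (- {0}) \<xi> *\<^sub>R scri_mult n \<xi>) = scri_mult n"
    by (auto simp: fun_eq_iff scri_mult_0 split: split_indicator)
  finally show ?thesis .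
qed

lemma abs_beta_le: "\<bar>lam * \<xi> + mu * of_int n\<bar> \<le> (lam + \<bar>mu\<bar>) * ((1 + \<bar>\<xi>\<bar>) * (1 + \<bar>real_of_int n\<bar>))"
proof -
  have "\<bar>lam * \<xi> + mu * of_int n\<bar> \<le> lam * \<bar>\<xi>\<bar> + \<bar>mu\<bar> * \<bar>real_of_int n\<bar>"
    using abs_triangle_ineq[of "lam * \<xi>" "mu * of_int n"] lam_pos by (simp add: abs_mult)
  also have "\<dots> \<le> lam * ((1 + \<bar>\<xi>\<bar>) * (1 + \<bar>real_of_int n\<bar>)) + \<bar>mu\<bar> * ((1 + \<bar>\<xi>\<bar>) * (1 + \<bar>real_of_int n\<bar>))"
    using lam_pos by (intro add_mono mult_left_mono) (auto simp: algebra_simps)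
  finally show ?thesis by (simp add: algebra_simps)
qed

text \<open>The factor \<open>e\<^sup>-\<^sup>\<epsilon>\<^sup>s\<close> makes the double integral in \<open>(s, \<xi>)\<close> absolutely convergent.\<close>

lemma az_mode_Rad_True:
  "az_mode n (Rad (P (True # w))) \<theta> u = ft (\<lambda>\<xi>. scri_mult n \<xi> * W w n \<xi> \<theta>) u / (2 * of_real pi)"
proof -
  let ?e = "\<lambda>j. inverse (real (Suc j))"
  have e: "?e \<longlonglongrightarrow> 0" by (rule LIMSEQ_inverse_real_of_nat)
  have e0: "?e j > 0" for j by simp
  define \<beta> where "\<beta> \<xi> = lam * \<xi> + mu * of_int n" for \<xi>
  \<comment> \<open>The letter \<open>True\<close> supplies the factor i\<xi> that keeps the Mellin
    integral bounded near zero frequency.\<close>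
  let ?A = "A (True # w) n \<theta>" and ?W = "\<lambda>\<xi>. W (True # w) n \<xi> \<theta>"
  let ?J = "\<lambda>s. indicator {0<..} s :: real"
  \<comment> \<open>The mode with damping. On the time side its removal is harmless, since the
    integrand lives on a bounded interval of s.\<close>
  define F where "F \<epsilon> = (LINT s|lborel. ?J s *\<^sub>R (of_real (exp (- (\<epsilon> * s))) * (cis (of_int n * twist s) * ?A (u + delay s))))" for \<epsilon>
  have "(\<lambda>j. F (?e j)) \<longlonglongrightarrow> (LINT s|lborel. ?J s *\<^sub>R (cis (of_int n * twist s) * ?A (u + delay s)))"
    unfolding F_def
  proof (rule integral_dominated_convergence[OF _ _ cutoff_integrable[of u "bd (True # w)"]])
    show "AE s in lborel. (\<lambda>j. ?J s *\<^sub>R (of_real (exp (- (?e j * s))) * (cis (of_int n * twist s) * ?A (u + delay s)))) \<longlonglongrightarrow> ?J s *\<^sub>R (cis (of_int n * twist s) * ?A (u + delay s))"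
    proof (rule AE_I2)
      fix s
      have "(\<lambda>j. ?J s *\<^sub>R (of_real (exp (- (?e j * s))) * (cis (of_int n * twist s) * ?A (u + delay s)))) \<longlonglongrightarrow> ?J s *\<^sub>R (of_real (exp (- (0 * s))) * (cis (of_int n * twist s) * ?A (u + delay s)))"
        by (intro tendsto_intros e)
      then show "(\<lambda>j. ?J s *\<^sub>R (of_real (exp (- (?e j * s))) * (cis (of_int n * twist s) * ?A (u + delay s)))) \<longlonglongrightarrow> ?J s *\<^sub>R (cis (of_int n * twist s) * ?A (u + delay s))"
        by simp
    qed
    show "AE s in lborel. norm (?J s *\<^sub>R (of_real (exp (- (?e j * s))) * (cis (of_int n * twist s) * ?A (u + delay s)))) \<le> indicator {0<..cutoff u} s *\<^sub>R bd (True # w)" for j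
    proof (rule AE_I2)
      fix s
      show "norm (?J s *\<^sub>R (of_real (exp (- (?e j * s))) * (cis (of_int n * twist s) * ?A (u + delay s)))) \<le> indicator {0<..cutoff u} s *\<^sub>R bd (True # w)"
      proof (cases "0 < s \<and> s \<le> cutoff u")
        case True
        then have "exp (- (?e j * s)) * cmod (?A (u + delay s)) \<le> 1 * bd (True # w)"
          by (intro mult_mono A_bound) auto
        then show ?thesis using True by (simp add: norm_mult)
      next
        case False
        then show ?thesis using A_delay_zero[of u s u] by (auto split: split_indicator simp: not_le)
      qed
    qed
  qed auto
  then have lim1: "(\<lambda>j. F (?e j)) \<longlonglongrightarrow> az_mode n (Rad (P (True # w))) \<theta> u"
    by (simp add: az_mode_Rad set_lebesgue_integral_def)
  \<comment> \<open>The mode is replaced by its inverse Fourier integral and the order is exchanged;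
    the s-integral then sees only the damped phase s^(i\<beta>) e^(-i\<xi>s).\<close>
  have Feq: "F \<epsilon> = (LINT \<xi>|lborel. cis (u * \<xi>) * (cis (\<xi> * c0 + of_int n * c1) * W w n \<xi> \<theta> *
      (\<i> * of_real \<xi> * (LINT s:{0<..}|lborel. mellin_kernel \<epsilon> (\<beta> \<xi>) \<xi> s)))) / (2 * of_real pi)" if "\<epsilon> > 0" for \<epsilon>
  proof -
    let ?h = "\<lambda>s \<xi>. ?J s *\<^sub>R (of_real (exp (- (\<epsilon> * s))) * (cis (of_int n * twist s) * (cis ((u + delay s) * \<xi>) * ?W \<xi>)))"
    have J: "integrable lborel (\<lambda>s. complex_of_real (?J s *\<^sub>R (s ^ 0 * exp (- (\<epsilon> * s)))))"
      using integrable_power_exp[OF that, of 0] unfolding set_integrable_def by (rule integrable_of_real)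
    have P1: "integrable (lborel \<Otimes>\<^sub>M lborel) (\<lambda>(s, \<xi>). complex_of_real (?J s *\<^sub>R (s ^ 0 * exp (- (\<epsilon> * s)))) * ?W \<xi>)"
      by (rule integrable_pair_mult[OF sigma_finite_lborel sigma_finite_lborel J W_integrable])
    have P2: "integrable (lborel \<Otimes>\<^sub>M lborel) (\<lambda>(s, \<xi>). ?h s \<xi>)"
      by (rule Bochner_Integration.integrable_bound[OF P1]) (auto simp: norm_mult)
    have "F \<epsilon> = (LINT s|lborel. (LINT \<xi>|lborel. ?h s \<xi>) / (2 * of_real pi))"
      unfolding F_def A_inversion ft_def
      by (simp only: integral_scaleR_right integral_mult_right_zero, intro Bochner_Integration.integral_cong refl)
         (simp add: scaleR_conv_of_real)
    also have "\<dots> = (LINT s|lborel. LINT \<xi>|lborel. ?h s \<xi>) / (2 * of_real pi)"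
      by (rule integral_divide_zero)
    also have "(LINT s|lborel. LINT \<xi>|lborel. ?h s \<xi>) = (LINT \<xi>|lborel. LINT s|lborel. ?h s \<xi>)"
      using lborel_pair.Fubini_integral[OF P2] by simp
    also have "\<dots> = (LINT \<xi>|lborel. cis (u * \<xi>) * (cis (\<xi> * c0 + of_int n * c1) * W w n \<xi> \<theta> *
      (\<i> * of_real \<xi> * (LINT s:{0<..}|lborel. mellin_kernel \<epsilon> (\<beta> \<xi>) \<xi> s))))"
    proof (intro Bochner_Integration.integral_cong refl)
      fix \<xi>
      have "(LINT s|lborel. ?h s \<xi>) = (LINT s|lborel. (cis (u * \<xi>) * (cis (\<xi> * c0 + of_int n * c1) * W w n \<xi> \<theta> * (\<i> * of_real \<xi>))) * (?J s *\<^sub>R mellin_kernel \<epsilon> (\<beta> \<xi>) \<xi> s))"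
      proof (intro Bochner_Integration.integral_cong refl)
        fix s
        \<comment> \<open>The s-dependence of delay and twist is collected in the Mellin phase; the
          time u and the constants factor out.\<close>
        have "cis (of_int n * twist s) * cis ((u + delay s) * \<xi>) = cis (u * \<xi>) * cis (\<xi> * c0 + of_int n * c1) * cis (\<beta> \<xi> * ln s - \<xi> * s)"
          by (simp add: cis_mult delay_def twist_def \<beta>_def algebra_simps)
        then have "?h s \<xi> = ?J s *\<^sub>R (of_real (exp (- (\<epsilon> * s))) * (cis (u * \<xi>) * cis (\<xi> * c0 + of_int n * c1) * cis (\<beta> \<xi> * ln s - \<xi> * s) * ?W \<xi>))"
          by (simp only: mult.assoc[symmetric])
        then show "?h s \<xi> = (cis (u * \<xi>) * (cis (\<xi> * c0 + of_int n * c1) * W w n \<xi> \<theta> * (\<i> * of_real \<xi>))) * (?J s *\<^sub>R mellin_kernel \<epsilon> (\<beta> \<xi>) \<xi> s)"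
          by (simp add: mellin_kernel_def W_True scaleR_conv_of_real mult_ac)
      qed
      also have "\<dots> = (cis (u * \<xi>) * (cis (\<xi> * c0 + of_int n * c1) * W w n \<xi> \<theta> * (\<i> * of_real \<xi>))) * (LINT s:{0<..}|lborel. mellin_kernel \<epsilon> (\<beta> \<xi>) \<xi> s)"
        unfolding set_lebesgue_integral_def by (rule integral_mult_right_zero)
      finally show "(LINT s|lborel. ?h s \<xi>) = cis (u * \<xi>) * (cis (\<xi> * c0 + of_int n * c1) * W w n \<xi> \<theta> *
      (\<i> * of_real \<xi> * (LINT s:{0<..}|lborel. mellin_kernel \<epsilon> (\<beta> \<xi>) \<xi> s)))"
        by (simp only: mult.assoc)
    qed
    finally show ?thesis .
  qed
  let ?M = "\<lambda>\<epsilon> \<xi>. \<i> * of_real \<xi> * (LINT s:{0<..}|lborel. mellin_kernel \<epsilon> (\<beta> \<xi>) \<xi> s)"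
  let ?K = "\<lambda>\<epsilon> \<xi>. cis (u * \<xi>) * (cis (\<xi> * c0 + of_int n * c1) * W w n \<xi> \<theta> * ?M \<epsilon> \<xi>)"
  obtain C where C: "C \<ge> 0" "\<forall>n \<xi> \<theta>. (1 + \<bar>\<xi>\<bar>)\<^sup>2 * (1 + \<bar>real_of_int n\<bar>)\<^sup>2 * cmod (W w n \<xi> \<theta>) \<le> C * (1 / (1 + (real_of_int n)\<^sup>2)) * (1 / (1 + \<xi>\<^sup>2))"
    using W_decay_symbol[of w] by blast
  define D where "D = 1 + 2 * pi * (lam + \<bar>mu\<bar>)"
  have D: "D \<ge> 1" using lam_pos by (simp add: D_def)
  \<comment> \<open>The Mellin bound controls the square linearly in \<beta>. It is relaxed to the
    squared weights, the form that \<open>W_decay_symbol\<close> absorbs.\<close>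
  have MD: "cmod (?M (?e j) \<xi>) \<le> D * ((1 + \<bar>\<xi>\<bar>)\<^sup>2 * (1 + \<bar>real_of_int n\<bar>)\<^sup>2)" for j \<xi>
  proof -
    have one: "1 \<le> (1 + \<bar>\<xi>\<bar>) * (1 + \<bar>real_of_int n\<bar>)" by (simp add: algebra_simps)
    have "(cmod (?M (?e j) \<xi>))\<^sup>2 \<le> 1 + 2 * pi * \<bar>\<beta> \<xi>\<bar>" by (rule mellin_integral_bound[OF e0])
    also have "\<dots> \<le> D * ((1 + \<bar>\<xi>\<bar>) * (1 + \<bar>real_of_int n\<bar>))"
    proof -
      have "D * ((1 + \<bar>\<xi>\<bar>) * (1 + \<bar>real_of_int n\<bar>)) = (1 + \<bar>\<xi>\<bar>) * (1 + \<bar>real_of_int n\<bar>) +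
          2 * pi * ((lam + \<bar>mu\<bar>) * ((1 + \<bar>\<xi>\<bar>) * (1 + \<bar>real_of_int n\<bar>)))"
        by (simp add: D_def algebra_simps)
      moreover have "2 * pi * \<bar>\<beta> \<xi>\<bar> \<le> 2 * pi * ((lam + \<bar>mu\<bar>) * ((1 + \<bar>\<xi>\<bar>) * (1 + \<bar>real_of_int n\<bar>)))"
        unfolding \<beta>_def by (intro mult_left_mono abs_beta_le) auto
      ultimately show ?thesis using one by linarith
    qed
    also have "\<dots> \<le> (D * ((1 + \<bar>\<xi>\<bar>) * (1 + \<bar>real_of_int n\<bar>)))\<^sup>2"
      using mult_mono[OF D one] D by (intro self_le_power) auto
    finally have "cmod (?M (?e j) \<xi>) \<le> D * ((1 + \<bar>\<xi>\<bar>) * (1 + \<bar>real_of_int n\<bar>))"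
      by (rule power2_le_imp_le) (use D in auto)
    also have "\<dots> \<le> D * ((1 + \<bar>\<xi>\<bar>) * (1 + \<bar>real_of_int n\<bar>))\<^sup>2"
      using D one by (intro mult_left_mono self_le_power) auto
    finally show ?thesis by (simp add: power_mult_distrib)
  qed
  have "(\<lambda>j. LINT \<xi>|lborel. ?K (?e j) \<xi>) \<longlonglongrightarrow> (LINT \<xi>|lborel. cis (u * \<xi>) * (scri_mult n \<xi> * W w n \<xi> \<theta>))"
  proof (rule integral_dominated_convergence)
    show "integrable lborel (\<lambda>\<xi>. D * C * (1 / (1 + (real_of_int n)\<^sup>2)) * (1 / (1 + \<xi>\<^sup>2)))"
      by (intro integrable_mult_right integrable_inverse_square_real)
    note scri_mult_measurable [measurable]
    show "(\<lambda>\<xi>. cis (u * \<xi>) * (scri_mult n \<xi> * W w n \<xi> \<theta>)) \<in> borel_measurable lborel"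
      by measurable
    show "?K (?e j) \<in> borel_measurable lborel" for j
    proof -
      have [measurable]: "(\<lambda>p. mellin_kernel \<epsilon> (\<beta> (fst p)) (fst p) (snd p)) \<in> borel_measurable (borel \<Otimes>\<^sub>M lborel)" for \<epsilon>
        unfolding mellin_kernel_def \<beta>_def by measurable
      have "(\<lambda>p. indicator {0<..} (snd p) *\<^sub>R mellin_kernel (?e j) (\<beta> (fst p)) (fst p) (snd p)) \<in> borel_measurable (borel \<Otimes>\<^sub>M lborel)"
        by measurable
      then have [measurable]: "(\<lambda>\<xi>. LINT s:{0<..}|lborel. mellin_kernel (?e j) (\<beta> \<xi>) \<xi> s) \<in> borel_measurable borel"
        unfolding set_lebesgue_integral_def by (intro lborel.borel_measurable_lebesgue_integral) (simp add: case_prod_beta)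
      show ?thesis by measurable
    qed
    show "AE \<xi> in lborel. (\<lambda>j. ?K (?e j) \<xi>) \<longlonglongrightarrow> cis (u * \<xi>) * (scri_mult n \<xi> * W w n \<xi> \<theta>)"
      \<comment> \<open>The limit of the damped integrals is available at nonzero
        frequencies.\<close>
      using AE_lborel_singleton[of 0]
    proof eventually_elim
      case (elim \<xi>)
      have "(\<lambda>j. ?K (?e j) \<xi>) \<longlonglongrightarrow> cis (u * \<xi>) * (cis (\<xi> * c0 + of_int n * c1) * W w n \<xi> \<theta> * mellin_symbol (\<beta> \<xi>) \<xi>)"
        by (intro tendsto_intros mellin_integral_tendsto elim e0 e)
      then show ?case by (simp add: scri_mult_def \<beta>_def mult_ac)
    qed
    show "AE \<xi> in lborel. cmod (?K (?e j) \<xi>) \<le> D * C * (1 / (1 + (real_of_int n)\<^sup>2)) * (1 / (1 + \<xi>\<^sup>2))" for j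
    proof (rule AE_I2)
      fix \<xi>
      have "cmod (?K (?e j) \<xi>) = cmod (W w n \<xi> \<theta>) * cmod (?M (?e j) \<xi>)" by (simp add: norm_mult)
      also have "\<dots> \<le> cmod (W w n \<xi> \<theta>) * (D * ((1 + \<bar>\<xi>\<bar>)\<^sup>2 * (1 + \<bar>real_of_int n\<bar>)\<^sup>2))"
        by (intro mult_left_mono MD) auto
      also have "\<dots> = D * ((1 + \<bar>\<xi>\<bar>)\<^sup>2 * (1 + \<bar>real_of_int n\<bar>)\<^sup>2 * cmod (W w n \<xi> \<theta>))" by simp
      also have "\<dots> \<le> D * (C * (1 / (1 + (real_of_int n)\<^sup>2)) * (1 / (1 + \<xi>\<^sup>2)))"
        using C(2) D by (intro mult_left_mono) auto
      finally show "cmod (?K (?e j) \<xi>) \<le> D * C * (1 / (1 + (real_of_int n)\<^sup>2)) * (1 / (1 + \<xi>\<^sup>2))"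
        by (simp only: mult.assoc)
    qed
  qed
  then have "(\<lambda>j. (LINT \<xi>|lborel. ?K (?e j) \<xi>) / (2 * of_real pi)) \<longlonglongrightarrow> (LINT \<xi>|lborel. cis (u * \<xi>) * (scri_mult n \<xi> * W w n \<xi> \<theta>)) / (2 * of_real pi)"
    by (intro tendsto_intros) auto
  then have "(\<lambda>j. F (?e j)) \<longlonglongrightarrow> ft (\<lambda>\<xi>. scri_mult n \<xi> * W w n \<xi> \<theta>) u / (2 * of_real pi)"
    unfolding ft_def by (simp only: Feq[OF e0])
  then show ?thesis using lim1 LIMSEQ_unique by blast
qed

end

section \<open>Asymptotics of the coordinates\<close>

lemma has_real_derivative_affine_comp:
  assumes "(f has_real_derivative d) (at (b + x / c))" "c \<noteq> 0"
  shows "((\<lambda>x. f (b + x / c)) has_real_derivative d / c) (at x)"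
proof -
  have "((\<lambda>x. b + x / c) has_real_derivative 1 / c) (at x)"
    using assms(2) by (auto intro!: derivative_eq_intros)
  from DERIV_chain[OF assms(1) this] show ?thesis by (simp add: o_def)
qed

lemma DERIV_zero_constant_on:
  fixes f :: "real \<Rightarrow> real"
  assumes "convex A" "\<And>x. x \<in> A \<Longrightarrow> (f has_real_derivative 0) (at x)"
  shows "\<exists>c. \<forall>x\<in>A. f x = c"
  by (rule has_field_derivative_zero_constant[OF assms(1)]) (auto intro: has_field_derivative_at_within assms(2))

text \<open>Subtracting or adding C/X makes \<open>e\<close> nondecreasing or nonincreasing. The
  second function bounds the first from below, so the first converges to its infimum as X ->
  -infinity, where C/X vanishes.\<close>

lemma convergent_at_bot_of_derivative_bound:
  fixes e e' :: "real \<Rightarrow> real"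
  assumes X0: "X0 < 0" and C: "C \<ge> 0"
    and d: "\<And>X. X \<le> X0 \<Longrightarrow> (e has_real_derivative e' X) (at X)"
    and b: "\<And>X. X \<le> X0 \<Longrightarrow> \<bar>e' X\<bar> \<le> C / X\<^sup>2"
  shows "\<exists>c. (e \<longlongrightarrow> c) at_bot"
proof -
  let ?g = "\<lambda>X. e X - C / X" and ?h = "\<lambda>X. e X + C / X"
  have g: "?g X \<le> ?g Y" if "X \<le> Y" "Y \<le> X0" for X Y
  proof (rule DERIV_nonneg_imp_nondecreasing[OF that(1)], intro exI conjI)
    fix x assume "X \<le> x" "x \<le> Y"
    then have "x \<le> X0" using that by simp
    then show "(?g has_real_derivative e' x + C / x\<^sup>2) (at x)"
      using X0 by (auto intro!: derivative_eq_intros d simp: power2_eq_square)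
    show "0 \<le> e' x + C / x\<^sup>2" using b[OF \<open>x \<le> X0\<close>] by linarith
  qed
  have h: "?h Y \<le> ?h X" if "X \<le> Y" "Y \<le> X0" for X Y
  proof (rule DERIV_nonpos_imp_nonincreasing[OF that(1)], intro exI conjI)
    fix x assume "X \<le> x" "x \<le> Y"
    then have "x \<le> X0" using that by simp
    then show "(?h has_real_derivative e' x - C / x\<^sup>2) (at x)"
      using X0 by (auto intro!: derivative_eq_intros d simp: power2_eq_square)
    show "e' x - C / x\<^sup>2 \<le> 0" using b[OF \<open>x \<le> X0\<close>] by linarith
  qed
  have low: "?h X0 \<le> ?g X" if "X \<le> X0" for X
  proof -
    have "C / X \<le> 0" using that X0 C by (simp add: divide_nonneg_neg)
    then show ?thesis using h[OF that] by simp
  qed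
  define L where "L = Inf (?g ` {..X0})"
  have bdd: "bdd_below (?g ` {..X0})" using low by (intro bdd_belowI[of _ "?h X0"]) auto
  have Lle: "L \<le> ?g X" if "X \<le> X0" for X unfolding L_def using that bdd by (intro cInf_lower) auto
  have "(?g \<longlongrightarrow> L) at_bot"
  proof (rule tendstoI)
    fix r :: real assume r: "r > 0"
    have "\<exists>z\<in>?g ` {..X0}. z < L + r"
      using cInf_lessD[of "?g ` {..X0}" "L + r"] r by (auto simp: L_def)
    then obtain Y where Y: "Y \<le> X0" "?g Y < L + r" by auto
    show "\<forall>\<^sub>F X in at_bot. dist (?g X) L < r"
      using eventually_le_at_bot[of Y]
    proof eventually_elim
      case (elim X)
      then show ?case using g[OF elim Y(1)] Y Lle[of X] by (auto simp: dist_real_def)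
    qed
  qed
  moreover have "((\<lambda>X. C / X) \<longlongrightarrow> 0) at_bot" by real_asymp
  ultimately have "((\<lambda>X. ?g X + C / X) \<longlongrightarrow> L + 0) at_bot" by (rule tendsto_add)
  then show ?thesis by auto
qed

section \<open>Expansions of the Kerr coordinates at the horizon and of the transformed ones at X =
  -infinity\<close>

lemma DERIV_ln_shift: "x - c > 0 \<Longrightarrow> ((\<lambda>x. ln (x - c)) has_real_derivative 1 / (x - c)) (at x)"
  by (auto intro!: derivative_eq_intros)

lemma DERIV_ln_minus: "x < 0 \<Longrightarrow> ((\<lambda>x. ln (- x)) has_real_derivative 1 / x) (at x)"
  using DERIV_ln_divide[of "- x"] DERIV_mirror[of ln "1 / (- x)" x] by simp

locale subextremal =
  fixes m a :: real
  assumes m_pos: "m > 0" and a_lt: "\<bar>a\<bar> < m"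
begin

text \<open>Half the separation of the horizons, r_+ = m + kp and r_- = m - kp; it is the
  denominator in the partial fractions below.\<close>

definition kp :: real where "kp = sqrt (m\<^sup>2 - a\<^sup>2)"

abbreviation "rp \<equiv> rplus m a"
abbreviation "rm \<equiv> rminus m a"
abbreviation "lam \<equiv> lambda_plus m a"
abbreviation "mu \<equiv> lambda_plus m a * omega_plus m a"

lemma a2: "a\<^sup>2 < m\<^sup>2"
  using power_strict_mono[OF a_lt, of 2] by simp

lemma kp_pos: "kp > 0" using a2 by (simp add: kp_def)

lemma kp_sq: "kp\<^sup>2 = m\<^sup>2 - a\<^sup>2" using a2 by (simp add: kp_def)

lemma rp_eq: "rp = m + kp" and rm_eq: "rm = m - kp" by (simp_all add: rplus_def rminus_def kp_def)

lemma rp_pos: "rp > 0" using m_pos kp_pos by (simp add: rp_eq)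

lemma lam_eq: "lam = 2 * m * rp / kp" using kp_pos by (simp add: lambda_plus_def rp_eq rm_eq field_simps)

lemma lam_pos: "lam > 0" using m_pos rp_pos kp_pos by (simp add: lam_eq)

lemma mu_eq: "mu = a / kp"
  using m_pos rp_pos kp_pos by (simp add: lam_eq omega_plus_def field_simps)

lemma Delta_eq: "Delta m a r = (r - rp) * (r - rm)"
  using kp_sq by (simp add: Delta_def rp_eq rm_eq power2_eq_square algebra_simps)

text \<open>Partial fractions isolate the logarithm at r_+. The remainder, with the logarithm at r_-
  and the constant of integration, is continuous up to the horizon. The factor 2 is that of v = u +
  2 r_*.\<close>

lemma kerr_star_expansion:
  assumes ks: "kerr_star m a rstar phistar"
  shows "\<exists>\<rho> \<sigma>. continuous_on {rp..} \<rho> \<and> continuous_on {rp..} \<sigma> \<and>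
    (\<forall>r>rp. 2 * rstar r = lam * ln (r - rp) + \<rho> r \<and> 2 * phistar r = mu * ln (r - rp) + \<sigma> r)"
proof -
  have d1: "((\<lambda>r. 2 * rstar r - (lam * ln (r - rp) + (2 * r - 2 * m * rm / kp * ln (r - rm)))) has_real_derivative 0) (at r)" if r: "r > rp" for r
  proof -
    have pos: "r - rp > 0" "r - rm > 0" using r kp_pos by (auto simp: rp_eq rm_eq)
    have "((\<lambda>r. 2 * rstar r - (lam * ln (r - rp) + (2 * r - 2 * m * rm / kp * ln (r - rm)))) has_real_derivative
       2 * ((r\<^sup>2 + a\<^sup>2) / Delta m a r) - (lam * (1 / (r - rp)) + (2 * 1 - 2 * m * rm / kp * (1 / (r - rm))))) (at r)"
      using ks r pos unfolding kerr_star_def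
      by (intro DERIV_diff DERIV_add DERIV_cmult DERIV_ident DERIV_ln_shift) auto
    moreover have "2 * ((r\<^sup>2 + a\<^sup>2) / Delta m a r) - (lam * (1 / (r - rp)) + (2 * 1 - 2 * m * rm / kp * (1 / (r - rm)))) = 0"
    proof -
      \<comment> \<open>Delta + 2mr: the first term integrates to the linear part, the second is
        decomposed into simple poles.\<close>
      have n: "r\<^sup>2 + a\<^sup>2 = (r - rp) * (r - rm) + 2 * m * r"
        using Delta_eq[of r] by (simp add: Delta_def)
      have "(rp * (r - rm) - rm * (r - rp)) / kp = 2 * r"
        using kp_pos by (simp add: rp_eq rm_eq field_simps)
      moreover have "2 * m * rp / kp * (r - rm) - 2 * m * rm / kp * (r - rp) = 2 * m * ((rp * (r - rm) - rm * (r - rp)) / kp)"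
        using kp_pos by (simp add: field_simps)
      ultimately have "2 * m * rp / kp * (r - rm) - 2 * m * rm / kp * (r - rp) = 4 * m * r" by simp
      then have "(2 * m * rp / kp * (r - rm) - 2 * m * rm / kp * (r - rp)) / ((r - rp) * (r - rm)) = 4 * m * r / ((r - rp) * (r - rm))"
        by (simp only:)
      then have "2 * m * rp / kp * (1 / (r - rp)) - 2 * m * rm / kp * (1 / (r - rm)) = 4 * m * r / ((r - rp) * (r - rm))"
        using pos by (simp add: diff_divide_distrib)
      then show ?thesis
        unfolding Delta_eq n lam_eq using pos by (simp add: add_divide_distrib)
    qed
    ultimately show ?thesis by simp
  qed
  obtain c where c: "\<forall>r\<in>{rp<..}. 2 * rstar r - (lam * ln (r - rp) + (2 * r - 2 * m * rm / kp * ln (r - rm))) = c"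
    using DERIV_zero_constant_on[OF convex_real_interval(3), OF d1] by auto
  have d2: "((\<lambda>r. 2 * phistar r - (mu * ln (r - rp) - mu * ln (r - rm))) has_real_derivative 0) (at r)" if r: "r > rp" for r
  proof -
    have pos: "r - rp > 0" "r - rm > 0" using r kp_pos by (auto simp: rp_eq rm_eq)
    have "((\<lambda>r. 2 * phistar r - (mu * ln (r - rp) - mu * ln (r - rm))) has_real_derivative
       2 * (a / Delta m a r) - (mu * (1 / (r - rp)) - mu * (1 / (r - rm)))) (at r)"
      using ks r pos unfolding kerr_star_def
      by (intro DERIV_diff DERIV_add DERIV_cmult DERIV_ident DERIV_ln_shift) auto
    moreover have "2 * (a / Delta m a r) - (mu * (1 / (r - rp)) - mu * (1 / (r - rm))) = 0"
    proof -
      have "mu * (r - rm) - mu * (r - rp) = 2 * a"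
        using kp_pos unfolding mu_eq by (simp add: rp_eq rm_eq field_simps)
      then have "(mu * (r - rm) - mu * (r - rp)) / ((r - rp) * (r - rm)) = 2 * a / ((r - rp) * (r - rm))"
        by (simp only:)
      then have "mu * (1 / (r - rp)) - mu * (1 / (r - rm)) = 2 * a / ((r - rp) * (r - rm))"
        using pos by (simp add: diff_divide_distrib)
      then show ?thesis unfolding Delta_eq by simp
    qed
    ultimately show ?thesis by simp
  qed
  obtain c' where c': "\<forall>r\<in>{rp<..}. 2 * phistar r - (mu * ln (r - rp) - mu * ln (r - rm)) = c'"
    using DERIV_zero_constant_on[OF convex_real_interval(3), OF d2] by auto
  have pos: "r - rm > 0" if "r \<ge> rp" for r using that kp_pos by (auto simp: rp_eq rm_eq)
  have "continuous_on {rp..} (\<lambda>r. 2 * r - 2 * m * rm / kp * ln (r - rm) + c)" "continuous_on {rp..} (\<lambda>r. - mu * ln (r - rm) + c')"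
    using pos[of rp] pos kp_pos by (auto intro!: continuous_intros dest: pos)
  then show ?thesis
    by (intro exI[of _ "\<lambda>r. 2 * r - 2 * m * rm / kp * ln (r - rm) + c"] exI[of _ "\<lambda>r. - mu * ln (r - rm) + c'"])
       (use c c' in \<open>auto simp: algebra_simps\<close>)
qed

text \<open>The comparison function consists of the first two terms of the root as X -> -infinity.
  Its square differs from the radicand by a constant, so the error is that constant divided by the
  sum of root and comparison function, and this sum is at least kp |X|.\<close>

lemma sqrt_expansion:
  assumes X: "X \<le> - 4"
  shows "\<bar>sqrt ((m\<^sup>2 - a\<^sup>2) * X\<^sup>2 - 4 * a\<^sup>2 * X - 4 * a\<^sup>2) - (- kp * X + 2 * a\<^sup>2 / kp)\<bar> \<le> (4 * a\<^sup>2 + 4 * (a\<^sup>2)\<^sup>2 / kp\<^sup>2) / kp / (- X)"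
proof -
  let ?Q = "(m\<^sup>2 - a\<^sup>2) * X\<^sup>2 - 4 * a\<^sup>2 * X - 4 * a\<^sup>2" and ?l = "- kp * X + 2 * a\<^sup>2 / kp"
  let ?N = "4 * a\<^sup>2 + 4 * (a\<^sup>2)\<^sup>2 / kp\<^sup>2"
  have "?Q = (m\<^sup>2 - a\<^sup>2) * X\<^sup>2 + 4 * a\<^sup>2 * (- X - 1)" by (simp add: right_diff_distrib)
  moreover have "(m\<^sup>2 - a\<^sup>2) * X\<^sup>2 \<ge> 0" using a2 by (intro mult_nonneg_nonneg) auto
  moreover have "4 * a\<^sup>2 * (- X - 1) \<ge> 0" using X by (intro mult_nonneg_nonneg) auto
  ultimately have Q: "?Q \<ge> 0" by linarith
  have kX: "- kp * X > 0" using kp_pos X by (simp add: mult_pos_neg)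
  have l: "?l \<ge> - kp * X" using kp_pos by simp
  have den: "sqrt ?Q + ?l \<ge> - kp * X" using l real_sqrt_ge_zero[OF Q] by linarith
  define b where "b = 2 * a\<^sup>2 / kp"
  have b: "kp * b = 2 * a\<^sup>2" "b\<^sup>2 = 4 * (a\<^sup>2)\<^sup>2 / kp\<^sup>2"
    using kp_pos by (simp_all add: b_def power_divide power_mult_distrib)
  have "(- kp * X + b)\<^sup>2 = kp\<^sup>2 * X\<^sup>2 - 2 * (kp * b) * X + b\<^sup>2"
    by (simp add: power2_eq_square algebra_simps)
  then have l2: "?l\<^sup>2 = (m\<^sup>2 - a\<^sup>2) * X\<^sup>2 - 4 * a\<^sup>2 * X + 4 * (a\<^sup>2)\<^sup>2 / kp\<^sup>2"
    unfolding b kp_sq unfolding b_def by simp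
  define s l N where "s = sqrt ?Q" and "l = ?l" and "N = ?N"
  have s2: "s\<^sup>2 - l\<^sup>2 = - N" unfolding s_def l_def N_def l2 using Q by simp
  have N0: "N \<ge> 0" unfolding N_def by (intro add_nonneg_nonneg divide_nonneg_nonneg) auto
  have sl: "s + l > 0" "- kp * X \<le> s + l" using den kX unfolding s_def l_def by linarith+
  have "(s - l) * (s + l) = - N" using s2 by (simp add: power2_eq_square algebra_simps)
  then have "\<bar>s - l\<bar> * (s + l) = N" using abs_mult[of "s - l" "s + l"] abs_of_pos[OF sl(1)] abs_of_nonneg[OF N0] by simp
  then have e: "\<bar>s - l\<bar> = N / (s + l)" using sl(1) by (simp add: eq_divide_eq)
  have "N / (s + l) \<le> N / (- kp * X)"
    by (rule divide_left_mono[OF sl(2) N0 mult_pos_pos[OF sl(1) kX]])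
  then have "\<bar>s - l\<bar> \<le> N / kp / (- X)" unfolding e by simp
  then show ?thesis by (simp only: s_def l_def N_def)
qed

text \<open>In the variable X the chain rule cancels the factor S. The constant terms of the
  derivatives add up to (R - m) - kp = R - r_+, the coefficients of 1/X to 2m + 2m^2/kp = lam, and
  the rest is of order 1/X^2, hence integrable.\<close>

lemma transformed_coords_expansion:
  assumes tc: "transformed_coords m a S R Rt rst q p" and S: "S < 0"
  shows "\<exists>c. ((\<lambda>X. rst (Rt + X / S) + q (Rt + X / S) - ((R - rp) * X + lam * ln (- X))) \<longlongrightarrow> c) at_bot"
    and "\<exists>c. \<forall>X< -2. p (Rt + X / S) = mu * ln (- X) + c"
proof -
  have S0: "S \<noteq> 0" using S by simp
  let ?Q = "\<lambda>X. (m\<^sup>2 - a\<^sup>2) * X\<^sup>2 - 4 * a\<^sup>2 * X - 4 * a\<^sup>2"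
  have D: "((\<lambda>X. rst (Rt + X / S)) has_real_derivative ((R - m) * X + 2 * R) / (X + 2)) (at X)"
      "((\<lambda>X. q (Rt + X / S)) has_real_derivative sqrt (?Q X) / (X + 2)) (at X)"
      "((\<lambda>X. p (Rt + X / S)) has_real_derivative mu / X) (at X)" if X: "X < - 2" for X
  proof -
    have SX: "S * ((Rt + X / S) - Rt) = X" using S0 by simp
    have den: "((Rt + X / S) - Rt + 2 / S) * S = X + 2" using S0 by (simp add: field_simps)
    note T = tc[unfolded transformed_coords_def Let_def, rule_format, of "Rt + X / S", unfolded SX, OF X]
    show "((\<lambda>X. rst (Rt + X / S)) has_real_derivative ((R - m) * X + 2 * R) / (X + 2)) (at X)"
      using has_real_derivative_affine_comp[OF conjunct1[OF T] S0] by (simp only: divide_divide_eq_left den)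
    show "((\<lambda>X. q (Rt + X / S)) has_real_derivative sqrt (?Q X) / (X + 2)) (at X)"
      using has_real_derivative_affine_comp[OF conjunct1[OF conjunct2[OF T]] S0] by (simp only: divide_divide_eq_left den)
    have "mu / X = a / sqrt (m\<^sup>2 - a\<^sup>2) * (1 / (Rt + X / S - Rt)) / S"
      using S0 by (simp add: mu_eq kp_def)
    then show "((\<lambda>X. p (Rt + X / S)) has_real_derivative mu / X) (at X)"
      using has_real_derivative_affine_comp[OF conjunct2[OF conjunct2[OF T]] S0] by (simp only:)
  qed
  let ?e = "\<lambda>X. rst (Rt + X / S) + q (Rt + X / S) - ((R - rp) * X + lam * ln (- X))"
  let ?e' = "\<lambda>X. ((R - m) * X + 2 * R) / (X + 2) + sqrt (?Q X) / (X + 2) - ((R - rp) + lam / X)"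
  define N where "N = (4 * a\<^sup>2 + 4 * (a\<^sup>2)\<^sup>2 / kp\<^sup>2) / kp"
  have N0: "N \<ge> 0" unfolding N_def using kp_pos by (intro divide_nonneg_pos add_nonneg_nonneg) auto
  show "\<exists>c. (?e \<longlongrightarrow> c) at_bot"
  proof (rule convergent_at_bot_of_derivative_bound[of "-4" "4 * lam + 2 * N" ?e ?e'])
    show "4 * lam + 2 * N \<ge> 0" using lam_pos N0 by simp
  next
    fix X :: real assume X: "X \<le> - 4"
    have X2: "X < -2" "X < 0" using X by auto
    have "(?e has_real_derivative ((R - m) * X + 2 * R) / (X + 2) + sqrt (?Q X) / (X + 2) - ((R - rp) * 1 + lam * (1 / X))) (at X)"
      by (intro DERIV_diff DERIV_add DERIV_cmult DERIV_ident D[OF X2(1)] DERIV_ln_minus X2(2))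
    then show "(?e has_real_derivative ?e' X) (at X)" by (simp only: mult_1_right times_divide_eq_right)
    define \<delta> where "\<delta> = sqrt (?Q X) - (- kp * X + 2 * a\<^sup>2 / kp)"
    have \<delta>: "\<bar>\<delta>\<bar> \<le> N / (- X)" unfolding \<delta>_def N_def by (rule sqrt_expansion[OF X])
    have nz: "X + 2 \<noteq> 0" "X \<noteq> 0" using X by auto
    \<comment> \<open>Replacing 1/(X + 2) by 1/X costs -2/(X (X + 2)); the error of the root divided
      by X + 2 is of the same order.\<close>
    have "?e' X = lam * (- 2 / (X * (X + 2))) + \<delta> / (X + 2)"
    proof -
      have s: "sqrt (?Q X) = - kp * X + 2 * a\<^sup>2 / kp + \<delta>" by (simp add: \<delta>_def)
      have i: "1 / (X + 2) - 1 / X = - 2 / (X * (X + 2))" using nz by (simp add: field_simps)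
      have r1: "((R - m) * X + 2 * R) / (X + 2) = (R - m) + 2 * m * (1 / (X + 2))"
        using nz by (simp add: field_simps)
      have "2 * a\<^sup>2 / kp + 2 * kp = 2 * m\<^sup>2 / kp"
        using kp_pos kp_sq by (simp add: field_simps power2_eq_square)
      moreover have "- kp * X + 2 * a\<^sup>2 / kp = - kp * (X + 2) + (2 * a\<^sup>2 / kp + 2 * kp)" by (simp add: algebra_simps)
      ultimately have "- kp * X + 2 * a\<^sup>2 / kp = - kp * (X + 2) + 2 * m\<^sup>2 / kp" by simp
      then have r2: "sqrt (?Q X) / (X + 2) = - kp + 2 * m\<^sup>2 / kp * (1 / (X + 2)) + \<delta> / (X + 2)"
        unfolding s using nz by (simp add: add_divide_distrib diff_divide_distrib)
      have l: "lam = 2 * m + 2 * m\<^sup>2 / kp" using kp_pos by (simp add: lam_eq rp_eq field_simps power2_eq_square)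
      define \<alpha> \<beta> k2 d where "\<alpha> = 1 / (X + 2)" and "\<beta> = 1 / X" and "k2 = 2 * m\<^sup>2 / kp" and "d = \<delta> / (X + 2)"
      have "lam / X = lam * \<beta>" by (simp add: \<beta>_def)
      then have "?e' X = (R - m) + 2 * m * \<alpha> + (- kp + k2 * \<alpha> + d) - ((R - (m + kp)) + (2 * m + k2) * \<beta>)"
        unfolding r1 r2 rp_eq l \<alpha>_def k2_def d_def by (simp only:)
      also have "\<dots> = (2 * m + k2) * (\<alpha> - \<beta>) + d" by (simp add: algebra_simps)
      finally have "?e' X = lam * (1 / (X + 2) - 1 / X) + \<delta> / (X + 2)"
        by (simp only: l \<alpha>_def \<beta>_def k2_def d_def)
      then show ?thesis unfolding i .
    qed
    also have "\<bar>\<dots>\<bar> \<le> \<bar>lam * (- 2 / (X * (X + 2)))\<bar> + \<bar>\<delta> / (X + 2)\<bar>" by (rule abs_triangle_ineq)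
    also have "\<dots> \<le> 4 * lam / X\<^sup>2 + 2 * N / X\<^sup>2"
    proof (rule add_mono)
      \<comment> \<open>For X \<le> -4 one has |X + 2| \<ge> |X|/2.\<close>
      have h: "1 / \<bar>X + 2\<bar> \<le> 2 / (- X)" using X by (simp add: field_simps)
      have "\<bar>lam * (- 2 / (X * (X + 2)))\<bar> = 2 * lam / (- X) * (1 / \<bar>X + 2\<bar>)"
        using lam_pos X by (simp add: abs_mult abs_divide)
      also have "\<dots> \<le> 2 * lam / (- X) * (2 / (- X))"
        using lam_pos X by (intro mult_left_mono[OF h] divide_nonneg_pos) auto
      also have "\<dots> = 4 * lam / X\<^sup>2" by (simp add: power2_eq_square)
      finally show "\<bar>lam * (- 2 / (X * (X + 2)))\<bar> \<le> 4 * lam / X\<^sup>2" .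
      have "\<bar>\<delta> / (X + 2)\<bar> = \<bar>\<delta>\<bar> * (1 / \<bar>X + 2\<bar>)" by (simp add: abs_divide)
      also have "\<dots> \<le> N / (- X) * (2 / (- X))"
        using \<delta> h N0 X by (intro mult_mono) auto
      also have "\<dots> = 2 * N / X\<^sup>2" by (simp add: power2_eq_square)
      finally show "\<bar>\<delta> / (X + 2)\<bar> \<le> 2 * N / X\<^sup>2" .
    qed
    finally show "\<bar>?e' X\<bar> \<le> (4 * lam + 2 * N) / X\<^sup>2" by (simp add: add_divide_distrib)
  qed simp
  have "((\<lambda>X. p (Rt + X / S) - mu * ln (- X)) has_real_derivative 0) (at X)" if "X \<in> {..< -2}" for X
  proof -
    have X: "X < - 2" using that by simp
    have "((\<lambda>X. ln (- X)) has_real_derivative 1 / X) (at X)"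
      using X by (intro DERIV_ln_minus) simp
    then have "((\<lambda>X. p (Rt + X / S) - mu * ln (- X)) has_real_derivative mu / X - mu * (1 / X)) (at X)"
      by (intro DERIV_diff D(3)[OF X] DERIV_cmult)
    then show ?thesis by simp
  qed
  from DERIV_zero_constant_on[OF convex_real_interval(4), OF this]
  obtain c where "\<forall>X\<in>{..< -2}. p (Rt + X / S) - mu * ln (- X) = c" by auto
  then show "\<exists>c. \<forall>X< -2. p (Rt + X / S) = mu * ln (- X) + c"
    by (intro exI[of _ c]) (auto simp: algebra_simps)
qed

end

context subextremal
begin

section \<open>The radiation field as an average over the horizon\<close>

lemma psi_continuous:
  assumes "acceptable m a h psi"
  shows "continuous_on (exterior m a) psi"
proof -
  obtain U F where U': "open U" "exterior m a \<subseteq> U" "\<forall>k. Ck k U F" "\<forall>x\<in>exterior m a. F x = psi x"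
    using conjunct1[OF assms[unfolded acceptable_def]] unfolding smooth_upto_def by (elim exE conjE)
  have "continuous_on U F" using U'(3)[rule_format, of 0] by simp
  then have "continuous_on (exterior m a) F" using U'(2) by (rule continuous_on_subset)
  then show ?thesis by (rule continuous_on_eq) (use U'(4) in blast)
qed

lemma psi_bounded_support:
  assumes t: "kerr_time m a rstar h" and acc: "acceptable m a h psi"
  shows "\<exists>V r1 B. V > 0 \<and> r1 > rp \<and> B \<ge> 0 \<and> (\<forall>v r \<omega>. rp \<le> r \<longrightarrow> \<omega> \<in> sphere 0 1 \<longrightarrow>
     cmod (psi (v, r, \<omega>)) \<le> B \<and> (psi (v, r, \<omega>) \<noteq> 0 \<longrightarrow> \<bar>v\<bar> \<le> V \<and> r \<le> r1))"
proof -
  obtain V r1 where V: "V > 0" "r1 > rp"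
    "\<And>v r \<omega>. r \<ge> rp \<Longrightarrow> \<omega> \<in> sphere 0 1 \<Longrightarrow> psi (v, r, \<omega>) \<noteq> 0 \<Longrightarrow> \<bar>v\<bar> \<le> V \<and> r \<le> r1"
    using acceptable_support[OF t acc] by metis
  let ?K = "{-V..V} \<times> {rp..r1} \<times> sphere (0::real^3) 1"
  have "?K \<subseteq> exterior m a" by (auto simp: exterior_def)
  then have "compact (psi ` ?K)"
    by (intro compact_continuous_image continuous_on_subset[OF psi_continuous[OF acc]] compact_Times) auto
  then have "bounded (psi ` ?K)" by (rule compact_imp_bounded)
  then obtain B where B: "\<forall>z\<in>?K. cmod (psi z) \<le> B" unfolding bounded_iff by blast
  have "cmod (psi (v, r, \<omega>)) \<le> max B 0" if "rp \<le> r" "\<omega> \<in> sphere 0 1" for v r \<omega>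
  proof (cases "psi (v, r, \<omega>) = 0")
    case False
    then have "(v, r, \<omega>) \<in> ?K" using V(3)[OF that False] that by auto
    then have "cmod (psi (v, r, \<omega>)) \<le> B" using B by blast
    then show ?thesis by simp
  qed simp
  then show ?thesis using V by (intro exI[of _ V] exI[of _ r1] exI[of _ "max B 0"]) auto
qed

text \<open>In the variable \<open>s = \<bar>X\<bar> (r - r\<^sub>+)\<close> the diverging parts of the phase cancel, and as
  \<open>X \<rightarrow> -\<infinity>\<close> only the restriction of \<open>\<psi>\<close> to the horizon survives.\<close>

lemma radiation_field_formula:
  assumes S: "S < 0" and ks: "kerr_star m a rstar phistar" and kt: "kerr_time m a rstar h"
    and acc: "acceptable m a h psi"
    and tc: "transformed_coords m a S R Rt rst q p"
    and rf: "radiation_field S Rt rst q p (whiting m a S R Rt rstar phistar psi) psinf"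
  shows "\<exists>c0 c1. \<forall>u \<theta> \<phi>. 0 \<le> \<theta> \<and> \<theta> \<le> pi \<longrightarrow> psinf (u, sph \<theta> \<phi>) =
    (LINT s:{0<..}|lborel. horizon_field m a psi (u + (- s + lam * ln s + c0), \<theta>, \<phi> + (mu * ln s + c1)))"
proof -
  obtain \<rho> \<sigma> where rs: "continuous_on {rp..} \<rho>" "continuous_on {rp..} \<sigma>"
    "\<forall>r>rp. 2 * rstar r = lam * ln (r - rp) + \<rho> r \<and> 2 * phistar r = mu * ln (r - rp) + \<sigma> r"
    using kerr_star_expansion[OF ks] by blast
  obtain ce where ce: "((\<lambda>X. rst (Rt + X / S) + q (Rt + X / S) - ((R - rp) * X + lam * ln (- X))) \<longlongrightarrow> ce) at_bot"
    using transformed_coords_expansion(1)[OF tc S] by blast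
  obtain cp where cp: "\<forall>X< -2. p (Rt + X / S) = mu * ln (- X) + cp"
    using transformed_coords_expansion(2)[OF tc S] by blast
  \<comment> \<open>With Y = -X, the part of the shift in retarded time that stays bounded; its
    limit enters \<open>c0\<close>.\<close>
  define \<epsilon> where "\<epsilon> Y = rst (Rt - Y / S) + q (Rt - Y / S) - ((R - rp) * (- Y) + lam * ln Y)" for Y
  have \<epsilon>: "(\<epsilon> \<longlongrightarrow> ce) at_top"
    using ce unfolding filterlim_at_bot_mirror \<epsilon>_def by simp
  obtain V r1 B where V: "V > 0" "r1 > rp" "B \<ge> 0" "\<forall>v r \<omega>. rp \<le> r \<longrightarrow> \<omega> \<in> sphere 0 1 \<longrightarrow>
     cmod (psi (v, r, \<omega>)) \<le> B \<and> (psi (v, r, \<omega>) \<noteq> 0 \<longrightarrow> \<bar>v\<bar> \<le> V \<and> r \<le> r1)"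
    using psi_bounded_support[OF kt acc] by blast
  have "compact (\<rho> ` {rp..r1})"
    by (intro compact_continuous_image continuous_on_subset[OF rs(1)]) auto
  then have "bounded (\<rho> ` {rp..r1})" by (rule compact_imp_bounded)
  then obtain K where K: "\<forall>r\<in>{rp..r1}. \<bar>\<rho> r\<bar> \<le> K" unfolding bounded_iff by auto
  define c0 where "c0 = ce + \<rho> rp"
  define c1 where "c1 = cp + \<sigma> rp"
  have S0: "S \<noteq> 0" using S by simp
  have "psinf (u, sph \<theta> \<phi>) = (LINT s:{0<..}|lborel. horizon_field m a psi (u + (- s + lam * ln s + c0), \<theta>, \<phi> + (mu * ln s + c1)))"
    if th: "0 \<le> \<theta> \<and> \<theta> \<le> pi" for u \<theta> \<phi>
  proof -
    define r where "r Y s = rp + s / Y" for Y s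
    define E where "E Y s = u + \<epsilon> Y - s + lam * ln s + \<rho> (r Y s)" for Y s
    define \<Phi> where "\<Phi> Y s = \<phi> + mu * ln s + cp + \<sigma> (r Y s)" for Y s
    define f where "f Y s = psi (E Y s, r Y s, sph \<theta> (\<Phi> Y s))" for Y s
    define g where "g s = horizon_field m a psi (u + (- s + lam * ln s + c0), \<theta>, \<phi> + (mu * ln s + c1))" for s
    let ?wh = "\<lambda>X. of_real \<bar>X + 1\<bar> * whiting m a S R Rt rstar phistar psi (u + rst (Rt + X / S) + q (Rt + X / S)) (Rt + X / S) \<theta> (\<phi> + p (Rt + X / S))"
    have "(?wh \<longlongrightarrow> psinf (u, sph \<theta> \<phi>)) at_bot"
      using rf th unfolding radiation_field_def Let_def by blast
    then have lim1: "((\<lambda>Y. ?wh (- Y)) \<longlongrightarrow> psinf (u, sph \<theta> \<phi>)) at_top"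
      unfolding filterlim_at_bot_mirror .
    \<comment> \<open>Substitution r = r_+ + s/Y. Its Jacobian 1/Y meets the factor |X + 1| = Y - 1,
      so the prefactor tends to 1.\<close>
    have whY: "?wh (- Y) = of_real ((Y - 1) / Y) * (LINT s|lborel. indicator {0<..} s *\<^sub>R f Y s)" if Y: "Y > 2" for Y
    proof -
      let ?o = "\<lambda>x. psi (u + rst (Rt - Y / S) + q (Rt - Y / S) + S * (Rt - Y / S - Rt) * (x - R) + 2 * rstar x, x, sph \<theta> (\<phi> + p (Rt - Y / S) + 2 * phistar x))"
      have SY: "S * (Rt - Y / S - Rt) = - Y" using S0 by simp
      have "whiting m a S R Rt rstar phistar psi (u + rst (Rt - Y / S) + q (Rt - Y / S)) (Rt - Y / S) \<theta> (\<phi> + p (Rt - Y / S))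
         = (LINT x|lborel. indicator {rp<..} x *\<^sub>R ?o x)"
        by (simp add: whiting_def outgoing_def set_lebesgue_integral_def)
      also have "\<dots> = \<bar>1 / Y\<bar> *\<^sub>R (LINT s|lborel. indicator {rp<..} (rp + (1 / Y) * s) *\<^sub>R ?o (rp + (1 / Y) * s))"
        using Y by (intro lborel_integral_real_affine) auto
      also have "(LINT s|lborel. indicator {rp<..} (rp + (1 / Y) * s) *\<^sub>R ?o (rp + (1 / Y) * s)) = (LINT s|lborel. indicator {0<..} s *\<^sub>R f Y s)"
      proof (intro Bochner_Integration.integral_cong refl)
        fix s
        show "indicator {rp<..} (rp + (1 / Y) * s) *\<^sub>R ?o (rp + (1 / Y) * s) = indicator {0<..} s *\<^sub>R f Y s"
        proof (cases "s > 0")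
          case False
          then have "\<not> (1 / Y) * s > 0" using Y by (simp add: zero_less_divide_iff)
          then show ?thesis using False by (simp add: indicator_def)
        next
          case True
          have rY: "rp + (1 / Y) * s = r Y s" by (simp add: r_def)
          have gt: "r Y s > rp" using True Y by (simp add: r_def)
          have rr: "2 * rstar (r Y s) = lam * ln (r Y s - rp) + \<rho> (r Y s)" "2 * phistar (r Y s) = mu * ln (r Y s - rp) + \<sigma> (r Y s)"
            using rs(3)[rule_format, OF gt] by auto
          have lnY: "ln (r Y s - rp) = ln s - ln Y" using True Y by (simp add: r_def ln_div)
          have pY: "p (Rt - Y / S) = mu * ln Y + cp" using cp[rule_format, of "- Y"] Y by simp
          \<comment> \<open>The terms linear in Y cancel between the phase of the transform and the
            transformed coordinates, and ln Y cancels between the latter and the tortoise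
            coordinate.\<close>
          have "u + rst (Rt - Y / S) + q (Rt - Y / S) + S * (Rt - Y / S - Rt) * (r Y s - R) + 2 * rstar (r Y s) = E Y s"
          proof -
            have "Y * r Y s = Y * rp + s" using Y by (simp add: r_def distrib_left)
            then have "- Y * (r Y s - R) = - (Y * rp) - s + Y * R" by (simp add: algebra_simps)
            moreover have "rst (Rt - Y / S) + q (Rt - Y / S) = \<epsilon> Y + ((R - rp) * (- Y) + lam * ln Y)" by (simp add: \<epsilon>_def)
            ultimately show ?thesis unfolding SY rr lnY E_def by (simp add: algebra_simps)
          qed
          moreover have "\<phi> + p (Rt - Y / S) + 2 * phistar (r Y s) = \<Phi> Y s"
            unfolding rr lnY pY \<Phi>_def by (simp add: algebra_simps)
          ultimately have "?o (r Y s) = f Y s" unfolding f_def by (simp only:)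
          then show ?thesis using True gt unfolding rY by simp
        qed
      qed
      finally show ?thesis using Y by (simp add: scaleR_conv_of_real)
    qed
    have cont_r: "continuous_on {0<..} (r Y)" if "Y > 0" for Y
      using that unfolding r_def by (intro continuous_intros) auto
    have r_ge: "r Y s \<in> {rp..}" if "s > 0" "Y > 0" for Y s using that by (simp add: r_def)
    have f_cont: "continuous_on {0<..} (f Y)" if Y: "Y > 0" for Y
    proof -
      have "continuous_on {0<..} (\<lambda>s. \<rho> (r Y s))" "continuous_on {0<..} (\<lambda>s. \<sigma> (r Y s))"
        using r_ge Y by (auto intro!: continuous_on_compose2[OF rs(1) cont_r[OF Y]] continuous_on_compose2[OF rs(2) cont_r[OF Y]])
      then show ?thesis
        unfolding f_def
        by (intro continuous_on_compose2[OF psi_continuous[OF acc]])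
           (use r_ge Y sph_in_sphere cont_r[OF Y] in \<open>auto simp: E_def \<Phi>_def exterior_def intro!: continuous_intros\<close>)
    qed
    have g_cont: "continuous_on {0<..} g"
      unfolding g_def horizon_field_def prod.case
      by (intro continuous_on_compose2[OF psi_continuous[OF acc]])
         (use sph_in_sphere in \<open>auto simp: exterior_def intro!: continuous_intros\<close>)
    have meas: "(\<lambda>s. indicator {0<..} s *\<^sub>R k s) \<in> borel_measurable borel" if "continuous_on {0<..} k" for k :: "real \<Rightarrow> complex"
      using that by (intro borel_measurable_continuous_on_indicator) auto
    \<comment> \<open>The 1 allows for the distance of \<epsilon> Y from its limit at large Y, and K
      for \<rho> on the radial support.\<close>
    obtain s2 where s2: "s2 > 0" "\<forall>s>s2. - s + lam * ln s < - (V + \<bar>u\<bar> + \<bar>ce\<bar> + 1 + K)"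
      using retarded_time_cutoff[OF lam_pos] by blast
    have pt: "((\<lambda>Y. f Y s) \<longlongrightarrow> g s) at_top" if s: "s > 0" for s
    proof -
      have rl: "((\<lambda>Y. r Y s) \<longlongrightarrow> rp) at_top"
        unfolding r_def by real_asymp
      have ev: "\<forall>\<^sub>F Y in at_top. r Y s \<in> {rp..}"
        using eventually_gt_at_top[of 0] by eventually_elim (use r_ge s in auto)
      have rhol: "((\<lambda>Y. \<rho> (r Y s)) \<longlongrightarrow> \<rho> rp) at_top" and sigl: "((\<lambda>Y. \<sigma> (r Y s)) \<longlongrightarrow> \<sigma> rp) at_top"
        using continuous_on_tendsto_compose[OF rs(1) rl _ ev] continuous_on_tendsto_compose[OF rs(2) rl _ ev] by auto
      have "((\<lambda>Y. (E Y s, r Y s, sph \<theta> (\<Phi> Y s))) \<longlongrightarrow> (u + ce - s + lam * ln s + \<rho> rp, rp, sph \<theta> (\<phi> + mu * ln s + cp + \<sigma> rp))) at_top"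
        unfolding E_def \<Phi>_def sph_alt by (intro tendsto_intros rl rhol sigl \<epsilon>)
      then have "((\<lambda>Y. psi (E Y s, r Y s, sph \<theta> (\<Phi> Y s))) \<longlongrightarrow> psi (u + ce - s + lam * ln s + \<rho> rp, rp, sph \<theta> (\<phi> + mu * ln s + cp + \<sigma> rp))) at_top"
      proof (rule continuous_on_tendsto_compose[OF psi_continuous[OF acc]])
        show "\<forall>\<^sub>F Y in at_top. (E Y s, r Y s, sph \<theta> (\<Phi> Y s)) \<in> exterior m a"
          using ev by eventually_elim (use sph_in_sphere in \<open>auto simp: exterior_def\<close>)
      qed (use sph_in_sphere in \<open>auto simp: exterior_def\<close>)
      then show ?thesis by (simp add: f_def g_def horizon_field_def c0_def c1_def algebra_simps)
    qed
    \<comment> \<open>\<open>max 1 Y\<close> agrees with Y eventually and keeps the integrand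
      measurable for every value of the parameter.\<close>
    have "((\<lambda>Y. LINT s|lborel. indicator {0<..} s *\<^sub>R f (max 1 Y) s) \<longlongrightarrow> (LINT s|lborel. indicator {0<..} s *\<^sub>R g s)) at_top"
    proof (rule integral_dominated_convergence_at_top)
      show "integrable lborel (\<lambda>s. indicator {0<..s2} s *\<^sub>R B)"
        using s2(1) by (intro integrable_scaleR_left) (simp add: emeasure_lborel_Ioc)
      show "(\<lambda>s. indicator {0<..} s *\<^sub>R g s) \<in> borel_measurable lborel"
        using meas[OF g_cont] by simp
      show "(\<lambda>s. indicator {0<..} s *\<^sub>R f (max 1 Y) s) \<in> borel_measurable lborel" for Y
        using meas[OF f_cont, of "max 1 Y"] by simp
      show "AE s in lborel. ((\<lambda>Y. indicator {0<..} s *\<^sub>R f (max 1 Y) s) \<longlongrightarrow> indicator {0<..} s *\<^sub>R g s) at_top"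
      proof (rule AE_I2)
        fix s :: real
        have "((\<lambda>Y. f (max 1 Y) s) \<longlongrightarrow> g s) at_top" if "s > 0"
        proof (rule Lim_transform_eventually[OF pt[OF that]])
          show "\<forall>\<^sub>F Y in at_top. f Y s = f (max 1 Y) s"
            using eventually_ge_at_top[of 1] by eventually_elim (simp add: max_def)
        qed
        then show "((\<lambda>Y. indicator {0<..} s *\<^sub>R f (max 1 Y) s) \<longlongrightarrow> indicator {0<..} s *\<^sub>R g s) at_top"
          by (cases "s > 0") auto
      qed
      have "\<forall>\<^sub>F Y in at_top. dist (\<epsilon> Y) ce < 1" using \<epsilon> by (rule tendstoD) simp
      then show "\<forall>\<^sub>F Y in at_top. AE s in lborel. norm (indicator {0<..} s *\<^sub>R f (max 1 Y) s) \<le> indicator {0<..s2} s *\<^sub>R B"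
        using eventually_ge_at_top[of 1]
      proof eventually_elim
        case (elim Y)
        show ?case
        proof (rule AE_I2)
          fix s :: real
          have mY: "max 1 Y = Y" using elim by simp
          show "norm (indicator {0<..} s *\<^sub>R f (max 1 Y) s) \<le> indicator {0<..s2} s *\<^sub>R B"
            unfolding mY
          proof (cases "s > 0 \<and> f Y s \<noteq> 0")
            case True
            have rr: "rp \<le> r Y s" using r_ge[of s Y] True elim by simp
            note W = V(4)[rule_format, OF rr sph_in_sphere]
            have nz: "psi (E Y s, r Y s, sph \<theta> (\<Phi> Y s)) \<noteq> 0" using True by (simp add: f_def)
            \<comment> \<open>A nonzero integrand has its time argument in [-V, V], and this forces
              s \<le> s2.\<close>
            have bdE: "\<bar>E Y s\<bar> \<le> V" "r Y s \<le> r1" using conjunct2[OF W, rule_format, OF nz] by auto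
            have "\<bar>\<rho> (r Y s)\<bar> \<le> K" using K bdE(2) rr by simp
            moreover have "\<bar>\<epsilon> Y - ce\<bar> < 1" using elim by (simp add: dist_real_def)
            moreover have "E Y s = u + \<epsilon> Y + (- s + lam * ln s) + \<rho> (r Y s)" by (simp add: E_def)
            ultimately have "- s + lam * ln s \<ge> - (V + \<bar>u\<bar> + \<bar>ce\<bar> + 1 + K)" using bdE(1) by linarith
            then have "s \<le> s2" using s2(2) by (meson not_le)
            then show "norm (indicator {0<..} s *\<^sub>R f Y s) \<le> indicator {0<..s2} s *\<^sub>R B"
              using True conjunct1[OF W] by (simp add: f_def)
          next
            case False
            then show "norm (indicator {0<..} s *\<^sub>R f Y s) \<le> indicator {0<..s2} s *\<^sub>R B"
              using V(3) by (auto split: split_indicator)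
          qed
        qed
      qed
    qed
    moreover have "((\<lambda>Y::real. complex_of_real ((Y - 1) / Y)) \<longlongrightarrow> complex_of_real 1) at_top"
      by (intro tendsto_of_real) real_asymp
    ultimately have "((\<lambda>Y. of_real ((Y - 1) / Y) * (LINT s|lborel. indicator {0<..} s *\<^sub>R f (max 1 Y) s)) \<longlongrightarrow> of_real 1 * (LINT s|lborel. indicator {0<..} s *\<^sub>R g s)) at_top"
      by (rule tendsto_mult[rotated])
    then have "((\<lambda>Y. ?wh (- Y)) \<longlongrightarrow> of_real 1 * (LINT s|lborel. indicator {0<..} s *\<^sub>R g s)) at_top"
    proof (rule Lim_transform_eventually)
      show "\<forall>\<^sub>F Y in at_top. of_real ((Y - 1) / Y) * (LINT s|lborel. indicator {0<..} s *\<^sub>R f (max 1 Y) s) = ?wh (- Y)"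
        using eventually_gt_at_top[of 2]
      proof eventually_elim
        case (elim Y)
        then have "max 1 Y = Y" by simp
        then show ?case by (simp only: whY[OF elim])
      qed
    qed
    from tendsto_unique[OF _ lim1 this] have "psinf (u, sph \<theta> \<phi>) = (LINT s|lborel. indicator {0<..} s *\<^sub>R g s)" by simp
    then show ?thesis by (simp only: g_def set_lebesgue_integral_def)
  qed
  then show ?thesis by blast
qed

end

section \<open>The estimate\<close>

lemma admissible_slice_measurable:
  assumes "admissible b"
  shows "(\<lambda>\<theta>. \<integral>\<^sup>+ n. \<integral>\<^sup>+ \<xi>. ennreal ((cmod (b n \<xi> \<theta>))\<^sup>2) \<partial>lborel \<partial>count_space UNIV) \<in> borel_measurable borel"
proof -
  interpret sigma_finite_measure "count_space (UNIV :: int set)" by (rule sigma_finite_int)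
  have s: "(\<lambda>\<theta>. \<integral>\<^sup>+ \<xi>. ennreal ((cmod (b n \<xi> \<theta>))\<^sup>2) \<partial>lborel) \<in> borel_measurable borel" for n
  proof -
    have [measurable]: "(\<lambda>z. b n (fst z) (snd z)) \<in> borel_measurable (borel \<Otimes>\<^sub>M borel)"
      using admissible_measurable_pair[OF assms, of n] by (simp add: case_prod_beta)
    have "(\<lambda>(\<theta>, \<xi>). ennreal ((cmod (b n (fst (\<xi>, \<theta>)) (snd (\<xi>, \<theta>))))\<^sup>2)) \<in> borel_measurable (borel \<Otimes>\<^sub>M lborel)"
      by measurable
    then have "(\<lambda>\<theta>. \<integral>\<^sup>+ \<xi>. ennreal ((cmod (b n (fst (\<xi>, \<theta>)) (snd (\<xi>, \<theta>))))\<^sup>2) \<partial>lborel) \<in> borel_measurable borel"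
      by (rule lborel.borel_measurable_nn_integral)
    then show ?thesis by simp
  qed
  have "(\<lambda>(\<theta>, n). \<integral>\<^sup>+ \<xi>. ennreal ((cmod (b n \<xi> \<theta>))\<^sup>2) \<partial>lborel) \<in> borel_measurable (borel \<Otimes>\<^sub>M count_space UNIV)"
    by (rule measurable_pair_countable2) (auto simp: s)
  then show ?thesis by (rule borel_measurable_nn_integral)
qed

text \<open>The norm of a synthesis is an exact integral of its squared data, so a pointwise
  inequality of the data passes to the fields with the same constant.\<close>

lemma nn_integral_synthesis_le:
  assumes b: "admissible b1" "admissible b2" "admissible b3" and C: "0 \<le> C"
    and le: "\<And>n \<theta>. AE \<xi> in lborel. (cmod (b1 n \<xi> \<theta>))\<^sup>2 + (cmod (b2 n \<xi> \<theta>))\<^sup>2 \<le> C * (cmod (b3 n \<xi> \<theta>))\<^sup>2"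
  shows "(\<integral>\<^sup>+ z. ennreal ((cmod (fourier_synthesis b1 z))\<^sup>2 + (cmod (fourier_synthesis b2 z))\<^sup>2) \<partial>cyl) \<le> ennreal C * (\<integral>\<^sup>+ z. ennreal ((cmod (fourier_synthesis b3 z))\<^sup>2) \<partial>cyl)"
proof -
  note [measurable] = admissible_measurable[OF b(1)] admissible_measurable[OF b(2)] admissible_measurable[OF b(3)]
    admissible_slice_measurable[OF b(1)] admissible_slice_measurable[OF b(2)] admissible_slice_measurable[OF b(3)]
  let ?I = "\<lambda>b \<theta> n. \<integral>\<^sup>+ \<xi>. ennreal ((cmod (b n \<xi> \<theta>))\<^sup>2) \<partial>lborel"
  let ?N = "\<lambda>b \<theta>. \<integral>\<^sup>+ n. ?I b \<theta> n \<partial>count_space UNIV"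
  let ?w = "\<lambda>\<theta>. indicator {0..pi} \<theta> * ennreal (sin \<theta>)"
  have [measurable]: "sin \<in> borel_measurable (borel :: real measure)"
    by (intro borel_measurable_continuous_onI continuous_intros)
  have [measurable]: "fourier_synthesis b1 \<in> borel_measurable cyl" "fourier_synthesis b2 \<in> borel_measurable cyl"
    using fourier_synthesis_measurable[OF b(1)] fourier_synthesis_measurable[OF b(2)] by (simp_all add: cyl_def)
  have I: "?I b1 \<theta> n + ?I b2 \<theta> n \<le> ennreal C * ?I b3 \<theta> n" for \<theta> n
  proof -
    have "?I b1 \<theta> n + ?I b2 \<theta> n = (\<integral>\<^sup>+ \<xi>. ennreal ((cmod (b1 n \<xi> \<theta>))\<^sup>2) + ennreal ((cmod (b2 n \<xi> \<theta>))\<^sup>2) \<partial>lborel)"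
      by (intro nn_integral_add[symmetric]) auto
    also have "\<dots> \<le> (\<integral>\<^sup>+ \<xi>. ennreal C * ennreal ((cmod (b3 n \<xi> \<theta>))\<^sup>2) \<partial>lborel)"
    proof (rule nn_integral_mono_AE)
      show "AE \<xi> in lborel. ennreal ((cmod (b1 n \<xi> \<theta>))\<^sup>2) + ennreal ((cmod (b2 n \<xi> \<theta>))\<^sup>2) \<le> ennreal C * ennreal ((cmod (b3 n \<xi> \<theta>))\<^sup>2)"
        using le[of n \<theta>] by eventually_elim (use C in \<open>simp flip: ennreal_plus ennreal_mult add: ennreal_leI\<close>)
    qed
    also have "\<dots> = ennreal C * ?I b3 \<theta> n" by (intro nn_integral_cmult) auto
    finally show ?thesis .
  qed
  have N: "?N b1 \<theta> + ?N b2 \<theta> \<le> ennreal C * ?N b3 \<theta>" for \<theta>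
  proof -
    have "?N b1 \<theta> + ?N b2 \<theta> = (\<integral>\<^sup>+ n. ?I b1 \<theta> n + ?I b2 \<theta> n \<partial>count_space UNIV)"
      by (intro nn_integral_add[symmetric]) auto
    also have "\<dots> \<le> (\<integral>\<^sup>+ n. ennreal C * ?I b3 \<theta> n \<partial>count_space UNIV)"
      by (intro nn_integral_mono I)
    also have "\<dots> = ennreal C * ?N b3 \<theta>" by (intro nn_integral_cmult) auto
    finally show ?thesis .
  qed
  have "(\<integral>\<^sup>+ z. ennreal ((cmod (fourier_synthesis b1 z))\<^sup>2 + (cmod (fourier_synthesis b2 z))\<^sup>2) \<partial>cyl)
     = (\<integral>\<^sup>+ z. ennreal ((cmod (fourier_synthesis b1 z))\<^sup>2) + ennreal ((cmod (fourier_synthesis b2 z))\<^sup>2) \<partial>cyl)" by simp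
  also have "\<dots> = (\<integral>\<^sup>+ z. ennreal ((cmod (fourier_synthesis b1 z))\<^sup>2) \<partial>cyl) + (\<integral>\<^sup>+ z. ennreal ((cmod (fourier_synthesis b2 z))\<^sup>2) \<partial>cyl)"
    by (intro nn_integral_add) auto
  also have "\<dots> = (\<integral>\<^sup>+ \<theta>. ?w \<theta> * ?N b1 \<theta> + ?w \<theta> * ?N b2 \<theta> \<partial>lborel)"
    unfolding nn_integral_synthesis[OF b(1)] nn_integral_synthesis[OF b(2)] by (intro nn_integral_add[symmetric]) auto
  also have "\<dots> \<le> (\<integral>\<^sup>+ \<theta>. ennreal C * (?w \<theta> * ?N b3 \<theta>) \<partial>lborel)"
  proof (intro nn_integral_mono)
    fix \<theta>
    have "?w \<theta> * (?N b1 \<theta> + ?N b2 \<theta>) \<le> ?w \<theta> * (ennreal C * ?N b3 \<theta>)" by (intro mult_left_mono N) auto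
    then show "?w \<theta> * ?N b1 \<theta> + ?w \<theta> * ?N b2 \<theta> \<le> ennreal C * (?w \<theta> * ?N b3 \<theta>)"
      by (simp only: distrib_left mult.left_commute)
  qed
  also have "\<dots> = ennreal C * (\<integral>\<^sup>+ z. ennreal ((cmod (fourier_synthesis b3 z))\<^sup>2) \<partial>cyl)"
    unfolding nn_integral_synthesis[OF b(3)] by (intro nn_integral_cmult) auto
  finally show ?thesis .
qed

text \<open>Growth of at most first order in \<xi> and in n. The product with a second factor of
  this kind stays within the reserve left by the decay of the horizon transforms.\<close>

definition good_symbol :: "(real \<Rightarrow> int \<Rightarrow> real) \<Rightarrow> bool" where
  "good_symbol \<sigma> \<longleftrightarrow> (\<forall>n. continuous_on UNIV (\<lambda>\<xi>. \<sigma> \<xi> n)) \<and>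
     (\<exists>K\<ge>0. \<forall>\<xi> n. \<bar>\<sigma> \<xi> n\<bar> \<le> K * ((1 + \<bar>\<xi>\<bar>) * (1 + \<bar>real_of_int n\<bar>)))"

lemma sqrt_le_self_plus: "x \<ge> 0 \<Longrightarrow> sqrt x \<le> 1 + x"
  by (rule real_le_lsqrt) (auto simp: power2_eq_square algebra_simps)

lemma one_le_weight: "1 \<le> (1 + \<bar>\<xi>\<bar>) * (1 + \<bar>real_of_int n\<bar>)"
  by (simp add: algebra_simps)

lemma good_symbol_1: "good_symbol (\<lambda>\<xi> n. 1)"
  unfolding good_symbol_def using one_le_weight by (auto intro!: exI[of _ 1] continuous_intros)

lemma good_symbol_T_half: "good_symbol T_half"
  unfolding good_symbol_def
proof (intro conjI allI exI[of _ 1])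
  fix \<xi> n
  have "sqrt \<bar>\<xi>\<bar> \<le> (1 + \<bar>\<xi>\<bar>) * 1" using sqrt_le_self_plus[of "\<bar>\<xi>\<bar>"] by simp
  also have "\<dots> \<le> (1 + \<bar>\<xi>\<bar>) * (1 + \<bar>real_of_int n\<bar>)" by (intro mult_left_mono) auto
  finally show "\<bar>T_half \<xi> n\<bar> \<le> 1 * ((1 + \<bar>\<xi>\<bar>) * (1 + \<bar>real_of_int n\<bar>))" by (simp add: T_half_def powr_half_sqrt)
qed (auto simp: T_half_def powr_half_sqrt intro!: continuous_intros)

lemma good_symbol_Tplus_half: "good_symbol (Tplus_half m a)"
  unfolding good_symbol_def
proof (intro conjI allI exI[of _ "2 + \<bar>omega_plus m a\<bar>"])
  fix \<xi> n
  let ?w = "(1 + \<bar>\<xi>\<bar>) * (1 + \<bar>real_of_int n\<bar>)"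
  have "\<bar>\<xi> + omega_plus m a * of_int n\<bar> \<le> \<bar>\<xi>\<bar> + \<bar>omega_plus m a\<bar> * \<bar>real_of_int n\<bar>"
    using abs_triangle_ineq[of \<xi> "omega_plus m a * of_int n"] by (simp add: abs_mult)
  also have "\<dots> \<le> ?w + \<bar>omega_plus m a\<bar> * ?w"
    by (intro add_mono mult_left_mono) (auto simp: algebra_simps)
  finally have "sqrt \<bar>\<xi> + omega_plus m a * of_int n\<bar> \<le> 1 + (?w + \<bar>omega_plus m a\<bar> * ?w)"
    using sqrt_le_self_plus[of "\<bar>\<xi> + omega_plus m a * of_int n\<bar>"] by simp
  also have "\<dots> \<le> (2 + \<bar>omega_plus m a\<bar>) * ?w"
  proof -
    have "1 + (w + c * w) \<le> (2 + c) * w" if "1 \<le> w" for w c :: real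
      using that by (simp add: distrib_right)
    then show ?thesis using one_le_weight[of \<xi> n] by blast
  qed
  finally show "\<bar>Tplus_half m a \<xi> n\<bar> \<le> (2 + \<bar>omega_plus m a\<bar>) * ?w"
    by (simp add: Tplus_half_def powr_half_sqrt)
qed (auto simp: Tplus_half_def powr_half_sqrt intro!: continuous_intros)

text \<open>The squared weights are exactly the reserve in \<open>W_decay_symbol\<close>: room for
  two factors of first order, a commutator symbol and one of \<open>Tplus_half\<close> and
  \<open>scri_mult\<close>.\<close>

lemma (in tower) admissible_symbol:
  fixes s :: "int \<Rightarrow> real \<Rightarrow> complex"
  assumes m: "\<And>n. s n \<in> borel_measurable borel" and c: "\<And>n. AE \<xi> in lborel. isCont (s n) \<xi>"
    and b: "\<And>n \<xi>. cmod (s n \<xi>) \<le> K * ((1 + \<bar>\<xi>\<bar>)\<^sup>2 * (1 + \<bar>real_of_int n\<bar>)\<^sup>2)"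
  shows "admissible (\<lambda>n \<xi> \<theta>. s n \<xi> * W w n \<xi> \<theta>)"
  unfolding admissible_def
proof (intro conjI allI)
  fix n
  have [measurable]: "(\<lambda>p. W w n (fst p) (snd p)) \<in> borel_measurable (borel \<Otimes>\<^sub>M borel)"
    using W_measurable[of w n] by (simp add: case_prod_beta)
  have "(\<lambda>p. s n (fst p) * W w n (fst p) (snd p)) \<in> borel_measurable (borel \<Otimes>\<^sub>M borel)"
    using m by measurable
  then show "(\<lambda>(\<xi>, \<theta>). s n \<xi> * W w n \<xi> \<theta>) \<in> borel_measurable borel"
    by (simp add: case_prod_beta borel_prod)
next
  fix n \<theta>
  show "AE \<xi> in lborel. isCont (\<lambda>\<xi>. s n \<xi> * W w n \<xi> \<theta>) \<xi>"
    using c[of n] by eventually_elim (intro continuous_intros W_cont)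
next
  obtain C where C: "C \<ge> 0" "\<forall>n \<xi> \<theta>. (1 + \<bar>\<xi>\<bar>)\<^sup>2 * (1 + \<bar>real_of_int n\<bar>)\<^sup>2 * cmod (W w n \<xi> \<theta>) \<le> C * (1 / (1 + (real_of_int n)\<^sup>2)) * (1 / (1 + \<xi>\<^sup>2))"
    using W_decay_symbol[of w] by blast
  have K: "0 \<le> K" using order_trans[OF norm_ge_zero b[of 0 0]] by simp
  have "cmod (s n \<xi> * W w n \<xi> \<theta>) \<le> K * C * (1 / (1 + (real_of_int n)\<^sup>2)) * (1 / (1 + \<xi>\<^sup>2))" for n \<xi> \<theta>
  proof -
    have "cmod (s n \<xi> * W w n \<xi> \<theta>) \<le> K * ((1 + \<bar>\<xi>\<bar>)\<^sup>2 * (1 + \<bar>real_of_int n\<bar>)\<^sup>2) * cmod (W w n \<xi> \<theta>)"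
      unfolding norm_mult by (intro mult_right_mono b) auto
    also have "\<dots> = K * ((1 + \<bar>\<xi>\<bar>)\<^sup>2 * (1 + \<bar>real_of_int n\<bar>)\<^sup>2 * cmod (W w n \<xi> \<theta>))" by simp
    also have "\<dots> \<le> K * (C * (1 / (1 + (real_of_int n)\<^sup>2)) * (1 / (1 + \<xi>\<^sup>2)))"
      using C(2) K by (intro mult_left_mono) auto
    finally show ?thesis by (simp only: mult.assoc)
  qed
  then show "\<exists>C. \<forall>n \<xi> \<theta>. cmod (s n \<xi> * W w n \<xi> \<theta>) \<le> C * (1 / (1 + (real_of_int n)\<^sup>2)) * (1 / (1 + \<xi>\<^sup>2))"
    by blast
qed

section \<open>The frequency set and the comparison of symbols on it\<close>

context subextremal
begin

lemma beta_plus_eq: "beta_plus m a \<xi> n = lam * \<xi> + mu * of_int n"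
  by (simp add: beta_plus_def algebra_simps)

lemma A_section_closed: "closed {\<xi>. (\<xi>, n) \<in> A_set m a M}"
proof -
  have "{\<xi>. (\<xi>, n) \<in> A_set m a M} = {\<xi>. 0 \<le> beta_plus m a \<xi> n * \<xi>} \<union> {\<xi>. \<bar>beta_plus m a \<xi> n\<bar> \<le> M}"
    by (auto simp: A_set_def)
  also have "closed \<dots>"
    unfolding beta_plus_eq by (intro closed_Un closed_Collect_le continuous_intros)
  finally show ?thesis .
qed

lemma Pi_measurable: "(\<lambda>\<xi>. Pi_A m a M \<xi> n) \<in> borel_measurable borel"
proof -
  have "(\<lambda>\<xi>. Pi_A m a M \<xi> n) = indicator {\<xi>. (\<xi>, n) \<in> A_set m a M}"
    by (auto simp: Pi_A_def fun_eq_iff indicator_def)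
  then show ?thesis using borel_closed[OF A_section_closed[of n M]] by simp
qed

text \<open>Membership of (\<xi>, n) can change only where \<xi> = 0, \<beta>_+ = 0 or |\<beta>_+| =
  M. Since \<beta>_+ is affine in \<xi> with nonzero slope, these are at most four
  frequencies.\<close>

lemma AE_isCont_Pi: "AE \<xi> in lborel. isCont (\<lambda>\<xi>. Pi_A m a M \<xi> n) \<xi>"
proof -
  let ?A = "{\<xi>. (\<xi>, n) \<in> A_set m a M}"
  let ?z = "\<lambda>b. (b - mu * of_int n) / lam"
  have eq: "(\<lambda>\<xi>. Pi_A m a M \<xi> n) = indicator ?A"
    by (auto simp: Pi_A_def fun_eq_iff indicator_def)
  have "isCont (indicator ?A :: real \<Rightarrow> real) \<xi>" if "\<xi> \<noteq> 0" "\<xi> \<noteq> ?z 0" "\<xi> \<noteq> ?z M" "\<xi> \<noteq> ?z (- M)" for \<xi>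
  proof -
    have z: "beta_plus m a \<xi> n \<noteq> b" if "\<xi> \<noteq> ?z b" for b
      using that lam_pos by (auto simp: beta_plus_eq field_simps)
    have "\<xi> \<notin> frontier ?A"
    proof
      assume "\<xi> \<in> frontier ?A"
      then have f: "\<xi> \<in> ?A" "\<xi> \<notin> interior ?A"
        using A_section_closed[of n M] by (auto simp: frontier_def closure_closed)
      \<comment> \<open>The strict inequalities define an open subset; off the four frequencies,
        membership is always strict.\<close>
      let ?O = "{\<xi>. 0 < beta_plus m a \<xi> n * \<xi>} \<union> {\<xi>. \<bar>beta_plus m a \<xi> n\<bar> < M}"
      have "open ?O" unfolding beta_plus_eq by (intro open_Un open_Collect_less continuous_intros)
      moreover have "?O \<subseteq> ?A" by (auto simp: A_set_def)
      ultimately have "?O \<subseteq> interior ?A" by (intro interior_maximal)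
      moreover have "\<xi> \<in> ?O"
        using f(1) that(1) z[OF that(2)] z[OF that(3)] z[OF that(4)] unfolding A_set_def
        by (auto simp: less_le abs_if split: if_splits)
      ultimately show False using f(2) by blast
    qed
    then show ?thesis by (simp add: isCont_indicator)
  qed
  then show ?thesis
    unfolding eq
    using AE_lborel_singleton[of 0] AE_lborel_singleton[of "?z 0"] AE_lborel_singleton[of "?z M"] AE_lborel_singleton[of "?z (- M)"]
    by (auto elim!: eventually_elim2)
qed

lemma Pi_bounds: "0 \<le> Pi_A m a M \<xi> n" "Pi_A m a M \<xi> n \<le> 1"
  by (auto simp: Pi_A_def split: split_indicator)

lemma Tplus_half_sq: "(Tplus_half m a \<xi> n)\<^sup>2 = \<bar>beta_plus m a \<xi> n\<bar> / lam"
  using lam_pos by (simp add: Tplus_half_def powr_half_sqrt beta_plus_def abs_mult)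

text \<open>With x = \<beta>_+ sgn \<xi>: the 2 serves x \<ge> 0, the summand (1 + M) e^(2 pi M)
  serves -M \<le> x < 0, and 1 + 1/lam converts |\<beta>_+| into the square of
  \<open>Tplus_half\<close>.\<close>

definition estimate_const :: "real \<Rightarrow> real" where "estimate_const M = (1 + 1 / lam) * (2 + (1 + M) * exp (2 * pi * M))"

lemma estimate_const_pos: "M > 0 \<Longrightarrow> estimate_const M > 0"
  unfolding estimate_const_def using lam_pos by (intro mult_pos_pos add_pos_nonneg) auto

text \<open>This is where the frequency set enters. If \<beta>_+ \<xi> \<ge> 0, the weight dominates
  both 1 and |\<beta>_+|; otherwise |\<beta>_+| \<le> M, and the exponentially small weight is still
  at least e^(-2 pi M).\<close>

lemma mellin_weight_lower_bound:
  assumes M: "M > 0" and A: "(\<xi>, n) \<in> A_set m a M" and \<xi>: "\<xi> \<noteq> 0"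
  shows "1 + (Tplus_half m a \<xi> n)\<^sup>2 \<le> estimate_const M * mellin_weight (beta_plus m a \<xi> n * sgn \<xi>)"
proof -
  define \<beta> where "\<beta> = beta_plus m a \<xi> n"
  define x where "x = \<beta> * sgn \<xi>"
  have xb: "\<bar>x\<bar> = \<bar>\<beta>\<bar>" using \<xi> by (simp add: x_def abs_mult abs_sgn_eq)
  define c where "c = (1 + M) * exp (2 * pi * M)"
  have c: "c \<ge> 0" using M by (simp add: c_def)
  have "1 + \<bar>\<beta>\<bar> \<le> (2 + c) * mellin_weight x"
  proof (cases "x \<ge> 0")
    case True
    have "x * 1 \<le> x * (2 * pi)" using True pi_ge_two by (intro mult_left_mono) auto
    then have "x \<le> mellin_weight x" using mellin_weight_ge_nonneg(2)[OF True] by (simp add: mult_ac)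
    then have "1 + \<bar>\<beta>\<bar> \<le> 2 * mellin_weight x" using mellin_weight_ge_nonneg(1)[OF True] True xb by simp
    also have "\<dots> \<le> (2 + c) * mellin_weight x" using c mellin_weight_ge_nonneg(1)[OF True] by (intro mult_right_mono) auto
    finally show ?thesis .
  next
    case False
    then have "\<not> \<beta> * \<xi> \<ge> 0"
      using \<xi> by (auto simp: x_def sgn_if mult_le_0_iff zero_le_mult_iff split: if_splits)
    then have bM: "\<bar>\<beta>\<bar> \<le> M" using A by (auto simp: A_set_def \<beta>_def)
    then have "- M \<le> x" using xb by linarith
    then have "2 * pi * (- M) \<le> 2 * pi * x" by (intro mult_left_mono) auto
    then have e: "exp (- (2 * pi * M)) \<le> exp (2 * pi * x)" by simp
    have k: "exp (- (2 * pi * M)) \<le> mellin_weight x"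
      by (rule order_trans[OF e mellin_weight_ge_neg]) (use False in simp)
    have "1 + \<bar>\<beta>\<bar> \<le> 1 + M" using bM by simp
    also have "\<dots> = c * exp (- (2 * pi * M))" by (simp add: c_def exp_minus)
    also have "\<dots> \<le> c * mellin_weight x" using k c by (intro mult_left_mono)
    also have "\<dots> \<le> (2 + c) * mellin_weight x" using order_trans[OF exp_ge_zero k] by (intro mult_right_mono) auto
    finally show ?thesis .
  qed
  then have "(1 + 1 / lam) * (1 + \<bar>\<beta>\<bar>) \<le> (1 + 1 / lam) * ((2 + c) * mellin_weight x)"
    using lam_pos by (intro mult_left_mono) auto
  moreover have "1 + \<bar>\<beta>\<bar> / lam \<le> (1 + 1 / lam) * (1 + \<bar>\<beta>\<bar>)"
    using lam_pos by (simp add: algebra_simps add_divide_distrib)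
  ultimately show ?thesis unfolding Tplus_half_sq estimate_const_def x_def c_def \<beta>_def by (simp add: mult.assoc)
qed

text \<open>A classical operator acts on the horizon data through the word \<open>w\<close>, so one
  argument covers all commutators. The three fields are syntheses of \<open>W w\<close> times
  symbols, the third with the extra factor \<open>scri_mult\<close>, whose modulus is bounded below
  on the frequency set.\<close>

lemma horizon_estimate_core:
  assumes M: "M > 0" and "radiating_tower V P lam" and \<sigma>: "good_symbol \<sigma>"
    and f': "\<And>x \<theta> \<phi>. 0 \<le> \<theta> \<Longrightarrow> \<theta> \<le> pi \<Longrightarrow> f' (x, \<theta>, \<phi>) = radiating_tower.Rad lam mu c0 c1 (P (True # w)) (x, \<theta>, \<phi>)"
  shows "\<exists>f1 f2 f3.
       fourier_mult (\<lambda>\<xi> n. Pi_A m a M \<xi> n * Tplus_half m a \<xi> n * \<sigma> \<xi> n) (P w) f1 \<and>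
       fourier_mult (\<lambda>\<xi> n. Pi_A m a M \<xi> n * \<sigma> \<xi> n) (P w) f2 \<and>
       fourier_mult (\<lambda>\<xi> n. Pi_A m a M \<xi> n * \<sigma> \<xi> n) f' f3 \<and>
       (\<integral>\<^sup>+ z. ennreal ((cmod (f1 z))\<^sup>2 + (cmod (f2 z))\<^sup>2) \<partial>cyl)
         \<le> ennreal (estimate_const M) * (\<integral>\<^sup>+ z. ennreal ((cmod (f3 z))\<^sup>2) \<partial>cyl)"
proof -
  interpret R: radiating_tower V P lam mu c0 c1 by fact
  let ?W = "\<lambda>n \<xi> \<theta>. R.W w n \<xi> \<theta>"
  let ?wt = "\<lambda>\<xi> n. (1 + \<bar>\<xi>\<bar>) * (1 + \<bar>real_of_int n\<bar>)"
  let ?s1 = "\<lambda>\<xi> n. Pi_A m a M \<xi> n * Tplus_half m a \<xi> n * \<sigma> \<xi> n" and ?s2 = "\<lambda>\<xi> n. Pi_A m a M \<xi> n * \<sigma> \<xi> n"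
  note sg = conjunct1[OF \<sigma>[unfolded good_symbol_def], rule_format]
  note tg = conjunct1[OF good_symbol_Tplus_half[of m a, unfolded good_symbol_def], rule_format]
  obtain K where K': "K \<ge> 0" "\<forall>\<xi> n. \<bar>\<sigma> \<xi> n\<bar> \<le> K * ?wt \<xi> n"
    using conjunct2[OF \<sigma>[unfolded good_symbol_def]] by (elim exE conjE)
  note K = K'(1) K'(2)[rule_format]
  obtain L where L': "L \<ge> 0" "\<forall>\<xi> n. \<bar>Tplus_half m a \<xi> n\<bar> \<le> L * ?wt \<xi> n"
    using conjunct2[OF good_symbol_Tplus_half[of m a, unfolded good_symbol_def]] by (elim exE conjE)
  note L = L'(1) L'(2)[rule_format]
  have \<sigma>i: "isCont (\<lambda>\<xi>. \<sigma> \<xi> n) \<xi>" for n \<xi>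
    using sg[of n] by (simp add: continuous_on_eq_continuous_at)
  have Ti: "isCont (\<lambda>\<xi>. Tplus_half m a \<xi> n) \<xi>" for n \<xi>
    using tg[of n] by (simp add: continuous_on_eq_continuous_at)
  note [measurable] = borel_measurable_continuous_onI[OF sg] borel_measurable_continuous_onI[OF tg] Pi_measurable R.scri_mult_measurable
  have wt0: "0 \<le> ?wt \<xi> n" "1 \<le> ?wt \<xi> n" for \<xi> n by (simp, rule one_le_weight)
  have wt2: "(1 + \<bar>\<xi>\<bar>)\<^sup>2 * (1 + \<bar>real_of_int n\<bar>)\<^sup>2 = ?wt \<xi> n * ?wt \<xi> n" for \<xi> n
    by (simp add: power2_eq_square)
  have s2b: "\<bar>?s2 \<xi> n\<bar> \<le> K * ?wt \<xi> n" for \<xi> n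
  proof -
    have "\<bar>?s2 \<xi> n\<bar> \<le> 1 * \<bar>\<sigma> \<xi> n\<bar>" unfolding abs_mult using Pi_bounds by (intro mult_right_mono) auto
    then show ?thesis using K(2)[of \<xi> n] by simp
  qed
  have s1b: "\<bar>?s1 \<xi> n\<bar> \<le> L * K * (?wt \<xi> n * ?wt \<xi> n)" for \<xi> n
  proof -
    have "\<bar>?s1 \<xi> n\<bar> = \<bar>Tplus_half m a \<xi> n\<bar> * \<bar>?s2 \<xi> n\<bar>" by (simp add: abs_mult)
    also have "\<dots> \<le> (L * ?wt \<xi> n) * (K * ?wt \<xi> n)"
      using L wt0(1) by (intro mult_mono s2b) auto
    finally show ?thesis by (simp add: mult_ac)
  qed
  define D where "D = 1 + 2 * pi * (lam + \<bar>mu\<bar>)"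
  have D: "D \<ge> 1" using lam_pos by (simp add: D_def)
  have symb: "cmod (R.scri_mult n \<xi>) \<le> D * ?wt \<xi> n" for n \<xi>
  proof (cases "\<xi> = 0")
    case True
    then show ?thesis using D wt0(1)[of \<xi> n] by (simp add: R.scri_mult_0)
  next
    case False
    have "(cmod (R.scri_mult n \<xi>))\<^sup>2 = mellin_weight ((lam * \<xi> + mu * of_int n) * sgn \<xi>)"
      unfolding R.scri_mult_def norm_mult using norm_mellin_symbol[OF False] by simp
    also have "\<dots> \<le> 1 + 2 * pi * \<bar>(lam * \<xi> + mu * of_int n) * sgn \<xi>\<bar>" by (rule mellin_weight_le)
    also have "\<dots> = 1 + 2 * pi * \<bar>lam * \<xi> + mu * of_int n\<bar>" using False by (simp add: abs_mult abs_sgn_eq)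
    also have "\<dots> \<le> ?wt \<xi> n + 2 * pi * ((lam + \<bar>mu\<bar>) * ?wt \<xi> n)"
      by (intro add_mono wt0(2) mult_left_mono R.abs_beta_le) auto
    also have "\<dots> = D * ?wt \<xi> n" by (simp add: D_def algebra_simps)
    also have "\<dots> \<le> (D * ?wt \<xi> n)\<^sup>2"
      using mult_mono[OF D wt0(2)] D by (intro self_le_power) auto
    finally show ?thesis by (rule power2_le_imp_le) (use D wt0(1) in auto)
  qed
  have s3b: "cmod (of_real (?s2 \<xi> n) * R.scri_mult n \<xi>) \<le> K * D * (?wt \<xi> n * ?wt \<xi> n)" for \<xi> n
  proof -
    have "cmod (of_real (?s2 \<xi> n) * R.scri_mult n \<xi>) = \<bar>?s2 \<xi> n\<bar> * cmod (R.scri_mult n \<xi>)" by (simp add: norm_mult abs_mult)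
    also have "\<dots> \<le> (K * ?wt \<xi> n) * (D * ?wt \<xi> n)"
      using K wt0(1) by (intro mult_mono s2b symb) auto
    finally show ?thesis by (simp add: mult_ac)
  qed
  have ad1: "admissible (\<lambda>n \<xi> \<theta>. of_real (?s1 \<xi> n) * ?W n \<xi> \<theta>)"
  proof (rule R.admissible_symbol)
    show "AE \<xi> in lborel. isCont (\<lambda>\<xi>. complex_of_real (?s1 \<xi> n)) \<xi>" for n
      using AE_isCont_Pi[of M n] by eventually_elim (intro continuous_intros \<sigma>i Ti)
    show "cmod (of_real (?s1 \<xi> n)) \<le> L * K * ((1 + \<bar>\<xi>\<bar>)\<^sup>2 * (1 + \<bar>real_of_int n\<bar>)\<^sup>2)" for n \<xi>
      using s1b[of \<xi> n] by (simp only: wt2 norm_of_real)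
  qed measurable
  have ad2: "admissible (\<lambda>n \<xi> \<theta>. of_real (?s2 \<xi> n) * ?W n \<xi> \<theta>)"
  proof (rule R.admissible_symbol)
    show "AE \<xi> in lborel. isCont (\<lambda>\<xi>. complex_of_real (?s2 \<xi> n)) \<xi>" for n
      using AE_isCont_Pi[of M n] by eventually_elim (intro continuous_intros \<sigma>i)
    show "cmod (of_real (?s2 \<xi> n)) \<le> K * ((1 + \<bar>\<xi>\<bar>)\<^sup>2 * (1 + \<bar>real_of_int n\<bar>)\<^sup>2)" for n \<xi>
    proof -
      have "K * (?wt \<xi> n * 1) \<le> K * (?wt \<xi> n * ?wt \<xi> n)" using K(1) wt0[of \<xi> n] by (intro mult_left_mono) auto
      then show ?thesis using s2b[of \<xi> n] by (simp only: wt2 norm_of_real mult_1_right)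
    qed
  qed measurable
  have ad3: "admissible (\<lambda>n \<xi> \<theta>. (of_real (?s2 \<xi> n) * R.scri_mult n \<xi>) * ?W n \<xi> \<theta>)"
  proof (rule R.admissible_symbol)
    show "AE \<xi> in lborel. isCont (\<lambda>\<xi>. complex_of_real (?s2 \<xi> n) * R.scri_mult n \<xi>) \<xi>" for n
      using AE_isCont_Pi[of M n] AE_lborel_singleton[of 0] by eventually_elim (intro continuous_intros \<sigma>i R.scri_mult_isCont)
    show "cmod (of_real (?s2 \<xi> n) * R.scri_mult n \<xi>) \<le> K * D * ((1 + \<bar>\<xi>\<bar>)\<^sup>2 * (1 + \<bar>real_of_int n\<bar>)\<^sup>2)" for n \<xi>
      using s3b[of \<xi> n] by (simp only: wt2)
  qed measurable
  have ad4: "admissible (\<lambda>n \<xi> \<theta>. R.scri_mult n \<xi> * ?W n \<xi> \<theta>)"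
  proof (rule R.admissible_symbol)
    show "AE \<xi> in lborel. isCont (R.scri_mult n) \<xi>" for n
      using AE_lborel_singleton[of 0] by eventually_elim (rule R.scri_mult_isCont)
    show "cmod (R.scri_mult n \<xi>) \<le> D * ((1 + \<bar>\<xi>\<bar>)\<^sup>2 * (1 + \<bar>real_of_int n\<bar>)\<^sup>2)" for n \<xi>
    proof -
      have "D * (?wt \<xi> n * 1) \<le> D * (?wt \<xi> n * ?wt \<xi> n)" using D wt0[of \<xi> n] by (intro mult_left_mono) auto
      then show ?thesis using symb[of n \<xi>] by (simp only: wt2 mult_1_right)
    qed
  qed measurable
  have ad3': "admissible (\<lambda>n \<xi> \<theta>. of_real (?s2 \<xi> n) * (R.scri_mult n \<xi> * ?W n \<xi> \<theta>))"
    using ad3 by (simp only: mult.assoc)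
  have fm1: "fourier_mult ?s1 (P w) (fourier_synthesis (\<lambda>n \<xi> \<theta>. of_real (?s1 \<xi> n) * ?W n \<xi> \<theta>))"
    by (rule fourier_mult_synthesis[OF ad1 R.L2_fourier_A])
  have fm2: "fourier_mult ?s2 (P w) (fourier_synthesis (\<lambda>n \<xi> \<theta>. of_real (?s2 \<xi> n) * ?W n \<xi> \<theta>))"
    by (rule fourier_mult_synthesis[OF ad2 R.L2_fourier_A])
  have fm3: "fourier_mult ?s2 f' (fourier_synthesis (\<lambda>n \<xi> \<theta>. of_real (?s2 \<xi> n) * (R.scri_mult n \<xi> * ?W n \<xi> \<theta>)))"
  proof (rule fourier_mult_synthesis[OF ad3'])
    fix n \<theta> assume th: "0 \<le> \<theta>" "\<theta> \<le> (pi :: real)"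
    \<comment> \<open>A mode at a polar angle depends on the field at that angle alone, so agreement
      for \<theta> in [0, pi] suffices.\<close>
    have "az_mode n f' \<theta> = az_mode n (R.Rad (P (True # w))) \<theta>"
      unfolding az_mode_def by (simp only: f'[OF th])
    also have "\<dots> = (\<lambda>x. ft (\<lambda>\<xi>. R.scri_mult n \<xi> * ?W n \<xi> \<theta>) x / (2 * of_real pi))"
      by (rule ext) (rule R.az_mode_Rad_True)
    finally show "L2_fourier (az_mode n f' \<theta>) (\<lambda>\<xi>. R.scri_mult n \<xi> * ?W n \<xi> \<theta>)"
      using L2_fourier_admissible[OF ad4] by simp
  qed
  have "(\<integral>\<^sup>+ z. ennreal ((cmod (fourier_synthesis (\<lambda>n \<xi> \<theta>. of_real (?s1 \<xi> n) * ?W n \<xi> \<theta>) z))\<^sup>2 + (cmod (fourier_synthesis (\<lambda>n \<xi> \<theta>. of_real (?s2 \<xi> n) * ?W n \<xi> \<theta>) z))\<^sup>2) \<partial>cyl)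
     \<le> ennreal (estimate_const M) * (\<integral>\<^sup>+ z. ennreal ((cmod (fourier_synthesis (\<lambda>n \<xi> \<theta>. of_real (?s2 \<xi> n) * (R.scri_mult n \<xi> * ?W n \<xi> \<theta>)) z))\<^sup>2) \<partial>cyl)"
  proof (rule nn_integral_synthesis_le[OF ad1 ad2 ad3' less_imp_le[OF estimate_const_pos[OF M]]])
    fix n \<theta>
    show "AE \<xi> in lborel. (cmod (of_real (?s1 \<xi> n) * ?W n \<xi> \<theta>))\<^sup>2 + (cmod (of_real (?s2 \<xi> n) * ?W n \<xi> \<theta>))\<^sup>2
       \<le> estimate_const M * (cmod (of_real (?s2 \<xi> n) * (R.scri_mult n \<xi> * ?W n \<xi> \<theta>)))\<^sup>2"
      using AE_lborel_singleton[of 0]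
    proof eventually_elim
      case (elim \<xi>)
      \<comment> \<open>The common factor of both sides; it vanishes off the frequency set, and on
        the set only the symbols remain to be compared.\<close>
      let ?v = "(?s2 \<xi> n)\<^sup>2 * (cmod (?W n \<xi> \<theta>))\<^sup>2"
      have sy: "(cmod (R.scri_mult n \<xi>))\<^sup>2 = mellin_weight (beta_plus m a \<xi> n * sgn \<xi>)"
        unfolding R.scri_mult_def norm_mult beta_plus_eq using norm_mellin_symbol[OF elim] by simp
      have "?v * (1 + (Tplus_half m a \<xi> n)\<^sup>2) \<le> ?v * (estimate_const M * (cmod (R.scri_mult n \<xi>))\<^sup>2)"
      proof (cases "(\<xi>, n) \<in> A_set m a M")
        case True
        show ?thesis unfolding sy by (intro mult_left_mono mellin_weight_lower_bound M True elim) auto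
      next
        case False
        then show ?thesis by (simp add: Pi_A_def)
      qed
      then show ?case by (simp add: norm_mult power_mult_distrib algebra_simps)
    qed
  qed
  then show ?thesis using fm1 fm2 fm3 by blast
qed

text \<open>\<open>T\<close> and \<open>Z\<close> pass through the half-line average and become
  letters of the tower, while the half-derivatives stay on the Fourier side as symbols.\<close>

lemma horizon_estimate:
  assumes S: "S < 0" and M: "M > 0" and ks: "kerr_star m a rstar phistar" and kt: "kerr_time m a rstar h"
    and acc: "acceptable m a h psi"
    and tc: "transformed_coords m a S R Rt rst q p"
    and rf: "radiation_field S Rt rst q p (whiting m a S R Rt rstar phistar psi) psinf"
    and D: "(D, \<sigma>) \<in> commutators m a"
  shows "\<exists>f1 f2 f3.
       fourier_mult (\<lambda>\<xi> n. Pi_A m a M \<xi> n * Tplus_half m a \<xi> n * \<sigma> \<xi> n) (D (horizon_field m a psi)) f1 \<and>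
       fourier_mult (\<lambda>\<xi> n. Pi_A m a M \<xi> n * \<sigma> \<xi> n) (D (horizon_field m a psi)) f2 \<and>
       fourier_mult (\<lambda>\<xi> n. Pi_A m a M \<xi> n * \<sigma> \<xi> n) (dT (D (scri_field psinf))) f3 \<and>
       (\<integral>\<^sup>+ z. ennreal ((cmod (f1 z))\<^sup>2 + (cmod (f2 z))\<^sup>2) \<partial>cyl)
         \<le> ennreal (estimate_const M) * (\<integral>\<^sup>+ z. ennreal ((cmod (f3 z))\<^sup>2) \<partial>cyl)"
proof -
  obtain V P where P: "field_tower V P" "P [] = horizon_field m a psi"
    using horizon_field_tower[OF kt acc] by blast
  obtain c0 c1 where c: "\<forall>u \<theta> \<phi>. 0 \<le> \<theta> \<and> \<theta> \<le> pi \<longrightarrow> psinf (u, sph \<theta> \<phi>) =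
    (LINT s:{0<..}|lborel. horizon_field m a psi (u + (- s + lam * ln s + c0), \<theta>, \<phi> + (mu * ln s + c1)))"
    using radiation_field_formula[OF S ks kt acc tc rf] by blast
  have rt: "radiating_tower V P lam"
    using P(1) lam_pos by (intro radiating_tower.intro tower.intro radiating_tower_axioms.intro)
  interpret R: radiating_tower V P lam mu c0 c1 by (rule rt)
  have r0: "scri_field psinf (u, \<theta>, \<phi>) = R.Rad (P []) (u, \<theta>, \<phi>)" if "0 \<le> \<theta>" "\<theta> \<le> pi" for u \<theta> \<phi>
    using c that by (simp add: scri_field_def R.Rad_def P(2) R.delay_def R.twist_def)
  \<comment> \<open>Equality is asked only along the line of differentiation, so the identification
    of the radiation field for polar angles in [0, pi] survives \<open>dT\<close>.\<close>
  have T: "dT f (u, \<theta>, \<phi>) = R.Rad (P (True # w)) (u, \<theta>, \<phi>)" if "\<And>s. f (s, \<theta>, \<phi>) = R.Rad (P w) (s, \<theta>, \<phi>)" for f w u \<theta> \<phi>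
    unfolding dT_def prod.case that by (rule vector_derivative_at[OF R.Rad_deriv_u])
  have Z: "dZ f (u, \<theta>, \<phi>) = R.Rad (P (False # w)) (u, \<theta>, \<phi>)" if "\<And>s. f (u, \<theta>, s) = R.Rad (P w) (u, \<theta>, s)" for f w u \<theta> \<phi>
    unfolding dZ_def prod.case that by (rule vector_derivative_at[OF R.Rad_deriv_phi])
  have TP: "dT (P w) = P (True # w)" and ZP: "dZ (P w) = P (False # w)" for w
    unfolding dT_def dZ_def by (auto simp: fun_eq_iff intro!: vector_derivative_at R.P_deriv_v R.P_deriv_phi)
  have core: ?thesis if w: "D (P []) = P w" "good_symbol \<sigma>"
      "\<And>u \<theta> \<phi>. 0 \<le> \<theta> \<Longrightarrow> \<theta> \<le> pi \<Longrightarrow> D (scri_field psinf) (u, \<theta>, \<phi>) = R.Rad (P w) (u, \<theta>, \<phi>)" for w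
  proof -
    have "dT (D (scri_field psinf)) (u, \<theta>, \<phi>) = R.Rad (P (True # w)) (u, \<theta>, \<phi>)" if "0 \<le> \<theta>" "\<theta> \<le> pi" for u \<theta> \<phi>
      by (rule T[OF w(3)[OF that]])
    from horizon_estimate_core[OF M rt w(2) this] show ?thesis unfolding P(2)[symmetric] w(1) .
  qed
  from D consider "D = (\<lambda>f. f)" "good_symbol \<sigma>" | "D = dT" "good_symbol \<sigma>" | "D = dZ" "good_symbol \<sigma>"
    unfolding commutators_def using good_symbol_1 good_symbol_T_half good_symbol_Tplus_half[of m a] by auto
  then show ?thesis
  proof cases
    case 1
    then show ?thesis by (intro core[of "[]"]) (simp_all add: r0)
  next
    case 2
    then show ?thesis by (intro core[of "[True]"]) (simp_all add: TP T[OF r0])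
  next
    case 3
    then show ?thesis by (intro core[of "[False]"]) (simp_all add: ZP Z[OF r0])
  qed
qed

end

theorem proposition4p4:
  fixes m a S M :: real
  assumes "m > 0" and "\<bar>a\<bar> < m" and "S < 0" and "M > 0"
  shows "\<exists>C > 0. \<forall>(R :: real) Rt rstar phistar h rst q p psi N psinf.
    kerr_star m a rstar phistar \<longrightarrow>
    kerr_time m a rstar h \<longrightarrow>
    acceptable m a h psi \<longrightarrow>
    solves_wave m a rstar phistar psi N \<longrightarrow>
    transformed_coords m a S R Rt rst q p \<longrightarrow>
    radiation_field S Rt rst q p (whiting m a S R Rt rstar phistar psi) psinf \<longrightarrow>
    regular_radiation_field psinf \<longrightarrow>
    (\<forall>(D, \<sigma>) \<in> commutators m a. \<exists>f1 f2 f3.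
       fourier_mult (\<lambda>\<xi> n. Pi_A m a M \<xi> n * Tplus_half m a \<xi> n * \<sigma> \<xi> n)
         (D (horizon_field m a psi)) f1 \<and>
       fourier_mult (\<lambda>\<xi> n. Pi_A m a M \<xi> n * \<sigma> \<xi> n) (D (horizon_field m a psi)) f2 \<and>
       fourier_mult (\<lambda>\<xi> n. Pi_A m a M \<xi> n * \<sigma> \<xi> n) (dT (D (scri_field psinf))) f3 \<and>
       (\<integral>\<^sup>+ z. ennreal ((cmod (f1 z))\<^sup>2 + (cmod (f2 z))\<^sup>2) \<partial>cyl)
         \<le> ennreal C * (\<integral>\<^sup>+ z. ennreal ((cmod (f3 z))\<^sup>2) \<partial>cyl))"
proof -
  interpret subextremal m a by unfold_locales (use assms in auto)
  show ?thesis
  \<comment> \<open>The constant is fixed by \<open>M\<close>, \<open>m\<close> and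
    \<open>a\<close>, ahead of all coordinate functions and fields.\<close>
  proof (intro exI[of _ "estimate_const M"] conjI allI impI ballI)
    show "estimate_const M > 0" by (rule estimate_const_pos[OF assms(4)])
  qed (clarify, rule horizon_estimate[OF assms(3,4)])
qed

end
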